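(* Let $r\geq 2$ be an integer, let $n$ be a positive integer and $c$ a real number with $2/\ln n\leq c\leq r^{-(2r+9)(r+1)}/2$, let $0<b<2^{-10}r^{-6}$, and let $G$ be a graph of order $n$. If $\mu(G)>(1-1/r-b)n$, then $G$ satisfies at least one of the following: (a) $G$ contains a subgraph isomorphic to $K_r^{+}(\lfloor c\ln n\rfloor,\ldots,\lfloor c\ln n\rfloor,\lceil n^{1-2\sqrt{c}}\rceil)$, where the first $r-1$ arguments equal $\lfloor c\ln n\rfloor$; (b) $G$ contains an induced subgraph $G_0$ which is $r$-partite, has at least $(1-4b^{1/3})n$ vertices, and has minimum degree $\delta(G_0)>(1-1/r-7b^{1/3})n$.
   Context: All graphs are finite and simple; $\ln$ is the natural logarithm. For a graph $G$, $\mu(G)$ denotes the largest eigenvalue of the adjacency matrix of $G$, and $\delta(G)$ its minimum degree. A graph is $r$-partite if its vertex set can be partitioned into $r$ independent sets. For integers $s_1\geq 2, s_2,\ldots,s_r\ge 1$, $K_r^{+}(s_1,\ldots,s_r)$ denotes the complete $r$-partite graph with parts of sizes $s_1,\ldots,s_r$ together with one additional edge joining two vertices of the first part. *)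

theory Defs
  imports
    Complex_Main
    "HOL-Library.Disjoint_Sets"
    "Graph_Theory.Digraph_Component"
    "Graph_Theory.Digraph_Isomorphism"
    "Graph_Theory.Pair_Digraph"
    "Jordan_Normal_Form.Char_Poly"
begin

text \<open>
  Finite simple graphs are the loop-free symmetric digraphs without parallel arcs, i.e. the
  instances of the locale \<^locale>\<open>graph\<close>: an edge is a pair of opposite arcs, and the degree of
  a vertex is its out-degree.
\<close>

definition adjacency_matrix :: "('a, 'b) pre_digraph \<Rightarrow> 'a list \<Rightarrow> real mat" where
  "adjacency_matrix G vs =
     mat (length vs) (length vs) (\<lambda>(i, j). if vs ! i \<rightarrow>\<^bsub>G\<^esub> vs ! j then 1 else 0)"

text \<open>
  The eigenvalues do not depend on the enumeration \<open>vs\<close> of the vertices, see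
  \<open>eigenvalue_adjacency_matrix_iff\<close>. The matrix is symmetric, so all its eigenvalues are real.
\<close>

definition graph_eigenvalues :: "('a, 'b) pre_digraph \<Rightarrow> real set" where
  "graph_eigenvalues G =
     {k. \<exists>vs. distinct vs \<and> set vs = verts G \<and> eigenvalue (adjacency_matrix G vs) k}"

definition max_eigenvalue :: "('a, 'b) pre_digraph \<Rightarrow> real" where
  "max_eigenvalue G = Max (graph_eigenvalues G)"

definition min_degree :: "('a, 'b) pre_digraph \<Rightarrow> nat" where
  "min_degree G = Min (out_degree G ` verts G)"

definition independent_set :: "('a, 'b) pre_digraph \<Rightarrow> 'a set \<Rightarrow> bool" where
  "independent_set G S \<longleftrightarrow> S \<subseteq> verts G \<and> (\<forall>u\<in>S. \<forall>v\<in>S. \<not> u \<rightarrow>\<^bsub>G\<^esub> v)"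

text \<open>As usual for \<open>r\<close>-partite graphs, parts may be empty.\<close>

definition r_partite :: "nat \<Rightarrow> ('a, 'b) pre_digraph \<Rightarrow> bool" where
  "r_partite r G \<longleftrightarrow>
     (\<exists>P :: nat \<Rightarrow> 'a set. disjoint_family_on P {..<r} \<and> (\<Union>i<r. P i) = verts G \<and>
        (\<forall>i<r. independent_set G (P i)))"

text \<open>
  \<open>K_plus [s\<^sub>1, \<dots>, s\<^sub>r]\<close> is $K_r^+(s_1, \ldots, s_r)$, for $s_1 \geq 2$. The vertex \<open>(i, j)\<close> is
  the \<open>j\<close>-th vertex of part \<open>i\<close>, with both counted from \<open>0\<close>.
\<close>

definition K_plus :: "nat list \<Rightarrow> (nat \<times> nat) pair_pre_digraph" where
  "K_plus s = (let V = (SIGMA i:{..<length s}. {..<s ! i}) in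
     \<lparr>pverts = V,
      parcs = {(u, v). u \<in> V \<and> v \<in> V \<and> (fst u \<noteq> fst v \<or> {u, v} = {(0, 0), (0, 1)})}\<rparr>)"

definition contains_copy :: "('a, 'b) pre_digraph \<Rightarrow> ('c, 'd) pre_digraph \<Rightarrow> bool" where
  "contains_copy G K \<longleftrightarrow> (\<exists>H. subgraph H G \<and> digraph_iso H K)"

lemma graph_K_plus: "graph (with_proj (K_plus s))"
proof -
  let ?V = "SIGMA i:{..<length s}. {..<s ! i}"
  have V: "finite ?V" by auto
  have "finite (parcs (K_plus s))"
    by (rule finite_subset[of _ "?V \<times> ?V"]) (use V in \<open>auto simp: K_plus_def Let_def\<close>)
  moreover have "symmetric (with_proj (K_plus s))"
    by (auto simp: symmetric_def sym_def K_plus_def Let_def insert_commute)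
  ultimately have "pair_graph (K_plus s)"
    by unfold_locales (use V in \<open>auto simp: K_plus_def Let_def doubleton_eq_iff\<close>)
  then show ?thesis by (rule pair_graph.pair_graphD_graph)
qed

lemma eigenvalue_adjacency_matrix_iff:
  fixes G :: "('a, 'b) pre_digraph"
  assumes d: "distinct vs" and s: "set vs = verts G"
  shows "eigenvalue (adjacency_matrix G vs) k \<longleftrightarrow>
    (\<exists>x :: 'a \<Rightarrow> real. (\<exists>v\<in>verts G. x v \<noteq> 0) \<and>
       (\<forall>v\<in>verts G. (\<Sum>u\<in>{u\<in>verts G. v \<rightarrow>\<^bsub>G\<^esub> u}. x u) = k * x v))"
    (is "?L \<longleftrightarrow> ?R")
proof -
  let ?n = "length vs" and ?A = "adjacency_matrix G vs"
  have fin: "finite (verts G)" using s by (metis List.finite_set)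
  have bij: "bij_betw ((!) vs) {0..<?n} (verts G)"
    using bij_betw_nth[OF d refl s[symmetric]] by (simp add: lessThan_atLeast0)
  have entry: "(?A *\<^sub>v vec ?n (\<lambda>i. x (vs ! i))) $ i =
      (\<Sum>u\<in>{u\<in>verts G. vs ! i \<rightarrow>\<^bsub>G\<^esub> u}. x u)" if "i < ?n" for x :: "'a \<Rightarrow> real" and i
  proof -
    have "(?A *\<^sub>v vec ?n (\<lambda>i. x (vs ! i))) $ i =
        (\<Sum>j\<in>{0..<?n}. (if vs ! i \<rightarrow>\<^bsub>G\<^esub> vs ! j then 1 else 0) * x (vs ! j))"
      using that by (simp add: adjacency_matrix_def scalar_prod_def)
    also have "\<dots> = (\<Sum>u\<in>verts G. (if vs ! i \<rightarrow>\<^bsub>G\<^esub> u then 1 else 0) * x u)"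
      by (rule sum.reindex_bij_betw[OF bij])
    also have "\<dots> = (\<Sum>u\<in>{u\<in>verts G. vs ! i \<rightarrow>\<^bsub>G\<^esub> u}. x u)"
      using fin by (intro sum.mono_neutral_cong_right) auto
    finally show ?thesis .
  qed
  have all: "(\<forall>v\<in>verts G. P v) \<longleftrightarrow> (\<forall>i<?n. P (vs ! i))" for P
    by (simp add: all_set_conv_all_nth flip: s)
  have ev: "eigenvector ?A (vec ?n (\<lambda>i. x (vs ! i))) k \<longleftrightarrow>
      (\<exists>v\<in>verts G. x v \<noteq> 0) \<and>
      (\<forall>v\<in>verts G. (\<Sum>u\<in>{u\<in>verts G. v \<rightarrow>\<^bsub>G\<^esub> u}. x u) = k * x v)" for x :: "'a \<Rightarrow> real"
  proof -
    have dim: "dim_row ?A = ?n" by (simp add: adjacency_matrix_def)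
    have "vec ?n (\<lambda>i. x (vs ! i)) \<noteq> 0\<^sub>v ?n \<longleftrightarrow> \<not> (\<forall>v\<in>verts G. x v = 0)"
      unfolding all by (auto simp: vec_eq_iff)
    moreover have "?A *\<^sub>v vec ?n (\<lambda>i. x (vs ! i)) = k \<cdot>\<^sub>v vec ?n (\<lambda>i. x (vs ! i)) \<longleftrightarrow>
        (\<forall>v\<in>verts G. (\<Sum>u\<in>{u\<in>verts G. v \<rightarrow>\<^bsub>G\<^esub> u}. x u) = k * x v)"
      unfolding all vec_eq_iff using entry by (auto simp: dim)
    ultimately show ?thesis unfolding eigenvector_def dim by auto
  qed
  show ?thesis
  proof
    assume ?L
    then obtain v where v: "eigenvector ?A v k" by (auto simp: eigenvalue_def)
    define x where "x u = v $ (the_inv_into {0..<?n} ((!) vs) u)" for u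
    have "v = vec ?n (\<lambda>i. x (vs ! i))"
    proof (rule eq_vecI)
      show "dim_vec v = dim_vec (vec ?n (\<lambda>i. x (vs ! i)))"
        using v by (auto simp: eigenvector_def adjacency_matrix_def)
    next
      fix i assume "i < dim_vec (vec ?n (\<lambda>i. x (vs ! i)))"
      then show "v $ i = vec ?n (\<lambda>i. x (vs ! i)) $ i"
        using bij by (simp add: x_def bij_betw_def the_inv_into_f_f)
    qed
    with v ev[of x] show ?R by auto
  next
    assume ?R
    then show ?L using ev unfolding eigenvalue_def by blast
  qed
qed

end

theory Submission
  imports Defs "HOL-Analysis.Analysis"
begin

text \<open>
  Let \<open>x\<close> be a nonnegative unit eigenvector for the largest eigenvalue \<open>\<mu>\<close> of a graph on \<open>m\<close>
  vertices. If some degree is at most \<open>\<mu> - e m\<close>, then the smallest entry of \<open>x\<close> satisfies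
  \<open>x\<^sub>k\<^sup>2 \<le> 1 / ((1 + 2 e) m)\<close>, and deleting \<open>k\<close> raises \<open>\<mu> / (m - 1)\<close> by a factor
  \<open>1 + 2 e / ((1 + 2 e) m)\<close>. Delete vertices as long as some degree is at most
  \<open>(1 - 1/r - 1/(48 r\<^sup>4)) m\<close>.

  If this goes on for \<open>n / (2 r)\<close> steps, then \<open>\<mu> \<ge> (1 - 1/r + \<delta>) m\<close> with \<open>\<delta>\<close> depending only on \<open>r\<close>.
  The entries of \<open>x\<close>, normalised to total weight 1, are at most \<open>1/\<mu>\<close>, so a weighted Moon--Moser
  inequality yields a positive density of \<open>(r + 1)\<close>-cliques, hence of \<open>r\<close>-cliques in some
  neighbourhood \<open>N(v)\<close>; a pigeonhole argument blows these up to a complete \<open>r\<close>-partite graph,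
  which together with \<open>v\<close> contains the required graph.

  Otherwise the deletion stops at a graph of large minimum degree. If one of its edges \<open>u v\<close> lies in
  many \<open>(r + 1)\<close>-cliques, then the \<open>(r - 1)\<close>-cliques in \<open>N(u) \<inter> N(v)\<close>, each extended by a
  further common neighbour, are blown up, and \<open>u\<close>, \<open>v\<close> are added to the part of the extending
  vertices. If there is no such edge, then the graph is \<open>r\<close>-partite. In that case
  \<open>\<mu> \<le> (1 - 1/r) m\<close>, so only \<open>O(b n)\<close> vertices have been deleted, and as \<open>\<mu>\<close> is almost maximal among
  \<open>r\<close>-partite graphs, \<open>x\<close> is almost constant, the parts are almost equal and almost all vertices
  have almost full degree; removing the others gives the second alternative.
\<close>

section \<open>Complete multipartite subgraphs from many cliques\<close>

text \<open>The vertex of small degree and the deleted vertex differ: the former only certifies that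
  the smallest Perron entry is small, the latter carries this entry and so costs the Rayleigh
  quotient least. Over about \<open>n / (2 r)\<close> deletions the gains accumulate to a factor of
  about \<open>1 + 1 / (64 r^5)\<close>. This beats the deficit \<open>b < 1 / (1024 r^6)\<close>
  and leaves a surplus over the Turan density, without which no \<open>(r + 1)\<close>-clique need
  exist. Both sources of cliques feed the same blow-up, with a constant \<open>D\<close> that does
  not depend on \<open>n\<close>. Parts of size \<open>s \<le> c ln n\<close> then cost a factor of
  at most \<open>(3 D)^(2 s)\<close>, and the upper bound on \<open>c\<close> keeps this below
  \<open>n^(2 sqrt c)\<close>: hence the exponent \<open>1 - 2 sqrt c\<close> of the last part. In
  the partite case the Turan bound for \<open>\<mu>\<close> is used as an exact identity, so that
  almost-equality can be read off from its two nonnegative deficits.\<close>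

locale adjacency =
  fixes E :: "'a \<Rightarrow> 'a \<Rightarrow> bool"
  assumes E_sym: "E u v \<Longrightarrow> E v u" and E_irrefl: "\<not> E u u"
begin

text \<open>Cliques are ordered, so a clique on \<open>k\<close> vertices is counted \<open>k!\<close> times.\<close>

definition cliques :: "nat \<Rightarrow> 'a set \<Rightarrow> 'a list set" where
  "cliques k S = {xs. length xs = k \<and> distinct xs \<and> set xs \<subseteq> S \<and> pairwise E (set xs)}"

definition nbrs :: "'a set \<Rightarrow> 'a \<Rightarrow> 'a set" where
  "nbrs S v = {u \<in> S. E v u}"

definition common :: "'a set \<Rightarrow> 'a list \<Rightarrow> 'a set" where
  "common S xs = {w \<in> S. \<forall>x\<in>set xs. E w x}"

lemma finite_cliques [simp]: "finite S \<Longrightarrow> finite (cliques k S)"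
  by (rule finite_subset[OF _ finite_lists_length_eq[of S k]]) (auto simp: cliques_def)

lemma finite_nbrs [simp]: "finite S \<Longrightarrow> finite (nbrs S v)"
  by (simp add: nbrs_def)

lemma finite_common [simp]: "finite S \<Longrightarrow> finite (common S xs)"
  by (simp add: common_def)

lemma card_cliques_le: "finite S \<Longrightarrow> card (cliques k S) \<le> card S ^ k"
  using card_mono[OF finite_lists_length_eq[of S k], of "cliques k S"]
  by (auto simp: cliques_def card_lists_length_eq)

lemma cliques_mono: "S \<subseteq> T \<Longrightarrow> cliques k S \<subseteq> cliques k T"
  by (auto simp: cliques_def)

lemma Cons_in_cliques_iff:
  "x # xs \<in> cliques (Suc k) S \<longleftrightarrow> xs \<in> cliques k S \<and> x \<in> common S xs"
  using E_irrefl E_sym by (auto simp: cliques_def common_def pairwise_insert)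

lemma cliques_0 [simp]: "cliques 0 S = {[]}"
  by (auto simp: cliques_def)

end

lemma pigeonhole_fibre:
  assumes "finite X" "finite Y" "f ` X \<subseteq> Y" "Y \<noteq> {}"
  obtains y where "y \<in> Y" "card X \<le> card Y * card {x \<in> X. f x = y}"
proof -
  have "\<exists>y\<in>Y. card X \<le> card Y * card {x \<in> X. f x = y}"
  proof (rule ccontr)
    assume *: "\<not> ?thesis"
    have "card Y * card X = card Y * (\<Sum>y\<in>Y. card {x \<in> X. f x = y})"
      using sum_card_image[OF assms(1)] card_eq_sum sum.group[OF assms(1-3), of "\<lambda>_. 1::nat"]
      by simp
    also have "\<dots> = (\<Sum>y\<in>Y. card Y * card {x \<in> X. f x = y})" by (simp add: sum_distrib_left)
    also have "\<dots> < (\<Sum>y\<in>Y. card X)"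
      using * assms by (intro sum_strict_mono) auto
    finally show False by simp
  qed
  then show thesis using that by blast
qed

context adjacency
begin

text \<open>
  The tuples \<open>a i\<close> are pairwise disjoint cliques with all edges between different coordinates. In the
  induction step the lemma is applied with \<open>D * s\<close> in place of \<open>s\<close> to the tuples having at least
  \<open>2 n / D\<close> extensions. At least \<open>n / D\<close> vertices extend \<open>s\<close> or more of the \<open>D * s\<close> tuples found,
  and by pigeonhole many of these vertices extend the same \<open>s\<close> tuples.
\<close>

lemma clique_blowup:
  assumes "finite V" "card V = n" "M \<subseteq> cliques (Suc k) V" "D > 0" "s > 0"
    and "2 * Suc k * n ^ Suc k \<le> D * card M"
    and "D ^ Suc k * s \<le> n"
    and "\<And>j. 1 \<le> j \<Longrightarrow> j < k \<Longrightarrow> D * (s * D ^ j) * (D * (s * D ^ j) choose (s * D ^ j)) \<le> n"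
  shows "\<exists>a W. (\<forall>i<s. length (a i) = k) \<and> W \<subseteq> V \<and>
      n \<le> D * (if k = 0 then 1 else D * s choose s) * card W \<and>
      (\<forall>i<s. \<forall>w\<in>W. w # a i \<in> M) \<and>
      (\<forall>i<s. \<forall>i'<s. \<forall>j<k. \<forall>j'<k. j \<noteq> j' \<longrightarrow> E (a i ! j) (a i' ! j')) \<and>
      (\<forall>j<k. inj_on (\<lambda>i. a i ! j) {..<s})"
  using assms(3,5-8)
proof (induction k arbitrary: M s)
  case 0
  define W where "W = {w \<in> V. [w] \<in> M}"
  have "M = (\<lambda>w. [w]) ` W"
    using 0(1) by (auto simp: W_def cliques_def length_Suc_conv) 
  then have "card M = card W" by (simp add: card_image inj_on_def)
  with 0 show ?case
    by (intro exI[of _ "\<lambda>_. []"] exI[of _ W]) (auto simp: W_def)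
next
  case (Suc k)
  have "0 < D ^ Suc (Suc k) * s" using assms(4) Suc.prems(2) by simp
  then have npos: "n > 0" using Suc.prems(4) by linarith
  define ext where "ext y = {w \<in> V. w # y \<in> M}" for y
  define R where "R = {y \<in> cliques (Suc k) V. 2 * n \<le> D * card (ext y)}"
  have fin_ext: "finite (ext y)" and card_ext: "card (ext y) \<le> n" for y
    using assms(1) card_mono[OF assms(1), of "ext y"] assms(2) by (auto simp: ext_def)
  have "M = (\<Union>y\<in>cliques (Suc k) V. (\<lambda>w. w # y) ` ext y)"
  proof (intro equalityI subsetI)
    fix xs assume "xs \<in> M"
    with Suc.prems(1) obtain w y where "xs = w # y" "y \<in> cliques (Suc k) V" "w \<in> V"
      by (cases xs) (auto simp: Cons_in_cliques_iff common_def, auto simp: cliques_def)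
    with \<open>xs \<in> M\<close> show "xs \<in> (\<Union>y\<in>cliques (Suc k) V. (\<lambda>w. w # y) ` ext y)"
      by (auto simp: ext_def)
  qed (auto simp: ext_def)
  then have "card M = (\<Sum>y\<in>cliques (Suc k) V. card ((\<lambda>w. w # y) ` ext y))"
    using assms(1) fin_ext by (simp only:, intro card_UN_disjoint) auto
  also have "\<dots> = (\<Sum>y\<in>cliques (Suc k) V. card (ext y))"
    by (intro sum.cong card_image) (auto simp: inj_on_def)
  finally have "D * card M = (\<Sum>y\<in>cliques (Suc k) V. D * card (ext y))"
    by (simp add: sum_distrib_left)
  also have "\<dots> \<le> (\<Sum>y\<in>cliques (Suc k) V. 2 * n + (if y \<in> R then D * n else 0))"
    using card_ext by (intro sum_mono) (auto simp: R_def trans_le_add2)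
  also have "\<dots> = 2 * n * card (cliques (Suc k) V) + D * n * card R"
    using assms(1) by (simp add: sum.distrib sum.If_cases R_def Int_def conj_commute) 
  also have "\<dots> \<le> 2 * n * n ^ Suc k + D * n * card R"
    using card_cliques_le[OF assms(1), of "Suc k"] assms(2) by (intro add_mono mult_le_mono) auto
  \<comment> \<open>Tuples outside \<open>R\<close> account for at most
    \<open>2 * n * n ^ Suc k\<close>, one unit of the factor \<open>2 * Suc (Suc k)\<close>. What
    remains is the hypothesis for \<open>R\<close> one level down.\<close>
  finally have "2 * Suc (Suc k) * n ^ Suc (Suc k) \<le> 2 * n * n ^ Suc k + D * n * card R"
    using Suc.prems(3) by linarith
  then have "n * (2 * Suc k * n ^ Suc k) \<le> n * (D * card R)"
    by (simp add: algebra_simps)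
  then have R: "2 * Suc k * n ^ Suc k \<le> D * card R" using npos by simp
  define p where "p = D * s"
  have p: "p > 0" using assms(4) Suc.prems(2) by (simp add: p_def)
  have cond: "D * (p * D ^ j) * (D * (p * D ^ j) choose (p * D ^ j)) \<le> n"
    if "1 \<le> j" "j < k" for j
    using Suc.prems(5)[of "Suc j"] that by (simp add: p_def mult_ac)
  have "D ^ Suc k * p \<le> n" using Suc.prems(4) by (simp add: p_def mult_ac)
  have Rsub: "R \<subseteq> cliques (Suc k) V" by (auto simp: R_def)
  have "\<exists>a W. (\<forall>i<p. length (a i) = k) \<and> W \<subseteq> V \<and>
      n \<le> D * (if k = 0 then 1 else D * p choose p) * card W \<and>
      (\<forall>i<p. \<forall>w\<in>W. w # a i \<in> R) \<and>
      (\<forall>i<p. \<forall>i'<p. \<forall>j<k. \<forall>j'<k. j \<noteq> j' \<longrightarrow> E (a i ! j) (a i' ! j')) \<and>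
      (\<forall>j<k. inj_on (\<lambda>i. a i ! j) {..<p})"
    by (rule Suc.IH[OF Rsub p R \<open>D ^ Suc k * p \<le> n\<close>]) (rule cond)
  then obtain a W where aW: "\<forall>i<p. length (a i) = k" "W \<subseteq> V"
      "n \<le> D * (if k = 0 then 1 else D * p choose p) * card W"
      "\<forall>i<p. \<forall>w\<in>W. w # a i \<in> R"
      "\<forall>i<p. \<forall>i'<p. \<forall>j<k. \<forall>j'<k. j \<noteq> j' \<longrightarrow> E (a i ! j) (a i' ! j')"
      "\<forall>j<k. inj_on (\<lambda>i. a i ! j) {..<p}"
    by (elim exE conjE)
  note W = aW(2) and cardW = aW(3)
  have a: "\<And>i. i < p \<Longrightarrow> length (a i) = k"
    and aM: "\<And>i w. i < p \<Longrightarrow> w \<in> W \<Longrightarrow> w # a i \<in> R"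
    and aE: "\<And>i i' j j'. i < p \<Longrightarrow> i' < p \<Longrightarrow> j < k \<Longrightarrow> j' < k \<Longrightarrow> j \<noteq> j' \<Longrightarrow> E (a i ! j) (a i' ! j')"
    and ainj: "\<And>j. j < k \<Longrightarrow> inj_on (\<lambda>i. a i ! j) {..<p}"
    using aW by blast+
  \<comment> \<open>Every tuple gets its own head \<open>w i\<close>, so that the new coordinate is
    injective; this takes \<open>p\<close> elements of \<open>W\<close>. The last hypothesis at
    \<open>j = 1\<close> supplies them, and for \<open>k = 0\<close>, where it is void, the bound on
    the power of \<open>D\<close> does.\<close>
  have pW: "p \<le> card W"
  proof (cases "k = 0")
    case True
    have "D * p \<le> n" using Suc.prems(4) True by (simp add: p_def mult.assoc)
    moreover have "n \<le> D * card W" using cardW True by simp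
    ultimately have "D * p \<le> D * card W" by (rule order_trans)
    then show ?thesis using assms(4) by simp
  next
    case False
    let ?C = "D * p choose p"
    have C: "?C > 0" using assms(4) by simp
    have "D * p * ?C \<le> n" using Suc.prems(5)[of 1] False by (simp add: p_def mult_ac)
    also have "n \<le> D * ?C * card W" using cardW False by simp
    finally have "(D * ?C) * p \<le> (D * ?C) * card W" by (simp add: mult_ac)
    then show ?thesis using C assms(4) by simp
  qed
  have finW: "finite W" using W assms(1) finite_subset by blast
  obtain w where w: "inj_on w {..<p}" "w ` {..<p} \<subseteq> W"
    using card_le_inj[of "{..<p}" W] finW pW by auto
  define y where "y i = w i # a i" for i
  have yR: "y i \<in> R" if "i < p" for i using aM w that by (auto simp: y_def)
  define I where "I v = {i \<in> {..<p}. v # y i \<in> M}" for v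
  have finI: "finite (I v)" for v by (simp add: I_def)
  define X where "X = {v \<in> V. s \<le> card (I v)}"
  \<comment> \<open>Double counting of the pairs \<open>(i, v)\<close> with
    \<open>v # y i \<in> M\<close>. Vertices outside \<open>X\<close> contribute at most
    \<open>D * s * n = p * n\<close>, half of the lower bound, so those in \<open>X\<close> carry
    the other half.\<close>
  have "p * (2 * n) \<le> (\<Sum>i<p. D * card (ext (y i)))"
    using yR sum_mono[of "{..<p}" "\<lambda>_. 2 * n"] by (simp add: R_def)
  also have "\<dots> = D * (\<Sum>i<p. \<Sum>v\<in>V. if v # y i \<in> M then 1 else 0)"
    using assms(1) by (simp add: sum_distrib_left ext_def sum.If_cases Int_def)
  also have "\<dots> = D * (\<Sum>v\<in>V. \<Sum>i<p. if v # y i \<in> M then 1 else 0)"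
    by (subst sum.swap) simp
  also have "\<dots> = D * (\<Sum>v\<in>V. card (I v))"
    by (simp add: I_def sum.If_cases Int_def)
  also have "\<dots> \<le> D * (\<Sum>v\<in>V. s + (if v \<in> X then p else 0))"
  proof -
    have "card (I v) \<le> p" for v using card_mono[of "{..<p}" "I v"] by (auto simp: I_def)
    then show ?thesis by (intro mult_le_mono sum_mono) (auto simp: X_def trans_le_add2)
  qed
  also have "\<dots> = D * (s * n + p * card X)"
    using assms(1,2) by (simp add: sum.distrib sum.If_cases X_def Int_def conj_commute)
  also have "\<dots> = p * (n + D * card X)" by (simp add: p_def algebra_simps)
  finally have cardX: "n \<le> D * card X" using p by simp
  have "\<exists>T. T \<subseteq> I v \<and> card T = s" if "v \<in> X" for v
    using obtain_subset_with_card_n[of s "I v"] that by (auto simp: X_def) 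
  then obtain T where T: "\<And>v. v \<in> X \<Longrightarrow> T v \<subseteq> I v \<and> card (T v) = s" by metis
  define Y where "Y = {B. B \<subseteq> {..<p} \<and> card B = s}"
  have cardY: "card Y = D * s choose s" using n_subsets[of "{..<p}" s] by (simp add: Y_def p_def)
  have "0 < (D * s choose s)" using assms(4) by simp
  then have Y: "Y \<noteq> {}" using cardY by auto
  have TX: "T ` X \<subseteq> Y" using T by (auto simp: Y_def I_def)
  have fin: "finite X" "finite Y" using assms(1) by (auto simp: X_def Y_def)
  obtain B where B: "B \<in> Y" "card X \<le> card Y * card {v \<in> X. T v = B}"
    by (rule pigeonhole_fibre[OF fin TX Y])
  define W' where "W' = {v \<in> X. T v = B}"
  have finB: "finite B" and BpB: "B \<subseteq> {..<p}" "card B = s" using B finite_subset by (auto simp: Y_def)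
  obtain e where e: "bij_betw e {..<s} B"
    using ex_bij_betw_nat_finite[OF finB] BpB(2) by (auto simp: atLeast0LessThan)
  have ep: "e i < p" if "i < s" for i using e that BpB by (auto simp: bij_betw_def)
  have einj: "inj_on e {..<s}" using e by (simp add: bij_betw_def)
  have "n \<le> D * (D * s choose s) * card W'"
    using cardX B(2) cardY by (metis W'_def mult.assoc mult_le_mono2 order_trans)
  moreover have "v # y (e i) \<in> M" if "i < s" "v \<in> W'" for i v
    using that T e by (auto simp: W'_def I_def bij_betw_def)
  moreover have "E (y (e i) ! j) (y (e i') ! j')"
    if "i < s" "i' < s" "j < Suc k" "j' < Suc k" "j \<noteq> j'" for i i' j j'
  proof -
    \<comment> \<open>Each element of \<open>W\<close> extends every tuple \<open>a l'\<close>, not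
      only the one whose head it becomes.\<close>
    have *: "E (w l) (a l' ! q)" if "l < p" "l' < p" "q < k" for l l' q
    proof -
      have "w l # a l' \<in> cliques (Suc k) V" using aM[of l' "w l"] w that by (auto simp: R_def)
      then show ?thesis using that a[of l'] by (auto simp: Cons_in_cliques_iff common_def)
    qed
    have el: "e i < p" "e i' < p" using ep that by auto
    show ?thesis
    proof (cases j)
      case 0
      with that obtain l where "j' = Suc l" "l < k" by (cases j') auto
      with 0 show ?thesis using *[OF el, of l] by (simp add: y_def)
    next
      case (Suc q)
      show ?thesis
      proof (cases j')
        case 0
        with Suc that show ?thesis using E_sym[OF *[OF el(2,1), of q]] by (simp add: y_def)
      next
        case (Suc q')
        with \<open>j = Suc q\<close> that show ?thesis using aE[OF el, of q q'] by (simp add: y_def)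
      qed
    qed
  qed
  moreover have "inj_on (\<lambda>i. y (e i) ! j) {..<s}" if "j < Suc k" for j
  proof -
    have "inj_on (\<lambda>i. y i ! j) {..<p}"
      using that w ainj[of "j - 1"] by (cases j) (auto simp: y_def)
    then show ?thesis using einj ep by (auto simp: inj_on_def)
  qed
  moreover have "length (y (e i)) = Suc k" if "i < s" for i using a ep[OF that] by (simp add: y_def)
  moreover have "W' \<subseteq> V" by (auto simp: W'_def X_def)
  ultimately show ?case by (intro exI[of _ "\<lambda>i. y (e i)"] exI[of _ W']) simp
qed

end

text \<open>The binomial coefficient is at most \<open>(D m)^m / m!\<close>, and
  \<open>m^m / m!\<close> is a single term of the series for \<open>e^m\<close>. This makes the
  pigeonhole loss of the blow-up a power of \<open>3 D\<close>.\<close>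

lemma binomial_mult_le: "real (D * m choose m) \<le> (3 * real D) ^ m"
proof -
  have "real (D * m choose m) * fact m \<le> (real D * real m) ^ m"
    using binomial_fact_pow[of "D * m" m]
    by (metis of_nat_fact of_nat_le_iff of_nat_mult of_nat_power)
  also have "\<dots> = real D ^ m * real m ^ m" by (simp add: power_mult_distrib)
  also have "real m ^ m \<le> 3 ^ m * fact m"
  proof -
    have "real m ^ m / fact m \<le> exp (real m)"
      using sum_le_suminf[OF summable_exp_generic[of "real m"], of "{m}"]
      by (simp add: exp_def scaleR_conv_of_real divide_inverse mult.commute)
    also have "\<dots> = exp 1 ^ m" by (simp add: exp_of_nat_mult[of m 1, simplified])
    also have "\<dots> \<le> 3 ^ m" by (intro power_mono exp_le) auto
    finally show ?thesis by (simp add: field_simps)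
  qed
  finally have "real (D * m choose m) * fact m \<le> real D ^ m * (3 ^ m * fact m)"
    by (simp add: mult_left_mono)
  then show ?thesis by (simp add: power_mult_distrib mult_ac)
qed

section \<open>Weighted clique counts\<close>

definition insert_nth :: "nat \<Rightarrow> 'a \<Rightarrow> 'a list \<Rightarrow> 'a list" where
  "insert_nth i x xs = take i xs @ x # drop i xs"

definition remove_nth :: "nat \<Rightarrow> 'a list \<Rightarrow> 'a list" where
  "remove_nth i xs = take i xs @ drop (Suc i) xs"

lemma set_insert_nth: "set (insert_nth i x xs) = insert x (set xs)"
  unfolding insert_nth_def by (metis append_take_drop_id set_append list.set(2) Un_insert_right)

lemma distinct_insert_nth: "distinct (insert_nth i x xs) \<longleftrightarrow> x \<notin> set xs \<and> distinct xs"
proof -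
  have "distinct (insert_nth i x xs) \<longleftrightarrow>
      x \<notin> set (take i xs @ drop i xs) \<and> distinct (take i xs @ drop i xs)"
    by (auto simp: insert_nth_def simp del: append_take_drop_id)
  then show ?thesis by (simp only: append_take_drop_id)
qed

lemma length_insert_nth [simp]: "length (insert_nth i x xs) = Suc (length xs)"
  by (simp add: insert_nth_def)

lemma remove_insert_nth: "i \<le> length xs \<Longrightarrow> remove_nth i (insert_nth i x xs) = xs"
  by (simp add: insert_nth_def remove_nth_def)

lemma nth_insert_nth: "i \<le> length xs \<Longrightarrow> insert_nth i x xs ! i = x"
  by (simp add: insert_nth_def nth_append)

lemma insert_remove_nth: "i < length xs \<Longrightarrow> insert_nth i (xs ! i) (remove_nth i xs) = xs"
  by (simp add: insert_nth_def remove_nth_def id_take_nth_drop[symmetric])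

lemma nth_in_remove_nth:
  assumes "i < length xs" "j < length xs" "i \<noteq> j"
  shows "xs ! j \<in> set (remove_nth i xs)"
proof (cases "j < i")
  case True
  then show ?thesis using assms by (auto simp: remove_nth_def in_set_conv_nth intro!: exI[of _ j])
next
  case False
  then have "xs ! j = drop (Suc i) xs ! (j - Suc i)" "j - Suc i < length (drop (Suc i) xs)"
    using assms by auto
  then show ?thesis unfolding remove_nth_def by (metis UnI2 nth_mem set_append)
qed

lemma prod_list_insert_nth:
  "prod_list (map y (insert_nth i x xs)) = (y x :: 'b :: comm_monoid_mult) * prod_list (map y xs)"
proof -
  have "prod_list (map y xs) = prod_list (map y (take i xs)) * prod_list (map y (drop i xs))"
    by (metis append_take_drop_id map_append prod_list.append)
  then show ?thesis by (simp add: insert_nth_def mult_ac)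
qed

context adjacency
begin

lemma insert_nth_in_cliques_iff:
  "insert_nth i x xs \<in> cliques (Suc k) S \<longleftrightarrow> xs \<in> cliques k S \<and> x \<in> common S xs"
  using E_irrefl E_sym
  by (auto simp: cliques_def common_def pairwise_insert set_insert_nth distinct_insert_nth)

lemma bij_betw_insert_nth:
  assumes "i \<le> k"
  shows "bij_betw (\<lambda>(xs, x). insert_nth i x xs) (SIGMA xs:cliques k S. common S xs) (cliques (Suc k) S)"
proof (rule bij_betw_byWitness[where f' = "\<lambda>ys. (remove_nth i ys, ys ! i)"])
  show "\<forall>a\<in>SIGMA xs:cliques k S. common S xs.
      (remove_nth i (case a of (xs, x) \<Rightarrow> insert_nth i x xs),
       (case a of (xs, x) \<Rightarrow> insert_nth i x xs) ! i) = a"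
    using assms by (auto simp: cliques_def remove_insert_nth nth_insert_nth)
  show *: "\<forall>ys\<in>cliques (Suc k) S.
      (case (remove_nth i ys, ys ! i) of (xs, x) \<Rightarrow> insert_nth i x xs) = ys"
    using assms by (auto simp: cliques_def insert_remove_nth)
  show "(\<lambda>(xs, x). insert_nth i x xs) ` (SIGMA xs:cliques k S. common S xs) \<subseteq> cliques (Suc k) S"
    by (auto simp: insert_nth_in_cliques_iff)
  show "(\<lambda>ys. (remove_nth i ys, ys ! i)) ` cliques (Suc k) S \<subseteq> (SIGMA xs:cliques k S. common S xs)"
  proof clarify
    fix ys assume "ys \<in> cliques (Suc k) S"
    with * have "insert_nth i (ys ! i) (remove_nth i ys) \<in> cliques (Suc k) S" by simp
    then show "remove_nth i ys \<in> cliques k S \<and> ys ! i \<in> common S (remove_nth i ys)"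
      by (simp only: insert_nth_in_cliques_iff)
  qed
qed

text \<open>Removing coordinate \<open>i\<close> splits a clique into a smaller one and a common
  neighbour of it. The position is free because the Moon--Moser argument and the choice of a typical
  clique run over all positions.\<close>

lemma sum_cliques_Suc:
  fixes f :: "'a list \<Rightarrow> 'a \<Rightarrow> 'b :: comm_monoid_add"
  assumes "finite S" "i \<le> k"
  shows "(\<Sum>ys\<in>cliques (Suc k) S. f (remove_nth i ys) (ys ! i)) =
    (\<Sum>xs\<in>cliques k S. \<Sum>x\<in>common S xs. f xs x)"
proof -
  have "(\<Sum>xs\<in>cliques k S. \<Sum>x\<in>common S xs. f xs x) =
      (\<Sum>(xs, x)\<in>(SIGMA xs:cliques k S. common S xs). f xs x)"
    using assms by (simp add: sum.Sigma)
  also have "\<dots> = (\<Sum>p\<in>(SIGMA xs:cliques k S. common S xs).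
      (\<lambda>ys. f (remove_nth i ys) (ys ! i)) (case p of (xs, x) \<Rightarrow> insert_nth i x xs))"
    using assms by (intro sum.cong) (auto simp: cliques_def remove_insert_nth nth_insert_nth)
  also have "\<dots> = (\<Sum>ys\<in>cliques (Suc k) S. f (remove_nth i ys) (ys ! i))"
    by (rule sum.reindex_bij_betw[OF bij_betw_insert_nth[OF assms(2)]])
  finally show ?thesis by simp
qed

lemma card_cliques_Suc:
  "finite S \<Longrightarrow> card (cliques (Suc k) S) = (\<Sum>xs\<in>cliques k S. card (common S xs))"
  using sum_cliques_Suc[of S 0 k "\<lambda>_ _. 1 :: nat"] by simp

end

text \<open>Cliques are counted with vertex weights \<open>y\<close> of total mass 1, as a Perron vector is
  in general far from constant.\<close>

locale weighted_adjacency = adjacency E for E :: "'a \<Rightarrow> 'a \<Rightarrow> bool" +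
  fixes S :: "'a set" and y :: "'a \<Rightarrow> real"
  assumes finite_S: "finite S" and y_nonneg: "v \<in> S \<Longrightarrow> 0 \<le> y v" and sum_y: "sum y S = 1"
begin

text \<open>The probability that \<open>k\<close> independent vertices with distribution
  \<open>y\<close> form a clique.\<close>

definition clique_weight :: "nat \<Rightarrow> real" where
  "clique_weight k = (\<Sum>xs\<in>cliques k S. prod_list (map y xs))"

definition common_weight :: "'a list \<Rightarrow> real" where
  "common_weight xs = sum y (common S xs)"

lemma weight_nonneg: "xs \<in> cliques k S \<Longrightarrow> 0 \<le> prod_list (map y xs)"
  by (rule prod_list_nonneg) (auto simp: cliques_def intro: y_nonneg)

lemma clique_weight_Suc:
  "clique_weight (Suc k) = (\<Sum>xs\<in>cliques k S. prod_list (map y xs) * common_weight xs)"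
proof -
  have "clique_weight (Suc k) =
      (\<Sum>ys\<in>cliques (Suc k) S. prod_list (map y (remove_nth 0 ys)) * y (ys ! 0))"
    unfolding clique_weight_def
    by (intro sum.cong) (auto simp: cliques_def remove_nth_def length_Suc_conv mult.commute)
  also have "\<dots> = (\<Sum>xs\<in>cliques k S. \<Sum>x\<in>common S xs. prod_list (map y xs) * y x)"
    using finite_S by (rule sum_cliques_Suc) simp
  finally show ?thesis by (simp add: common_weight_def sum_distrib_left)
qed

lemma clique_weight_1: "clique_weight 1 = 1"
  using clique_weight_Suc[of 0] by (simp add: common_weight_def common_def sum_y)

text \<open>A vertex with a non-neighbour \<open>xs ! j\<close> can be counted only for
  \<open>i = j\<close>, hence at most once; a common neighbour of \<open>xs\<close> is counted
  \<open>k + 1\<close> times.\<close>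

lemma sum_common_weight_remove_le:
  assumes "xs \<in> cliques (Suc k) S"
  shows "(\<Sum>i<Suc k. common_weight (remove_nth i xs)) \<le> 1 + real k * common_weight xs"
proof -
  have len: "length xs = Suc k" using assms by (simp add: cliques_def)
  let ?N = "\<lambda>w. {i \<in> {..<Suc k}. w \<in> common S (remove_nth i xs)}"
  have "(\<Sum>i<Suc k. common_weight (remove_nth i xs)) =
      (\<Sum>i<Suc k. \<Sum>w\<in>S. if w \<in> common S (remove_nth i xs) then y w else 0)"
    unfolding common_weight_def using finite_S
    by (intro sum.cong[OF refl] sum.mono_neutral_cong_left) (auto simp: common_def)
  also have "\<dots> = (\<Sum>w\<in>S. \<Sum>i<Suc k. if w \<in> common S (remove_nth i xs) then y w else 0)"
    by (rule sum.swap)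
  also have "\<dots> = (\<Sum>w\<in>S. y w * real (card (?N w)))"
    by (simp add: sum.If_cases Int_def mult.commute del: sum.lessThan_Suc)
  also have "\<dots> \<le> (\<Sum>w\<in>S. y w * (1 + real k * (if w \<in> common S xs then 1 else 0)))"
  proof (intro sum_mono mult_left_mono y_nonneg)
    fix w assume w: "w \<in> S"
    show "real (card (?N w)) \<le> 1 + real k * (if w \<in> common S xs then 1 else 0)"
    proof (cases "w \<in> common S xs")
      case True
      have "card (?N w) \<le> card {..<Suc k}" by (intro card_mono) auto
      with True show ?thesis by simp
    next
      case False
      with w obtain j where j: "j < Suc k" "\<not> E w (xs ! j)"
        using len by (auto simp: common_def in_set_conv_nth)
      have "?N w \<subseteq> {j}"
      proof
        fix i assume i: "i \<in> ?N w"
        show "i \<in> {j}"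
        proof (rule ccontr)
          assume "i \<notin> {j}"
          then have "xs ! j \<in> set (remove_nth i xs)"
            using i j(1) len by (intro nth_in_remove_nth) auto
          with i j(2) show False by (auto simp: common_def)
        qed
      qed
      then have "card (?N w) \<le> card {j}" by (intro card_mono) auto
      with False show ?thesis by simp
    qed
  qed
  also have "\<dots> = (\<Sum>w\<in>S. y w) + real k * (\<Sum>w\<in>S. if w \<in> common S xs then y w else 0)"
    unfolding sum_distrib_left sum.distrib[symmetric] by (intro sum.cong) (auto simp: algebra_simps)
  also have "(\<Sum>w\<in>S. if w \<in> common S xs then y w else 0) = common_weight xs"
    unfolding common_weight_def using finite_S
    by (intro sum.mono_neutral_cong_right) (auto simp: common_def)
  finally show ?thesis by (simp add: sum_y)
qed

text \<open>Cauchy--Schwarz for \<open>clique_weight (Suc k)\<close>, seen as a weighted sum of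
  \<open>common_weight\<close> over \<open>k\<close>-cliques, leaves the second moment
  \<open>?A\<close>. Spread over the \<open>k + 1\<close> positions of the
  \<open>(k + 1)\<close>-cliques, it is bounded by the preceding count.\<close>

lemma clique_weight_moon_moser:
  "real (Suc k) * clique_weight (Suc k) ^ 2 \<le>
    clique_weight k * (clique_weight (Suc k) + real k * clique_weight (Suc (Suc k)))"
proof -
  let ?w = "\<lambda>xs. prod_list (map y xs)"
  let ?A = "\<Sum>xs\<in>cliques k S. ?w xs * common_weight xs ^ 2"
  have w: "sqrt (?w xs) * sqrt (?w xs) = ?w xs" if "xs \<in> cliques k S" for xs
    using weight_nonneg[OF that] by simp
  have "clique_weight (Suc k) ^ 2 = (\<Sum>xs\<in>cliques k S. sqrt (?w xs) * (sqrt (?w xs) * common_weight xs)) ^ 2"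
    unfolding clique_weight_Suc using w by (simp add: mult.assoc[symmetric] cong: sum.cong)
  also have "\<dots> \<le> (\<Sum>xs\<in>cliques k S. sqrt (?w xs) ^ 2) * (\<Sum>xs\<in>cliques k S. (sqrt (?w xs) * common_weight xs) ^ 2)"
    by (rule Cauchy_Schwarz_ineq_sum)
  also have "\<dots> = clique_weight k * ?A"
    unfolding clique_weight_def using weight_nonneg by (simp add: power_mult_distrib cong: sum.cong)
  finally have CS: "clique_weight (Suc k) ^ 2 \<le> clique_weight k * ?A" .
  \<comment> \<open>One of the two factors \<open>common_weight xs\<close> is expanded into the
    extending vertex; each position \<open>i\<close> then yields one copy of
    \<open>?A\<close>.\<close>
  have "real (Suc k) * ?A = (\<Sum>i<Suc k. \<Sum>ys\<in>cliques (Suc k) S.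
      ?w (remove_nth i ys) * y (ys ! i) * common_weight (remove_nth i ys))"
  proof -
    have "(\<Sum>ys\<in>cliques (Suc k) S. ?w (remove_nth i ys) * y (ys ! i) * common_weight (remove_nth i ys)) = ?A"
      if "i < Suc k" for i
    proof -
      have "(\<Sum>x\<in>common S xs. ?w xs * y x * common_weight xs) = ?w xs * common_weight xs ^ 2" for xs
        unfolding sum_distrib_right[symmetric] sum_distrib_left[symmetric] common_weight_def
        by (simp add: power2_eq_square)
      then show ?thesis
        using that sum_cliques_Suc[OF finite_S, of i k "\<lambda>xs x. ?w xs * y x * common_weight xs"] by simp
    qed
    then show ?thesis by simp
  qed
  also have "\<dots> = (\<Sum>i<Suc k. \<Sum>ys\<in>cliques (Suc k) S. ?w ys * common_weight (remove_nth i ys))"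
  proof (intro sum.cong refl)
    fix i ys assume "i \<in> {..<Suc k}" "ys \<in> cliques (Suc k) S"
    then have "?w ys = y (ys ! i) * ?w (remove_nth i ys)"
      using prod_list_insert_nth[of y i "ys ! i" "remove_nth i ys"]
      by (simp add: insert_remove_nth cliques_def)
    then show "?w (remove_nth i ys) * y (ys ! i) * common_weight (remove_nth i ys) =
        ?w ys * common_weight (remove_nth i ys)"
      by simp
  qed
  also have "\<dots> = (\<Sum>ys\<in>cliques (Suc k) S. ?w ys * (\<Sum>i<Suc k. common_weight (remove_nth i ys)))"
    by (subst sum.swap) (simp only: sum_distrib_left)
  also have "\<dots> \<le> (\<Sum>ys\<in>cliques (Suc k) S. ?w ys * (1 + real k * common_weight ys))"
    by (intro sum_mono mult_left_mono sum_common_weight_remove_le weight_nonneg)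
  also have "\<dots> = clique_weight (Suc k) + real k * clique_weight (Suc (Suc k))"
    by (simp add: clique_weight_Suc[of "Suc k"] clique_weight_def[of "Suc k"] algebra_simps
        sum.distrib sum_distrib_left)
  finally have "real (Suc k) * ?A \<le> clique_weight (Suc k) + real k * clique_weight (Suc (Suc k))" .
  moreover have "0 \<le> clique_weight k"
    unfolding clique_weight_def by (intro sum_nonneg weight_nonneg)
  ultimately have *: "clique_weight k * (real (Suc k) * ?A) \<le>
      clique_weight k * (clique_weight (Suc k) + real k * clique_weight (Suc (Suc k)))"
    by (rule mult_left_mono)
  have "real (Suc k) * clique_weight (Suc k) ^ 2 \<le> real (Suc k) * (clique_weight k * ?A)"
    using CS by (intro mult_left_mono) auto
  also have "\<dots> = clique_weight k * (real (Suc k) * ?A)" by (rule mult.left_commute)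
  finally show ?thesis using * by (rule order_trans)
qed

text \<open>The ratio is that of a complete multipartite graph with parts of weight \<kappa>.
  Moon--Moser propagates it through the identity \<open>(s + 2) (1 - (s + 1) \<kappa>) - 1 = (s + 1)
  (1 - (s + 2) \<kappa>)\<close>; positivity is carried along for the divisions.\<close>

lemma clique_weight_ratio:
  assumes "clique_weight 2 \<ge> 1 - \<kappa>" and "\<kappa> \<ge> 0" and "real s * \<kappa> < 1"
  shows "clique_weight (Suc s) > 0 \<and>
    clique_weight (Suc (Suc s)) \<ge> (1 - real (Suc s) * \<kappa>) * clique_weight (Suc s)"
  using assms(3)
proof (induction s)
  case 0
  then show ?case using assms(1) clique_weight_1 by (simp add: numeral_2_eq_2)
next
  case (Suc s)
  let ?a = "clique_weight (Suc s)" and ?b = "clique_weight (Suc (Suc s))"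
    and ?c = "clique_weight (Suc (Suc (Suc s)))"
  have "real s * \<kappa> \<le> real (Suc s) * \<kappa>" using assms(2) by (intro mult_right_mono) auto
  then have a: "?a > 0" and b: "?b \<ge> (1 - real (Suc s) * \<kappa>) * ?a" using Suc by auto
  have "(1 - real (Suc s) * \<kappa>) * ?a > 0" using a Suc.prems by (intro mult_pos_pos) auto
  with b have bpos: "?b > 0" by linarith
  have "?a * (real (Suc s) * ?c) \<ge> real (Suc (Suc s)) * ?b ^ 2 - ?a * ?b"
    using clique_weight_moon_moser[of "Suc s"] by (simp add: algebra_simps)
  also have "real (Suc (Suc s)) * ?b ^ 2 - ?a * ?b = ?b * (real (Suc (Suc s)) * ?b - ?a)"
    by (simp add: algebra_simps power2_eq_square)
  also have "\<dots> \<ge> ?b * (real (Suc (Suc s)) * ((1 - real (Suc s) * \<kappa>) * ?a) - ?a)"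
    using b bpos by (intro mult_left_mono diff_right_mono) auto
  also have "?b * (real (Suc (Suc s)) * ((1 - real (Suc s) * \<kappa>) * ?a) - ?a) =
      ?a * (real (Suc s) * ((1 - real (Suc (Suc s)) * \<kappa>) * ?b))"
    by (simp add: algebra_simps)
  finally have "real (Suc s) * ((1 - real (Suc (Suc s)) * \<kappa>) * ?b) \<le> real (Suc s) * ?c"
    using a by (simp del: of_nat_Suc)
  then have "(1 - real (Suc (Suc s)) * \<kappa>) * ?b \<le> ?c" by (simp del: of_nat_Suc)
  with bpos show ?case by simp
qed

text \<open>For \<open>\<kappa> = 1 / r - \<delta>\<close> all ratios before the last are at least
  \<open>1 / r\<close>, while the last, \<open>1 - r \<kappa>\<close>, equals
  \<open>r \<delta>\<close>: the surplus over the Turan density enters only there.\<close>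

lemma clique_weight_ge:
  assumes "r \<ge> 1" and "clique_weight 2 \<ge> 1 - 1 / real r + \<delta>" and "0 \<le> \<delta>" and "\<delta> \<le> 1 / real r"
  shows "clique_weight (Suc r) \<ge> real r * \<delta> * (1 / real r) ^ (r - 1)"
proof -
  let ?\<kappa> = "1 / real r - \<delta>"
  have small: "real s * ?\<kappa> < 1" if "s < r" for s
  proof -
    have "real s * ?\<kappa> \<le> real s * (1 / real r)" using assms by (intro mult_left_mono) auto
    also have "\<dots> < 1" using that assms(1) by simp
    finally show ?thesis .
  qed
  have step: "clique_weight (Suc s) > 0 \<and>
      clique_weight (Suc (Suc s)) \<ge> (1 - real (Suc s) * ?\<kappa>) * clique_weight (Suc s)" if "s < r" for s
    using assms small[OF that] by (intro clique_weight_ratio) auto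
  have ge: "clique_weight (Suc s) \<ge> (1 / real r) ^ s" if "s < r" for s
    using that
  proof (induction s)
    case 0
    then show ?case using clique_weight_1 by simp
  next
    case (Suc s)
    have "real (Suc s) * ?\<kappa> \<le> real (r - 1) * (1 / real r)"
      using Suc.prems assms by (intro mult_mono) auto
    also have "\<dots> = 1 - 1 / real r" using assms(1) by (simp add: field_simps of_nat_diff)
    finally have *: "1 / real r \<le> 1 - real (Suc s) * ?\<kappa>" by simp
    have "(1 / real r) ^ Suc s \<le> (1 - real (Suc s) * ?\<kappa>) * clique_weight (Suc s)"
    proof (unfold power_Suc, rule mult_mono)
      have "0 < 1 / real r" using assms(1) by simp
      then show "0 \<le> 1 - real (Suc s) * ?\<kappa>" using * by linarith
    qed (use * Suc assms(1) in auto)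
    also have "\<dots> \<le> clique_weight (Suc (Suc s))" using step[of s] Suc.prems by auto
    finally show ?case .
  qed
  obtain r' where r': "r = Suc r'" using assms(1) by (cases r) auto
  have "1 - real r * ?\<kappa> = real r * \<delta>" using assms(1) by (simp add: field_simps)
  then have "clique_weight (Suc r) \<ge> real r * \<delta> * clique_weight r"
    using step[of r'] r' by simp
  moreover have "real r * \<delta> * clique_weight r \<ge> real r * \<delta> * (1 / real r) ^ (r - 1)"
    using ge[of r'] r' assms(3) by (intro mult_left_mono) auto
  ultimately show ?thesis by linarith
qed

lemma clique_weight_le_card:
  assumes "\<And>v. v \<in> S \<Longrightarrow> y v \<le> t" and "0 \<le> t"
  shows "clique_weight k \<le> real (card (cliques k S)) * t ^ k"
proof -
  have "prod_list (map y xs) \<le> t ^ length xs" if "set xs \<subseteq> S" for xs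
    using that
  proof (induction xs)
    case (Cons x xs)
    have "0 \<le> prod_list (map y xs)" using Cons.prems by (intro prod_list_nonneg) (auto intro: y_nonneg)
    with Cons assms show ?case by (auto intro!: mult_mono)
  qed simp
  then have "clique_weight k \<le> (\<Sum>xs\<in>cliques k S. t ^ k)"
    unfolding clique_weight_def by (intro sum_mono) (auto simp: cliques_def)
  then show ?thesis by simp
qed

end

section \<open>Perron vectors and vertex deletion\<close>

context adjacency
begin

section \<open>Quadratic forms and the existence of Perron vectors\<close>

definition quad_form :: "'a set \<Rightarrow> ('a \<Rightarrow> real) \<Rightarrow> real" where
  "quad_form S x = (\<Sum>u\<in>S. \<Sum>w\<in>S. if E u w then x u * x w else 0)"

text \<open>The last conjunct makes \<mu> the maximum of the Rayleigh quotient, hence the largest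
  eigenvalue of the subgraph induced by \<open>S\<close>. With the graph given by \<open>E\<close>
  and a vertex set, deleting a vertex is a set difference.\<close>

definition perron :: "'a set \<Rightarrow> real \<Rightarrow> ('a \<Rightarrow> real) \<Rightarrow> bool" where
  "perron S \<mu> x \<longleftrightarrow> (\<forall>v\<in>S. 0 \<le> x v) \<and> (\<Sum>v\<in>S. (x v)\<^sup>2) = 1 \<and>
     (\<forall>v\<in>S. sum x (nbrs S v) = \<mu> * x v) \<and> (\<forall>z. quad_form S z \<le> \<mu> * (\<Sum>v\<in>S. (z v)\<^sup>2))"

lemma sum_if_adjacent:
  "finite S \<Longrightarrow> (\<Sum>w\<in>S. if E u w then f w else 0) = (sum f (nbrs S u) :: real)"
  unfolding nbrs_def by (intro sum.mono_neutral_cong_right) auto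

lemma quad_form_eq:
  assumes "finite S"
  shows "quad_form S x = (\<Sum>u\<in>S. x u * sum x (nbrs S u))"
proof -
  have "(\<Sum>w\<in>S. if E u w then x u * x w else 0) = x u * sum x (nbrs S u)" for u
    unfolding sum_if_adjacent[OF assms] by (simp add: sum_distrib_left)
  then show ?thesis by (simp add: quad_form_def)
qed

lemma quad_form_add:
  assumes "finite S"
  shows "quad_form S (\<lambda>u. x u + h u) =
    quad_form S x + 2 * (\<Sum>u\<in>S. h u * sum x (nbrs S u)) + quad_form S h"
proof -
  let ?f = "\<lambda>a b. \<Sum>u\<in>S. \<Sum>w\<in>S. if E u w then a u * b w else (0 :: real)"
  have "?f x h = (\<Sum>u\<in>S. \<Sum>w\<in>S. if E w u then x w * h u else 0)" by (rule sum.swap)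
  also have "\<dots> = ?f h x" by (intro sum.cong refl) (auto simp: E_sym mult.commute)
  finally have swap: "?f x h = ?f h x" .
  have hx: "?f h x = (\<Sum>u\<in>S. h u * sum x (nbrs S u))"
    unfolding sum_if_adjacent[OF assms] by (simp add: sum_distrib_left)
  have "quad_form S (\<lambda>u. x u + h u) = ?f x x + ?f h x + ?f x h + ?f h h"
    unfolding quad_form_def sum.distrib[symmetric]
    by (intro sum.cong refl) (auto simp: algebra_simps)
  then show ?thesis by (simp add: swap hx quad_form_def)
qed

text \<open>There is no term in \<open>t\<^sup>2\<close> because there are no loops. A small
  \<open>t\<close> gives the first variation; \<open>t = - x v\<close> amounts to deleting
  \<open>v\<close>.\<close>

lemma quad_form_update:
  assumes "finite S" "v \<in> S"
  shows "quad_form S (x(v := x v + t)) = quad_form S x + 2 * t * sum x (nbrs S v)"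
proof -
  let ?h = "\<lambda>u. if u = v then t else 0"
  have 1: "x(v := x v + t) = (\<lambda>u. x u + ?h u)" by auto
  have 2: "quad_form S ?h = 0"
    unfolding quad_form_def using E_irrefl by (intro sum.neutral ballI) auto
  have "(\<Sum>u\<in>S. ?h u * sum x (nbrs S u)) = (\<Sum>u\<in>{v}. t * sum x (nbrs S u))"
    using assms by (intro sum.mono_neutral_cong_right) auto
  then show ?thesis unfolding 1 quad_form_add[OF assms(1)] 2 by simp
qed

lemma quad_form_nonneg: "(\<And>v. v \<in> S \<Longrightarrow> 0 \<le> x v) \<Longrightarrow> 0 \<le> quad_form S x"
  unfolding quad_form_def by (intro sum_nonneg) auto

lemma quad_form_le_abs: "quad_form S x \<le> quad_form S (\<lambda>v. \<bar>x v\<bar>)"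
  unfolding quad_form_def
  by (intro sum_mono) (auto simp: abs_mult[symmetric])

lemma quad_form_cong: "(\<And>v. v \<in> S \<Longrightarrow> x v = z v) \<Longrightarrow> quad_form S x = quad_form S z"
  unfolding quad_form_def by (intro sum.cong refl) auto

lemma quad_form_scale: "quad_form S (\<lambda>v. c * x v) = c\<^sup>2 * quad_form S x"
  unfolding quad_form_def sum_distrib_left
  by (intro sum.cong refl) (auto simp: power2_eq_square mult_ac)

lemma sum_sq_update:
  assumes "finite S" "v \<in> S"
  shows "(\<Sum>u\<in>S. ((x(v := t)) u)\<^sup>2) = (\<Sum>u\<in>S. (x u)\<^sup>2) - (x v)\<^sup>2 + (t :: real)\<^sup>2"
  using assms by (simp add: sum.remove[OF assms])

text \<open>A maximiser over the nonnegative part of the unit sphere serves: passing to absolute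
  values does not decrease the form, so it is maximal among all vectors, and varying one coordinate
  gives the eigenvalue equation.\<close>

lemma ex_perron:
  assumes S: "finite S" "S \<noteq> {}"
  shows "\<exists>\<mu> x. perron S \<mu> x"
proof -
  \<comment> \<open>Vectors vanish outside \<open>S\<close>, so they range over a product of
    intervals and points, which is compact in the product topology.\<close>
  let ?B = "\<lambda>v. if v \<in> S then {0..1::real} else {0}"
  let ?K = "PiE UNIV ?B"
  let ?C = "?K \<inter> {x. (\<Sum>v\<in>S. (x v)\<^sup>2) = 1}"
  have cont: "continuous_on UNIV (\<lambda>x :: 'a \<Rightarrow> real. x v)" for v by simp
  have "compactin (product_topology (\<lambda>_. euclidean) UNIV) ?K"
    unfolding compactin_PiE by auto
  then have "compact ?K" by (simp add: euclidean_product_topology)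
  moreover have "closed {x :: 'a \<Rightarrow> real. (\<Sum>v\<in>S. (x v)\<^sup>2) = 1}"
    by (intro closed_Collect_eq continuous_on_sum continuous_on_power cont continuous_on_const)
  ultimately have "compact ?C" by (rule compact_Int_closed)
  moreover obtain v0 where v0: "v0 \<in> S" using S by blast
  have "(\<Sum>v\<in>S. (if v = v0 then 1 else 0 :: real)\<^sup>2) = (\<Sum>v\<in>{v0}. 1)"
    using v0 S by (intro sum.mono_neutral_cong_right) auto
  then have "(\<lambda>v. if v = v0 then 1 else 0) \<in> ?C" using v0 by (auto simp: PiE_def Pi_def)
  then have "?C \<noteq> {}" by blast
  moreover have "continuous_on ?C (quad_form S)"
  proof (rule continuous_on_subset[of UNIV])
    have "continuous_on UNIV (\<lambda>x :: 'a \<Rightarrow> real. if E u w then x u * x w else 0)" for u w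
      by (cases "E u w") (auto intro!: continuous_on_mult cont)
    then show "continuous_on UNIV (quad_form S)"
      unfolding quad_form_def[abs_def] by (intro continuous_on_sum)
  qed simp
  ultimately obtain x where x: "x \<in> ?C" and max: "\<And>z. z \<in> ?C \<Longrightarrow> quad_form S z \<le> quad_form S x"
    using continuous_attains_sup[of ?C "quad_form S"] by blast
  let ?\<mu> = "quad_form S x"
  have nonneg: "0 \<le> x v" if "v \<in> S" for v
  proof -
    have "x v \<in> ?B v" using x by blast
    with that show ?thesis by simp
  qed
  have one: "(\<Sum>v\<in>S. (x v)\<^sup>2) = 1" using x by simp
  have mu: "0 \<le> ?\<mu>" using nonneg by (rule quad_form_nonneg)
  have le: "quad_form S z \<le> ?\<mu> * (\<Sum>v\<in>S. (z v)\<^sup>2)" for z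
  proof -
    let ?N = "\<Sum>v\<in>S. (z v)\<^sup>2"
    show ?thesis
    proof (cases "?N = 0")
      case True
      then have "z v = 0" if "v \<in> S" for v
        using that S(1) by (simp add: sum_nonneg_eq_0_iff)
      then have "quad_form S z = 0" unfolding quad_form_def by (intro sum.neutral ballI) auto
      with True show ?thesis by simp
    next
      case False
      then have N: "?N > 0" by (simp add: sum_nonneg order_less_le)
      define w where "w v = (if v \<in> S then \<bar>z v\<bar> / sqrt ?N else 0)" for v
      have "(z v)\<^sup>2 \<le> ?N" if "v \<in> S" for v
        using that S(1) by (intro member_le_sum) auto
      then have "\<bar>z v\<bar> \<le> sqrt ?N" if "v \<in> S" for v
        using that real_le_rsqrt by (metis power2_abs)
      then have 1: "w \<in> ?K" using N by (auto simp: w_def PiE_def Pi_def)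
      have "(\<Sum>v\<in>S. (w v)\<^sup>2) = (\<Sum>v\<in>S. (z v)\<^sup>2 / ?N)"
        using N by (intro sum.cong) (auto simp: w_def power_divide)
      also have "\<dots> = 1" using N by (simp add: sum_divide_distrib[symmetric])
      finally have "w \<in> ?C" using 1 by simp
      then have "quad_form S w \<le> ?\<mu>" by (rule max)
      moreover have "quad_form S w = quad_form S (\<lambda>v. (1 / sqrt ?N) * \<bar>z v\<bar>)"
        by (rule quad_form_cong) (simp add: w_def)
      moreover have "\<dots> = quad_form S (\<lambda>v. \<bar>z v\<bar>) / ?N"
        unfolding quad_form_scale using N by (simp add: power_divide)
      ultimately have "quad_form S (\<lambda>v. \<bar>z v\<bar>) / ?N \<le> ?\<mu>" by linarith
      then have "quad_form S (\<lambda>v. \<bar>z v\<bar>) \<le> ?\<mu> * ?N" using N by (simp only: pos_divide_le_eq)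
      with quad_form_le_abs[of S z] show ?thesis by linarith
    qed
  qed
  have "sum x (nbrs S v) = ?\<mu> * x v" if v: "v \<in> S" for v
  proof -
    define d where "d = sum x (nbrs S v) - ?\<mu> * x v"
    have *: "2 * t * d \<le> ?\<mu> * t\<^sup>2" for t
    proof -
      have "?\<mu> + 2 * t * sum x (nbrs S v) \<le> ?\<mu> * (1 - (x v)\<^sup>2 + (x v + t)\<^sup>2)"
        using le[of "x(v := x v + t)"]
        unfolding quad_form_update[OF S(1) v] sum_sq_update[OF S(1) v] one by simp
      then show ?thesis unfolding d_def by (simp add: algebra_simps power2_eq_square)
    qed
    \<comment> \<open>A step proportional to the defect \<open>d\<close> of the eigenvalue equation
      would beat the maximum unless \<open>d = 0\<close>.\<close>
    define t where "t = d / (?\<mu> + 1)"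
    have d: "d = t * (?\<mu> + 1)" using mu by (simp add: t_def)
    have "t\<^sup>2 * (?\<mu> + 2) \<le> 0" using *[of t] unfolding d by (simp add: algebra_simps power2_eq_square)
    then have "d = 0" using mu unfolding d by (simp add: mult_le_0_iff)
    then show ?thesis by (simp add: d_def)
  qed
  with nonneg one le show ?thesis unfolding perron_def by blast
qed

lemma perron_quad_form:
  assumes "finite S" "perron S \<mu> x"
  shows "quad_form S x = \<mu>"
proof -
  have "quad_form S x = (\<Sum>u\<in>S. \<mu> * (x u)\<^sup>2)"
    unfolding quad_form_eq[OF assms(1)] using assms(2)
    by (intro sum.cong) (auto simp: perron_def power2_eq_square)
  also have "\<dots> = \<mu>" using assms(2) by (simp add: perron_def sum_distrib_left[symmetric])
  finally show ?thesis .
qed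

text \<open>At a vertex of degree \<open>d\<close> the eigenvalue equation and Cauchy--Schwarz give
  \<open>\<mu>\<^sup>2 * y \<le> d * (1 - (m - d) * y)\<close>, where \<open>y\<close> is the square
  of the smallest entry: each of the \<open>m - d\<close> vertices outside the neighbourhood carries
  at least \<open>y\<close>. The restriction of \<open>x\<close> to \<open>S - {k}\<close> then
  serves as a test vector for \<open>\<mu>'\<close>.\<close>

lemma perron_delete_min:
  assumes S: "finite S" "card S = m" "m \<ge> 3" and P: "perron S \<mu> x" and "\<mu> > 0" and "e \<ge> 0"
    and u: "u \<in> S" "real (card (nbrs S u)) \<le> \<mu> - e * real m"
  shows "\<exists>k\<in>S. \<exists>\<mu>' x'. perron (S - {k}) \<mu>' x' \<and>
    \<mu>' * (real m - 1) \<ge> \<mu> * (real m - 2) * (1 + 2 * e / ((1 + 2 * e) * real m))"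
proof -
  let ?m = "real m" and ?d = "real (card (nbrs S u))"
  have nonneg: "\<And>v. v \<in> S \<Longrightarrow> 0 \<le> x v" and one: "(\<Sum>v\<in>S. (x v)\<^sup>2) = 1"
    and eig: "\<And>v. v \<in> S \<Longrightarrow> sum x (nbrs S v) = \<mu> * x v"
    using P by (auto simp: perron_def)
  obtain k where k: "k \<in> S" "\<And>v. v \<in> S \<Longrightarrow> x k \<le> x v"
    using ex_min_if_finite[of "x ` S"] S(1) u(1)
    by (metis (no_types, lifting) arg_min_least empty_iff arg_min_if_finite(1))
  define y where "y = (x k)\<^sup>2"
  have y0: "y \<ge> 0" by (simp add: y_def)
  have le: "y \<le> (x v)\<^sup>2" if "v \<in> S" for v
    unfolding y_def using k that nonneg by (intro power_mono) auto
  have sub: "nbrs S u \<subseteq> S" by (auto simp: nbrs_def)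
  have cardsub: "card (S - nbrs S u) = m - card (nbrs S u)" "card (nbrs S u) \<le> m"
    using card_Diff_subset[of "nbrs S u" S] card_mono[OF S(1) sub] S sub by (auto simp: finite_subset)
  have "\<mu>\<^sup>2 * y \<le> (\<mu> * x u)\<^sup>2" using le[OF u(1)] by (simp add: power_mult_distrib mult_left_mono)
  also have "\<dots> = (sum x (nbrs S u))\<^sup>2" using eig[OF u(1)] by simp
  also have "\<dots> \<le> (\<Sum>v\<in>nbrs S u. (x v)\<^sup>2) * ?d" by (rule sum_squared_le_sum_of_squares)
  also have "(\<Sum>v\<in>nbrs S u. (x v)\<^sup>2) \<le> 1 - (?m - ?d) * y"
  proof -
    have "(\<Sum>v\<in>S - nbrs S u. y) \<le> (\<Sum>v\<in>S - nbrs S u. (x v)\<^sup>2)" by (intro sum_mono le) auto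
    moreover have "(\<Sum>v\<in>S - nbrs S u. (x v)\<^sup>2) + (\<Sum>v\<in>nbrs S u. (x v)\<^sup>2) = 1"
      using sum.subset_diff[OF sub S(1), of "\<lambda>v. (x v)\<^sup>2"] one by simp
    ultimately show ?thesis using cardsub by (simp add: of_nat_diff)
  qed
  finally have key: "\<mu>\<^sup>2 * y \<le> (1 - (?m - ?d) * y) * ?d" by (simp add: mult_right_mono)
  define p where "p = (1 + 2 * e) * ?m"
  have pm: "p \<ge> ?m" using assms(6) mult_right_mono[of 1 "1 + 2 * e" ?m] by (simp add: p_def)
  have "p * y \<le> 1"
  proof (cases "?d = 0")
    case True
    then have "\<mu>\<^sup>2 * y \<le> 0" using key by simp
    then have "y = 0" using assms(5) y0 by (simp add: mult_le_0_iff)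
    then show ?thesis by simp
  next
    case False
    have "2 * (e * ?m) * ?d \<le> 2 * (\<mu> - ?d) * ?d" using u(2) by (intro mult_right_mono) auto
    \<comment> \<open>That is, \<open>\<mu>\<^sup>2 \<ge> ?d * (2 * \<mu> - ?d)\<close>; the degree
      bound turns \<open>?m + 2 * \<mu> - 2 * ?d\<close> into at least \<open>p\<close>.\<close>
    moreover have "0 \<le> (\<mu> - ?d)\<^sup>2" by simp
    ultimately have "p * ?d \<le> \<mu>\<^sup>2 + ?d * (?m - ?d)"
      by (simp add: p_def algebra_simps power2_eq_square)
    then have "p * ?d * y \<le> (\<mu>\<^sup>2 + ?d * (?m - ?d)) * y" using y0 by (intro mult_right_mono)
    also have "\<dots> \<le> ?d" using key by (simp add: algebra_simps)
    finally have "?d * (p * y) \<le> ?d * 1" by (simp add: mult_ac)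
    moreover have "?d > 0" using False by simp
    ultimately show ?thesis by (simp only: mult_le_cancel_left_pos)
  qed
  have S': "finite (S - {k})" "S - {k} \<noteq> {}"
    using S k card_le_Suc0_iff_eq[OF S(1)] by auto
  then obtain \<mu>' x' where P': "perron (S - {k}) \<mu>' x'" using ex_perron by blast
  have "quad_form S (x(k := x k + (- x k))) = quad_form (S - {k}) x"
  proof -
    define z where "z = x(k := x k + (- x k))"
    have "(\<Sum>w\<in>S. if E u w then z u * z w else 0) = (\<Sum>w\<in>S - {k}. if E u w then z u * z w else 0)" for u
      by (rule sum.mono_neutral_right) (use S in \<open>auto simp: z_def\<close>)
    then have "quad_form S z = (\<Sum>u\<in>S. \<Sum>w\<in>S - {k}. if E u w then z u * z w else 0)"
      by (simp add: quad_form_def)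
    also have "\<dots> = quad_form (S - {k}) z" unfolding quad_form_def
      by (rule sum.mono_neutral_right) (use S in \<open>auto simp: z_def intro!: sum.neutral split: if_splits\<close>)
    also have "\<dots> = quad_form (S - {k}) x" by (rule quad_form_cong) (simp add: z_def)
    finally show ?thesis by (simp only: z_def)
  qed
  then have "quad_form (S - {k}) x = quad_form S (x(k := x k + (- x k)))" by simp
  also have "\<dots> = \<mu> - 2 * (\<mu> * y)"
    unfolding quad_form_update[OF S(1) k(1)] perron_quad_form[OF S(1) P] eig[OF k(1)]
    by (simp add: y_def power2_eq_square)
  finally have "quad_form (S - {k}) x = \<mu> - 2 * (\<mu> * y)" .
  moreover have "(\<Sum>v\<in>S - {k}. (x v)\<^sup>2) = 1 - y"
    using sum.remove[OF S(1) k(1), of "\<lambda>v. (x v)\<^sup>2"] one by (simp add: y_def)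
  ultimately have mu': "\<mu> * (1 - 2 * y) \<le> \<mu>' * (1 - y)"
    using P' unfolding perron_def by (metis mult.left_commute right_diff_distrib mult_1_right)
  have p3: "p \<ge> 3" using pm S(3) by simp
  \<comment> \<open>The quotient \<open>(1 - 2 y) / (1 - y)\<close> decreases in \<open>y\<close>,
    so \<open>y\<close> may be replaced by its upper bound \<open>1 / p\<close>.\<close>
  have "\<mu> * (p - 2) * (1 - y) \<le> \<mu> * (1 - 2 * y) * (p - 1)"
    using \<open>p * y \<le> 1\<close> assms(5) by (simp add: algebra_simps)
  also have "\<dots> \<le> \<mu>' * (1 - y) * (p - 1)" using mu' p3 by (intro mult_right_mono) auto
  finally have "(\<mu> * (p - 2)) * (1 - y) \<le> (\<mu>' * (p - 1)) * (1 - y)" by (simp add: mult_ac)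
  moreover have "1 - y > 0"
  proof -
    have "3 * y \<le> p * y" using p3 y0 by (intro mult_right_mono)
    then show ?thesis using \<open>p * y \<le> 1\<close> by linarith
  qed
  ultimately have fin: "\<mu> * (p - 2) \<le> \<mu>' * (p - 1)" by simp
  \<comment> \<open>The gain is the difference
    \<open>(p - 2) * (m - 1) - (m - 2) * (p - 1) = p - m = 2 * e * m\<close>.\<close>
  have "(?m - 2) * (1 + 2 * e * ?m / (p * ?m)) * (p - 1) \<le> (p - 2) * (?m - 1)"
  proof -
    have "2 * e * ?m * ((?m - 2) * (p - 1)) \<le> 2 * e * ?m * (p * ?m)"
    proof (rule mult_left_mono)
      have "(?m - 2) * (p - 1) \<le> ?m * p" using p3 S(3) by (intro mult_mono) auto
      then show "(?m - 2) * (p - 1) \<le> p * ?m" by (simp add: mult.commute)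
    qed (use assms(6) in auto)
    moreover have "p * ?m > 0" using p3 S(3) by simp
    ultimately have "2 * e * ?m / (p * ?m) * ((?m - 2) * (p - 1)) \<le> 2 * e * ?m"
      by (simp only: times_divide_eq_left pos_divide_le_eq)
    moreover have "2 * e * ?m = (p - 2) * (?m - 1) - (?m - 2) * (p - 1)"
      by (simp add: p_def algebra_simps)
    ultimately show ?thesis by (simp add: algebra_simps)
  qed
  moreover have "2 * e * ?m / (p * ?m) = 2 * e / p" using S(3) by simp
  ultimately have "(?m - 2) * (1 + 2 * e / p) * (p - 1) \<le> (p - 2) * (?m - 1)" by simp
  then have "\<mu> * ((?m - 2) * (1 + 2 * e / p) * (p - 1)) \<le> \<mu> * ((p - 2) * (?m - 1))"
    using assms(5) by (intro mult_left_mono) auto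
  also have "\<dots> \<le> \<mu>' * (p - 1) * (?m - 1)"
    using fin S(3) mult_right_mono[of "\<mu> * (p - 2)" "\<mu>' * (p - 1)" "?m - 1"] by (simp add: mult_ac)
  finally have "(\<mu> * (?m - 2) * (1 + 2 * e / p)) * (p - 1) \<le> (\<mu>' * (?m - 1)) * (p - 1)"
    by (simp add: mult_ac)
  then have "\<mu> * (?m - 2) * (1 + 2 * e / p) \<le> \<mu>' * (?m - 1)" using p3 by simp
  with P' k(1) show ?thesis unfolding p_def by blast
qed


text \<open>For the weights \<open>x / \<sigma>\<close> the edge weight is
  \<open>\<mu> / \<sigma>\<^sup>2\<close>, which is at least \<open>\<mu> / m\<close> by
  Cauchy--Schwarz. So the spectral hypothesis is a density hypothesis for these weights.\<close>

lemma perron_many_cliques: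
  assumes S: "finite S" "card S = m" and P: "perron S \<mu> x" and "r \<ge> 1" and "0 \<le> \<delta>" "\<delta> \<le> 1 / real r"
    and "\<mu> \<ge> (1 - 1 / real r + \<delta>) * real m" and "\<mu> > 0"
  shows "real (card (cliques (Suc r) S)) \<ge> real r * \<delta> * (1 / real r) ^ (r - 1) * \<mu> ^ Suc r"
proof -
  define \<sigma> where "\<sigma> = sum x S"
  have nonneg: "\<And>v. v \<in> S \<Longrightarrow> 0 \<le> x v" and one: "(\<Sum>v\<in>S. (x v)\<^sup>2) = 1"
    and eig: "\<And>v. v \<in> S \<Longrightarrow> sum x (nbrs S v) = \<mu> * x v"
    using P by (auto simp: perron_def)
  have "\<sigma> \<noteq> 0"
  proof
    assume "\<sigma> = 0"
    then have "\<forall>v\<in>S. x v = 0" unfolding \<sigma>_def using nonneg S(1) by (simp add: sum_nonneg_eq_0_iff)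
    with one show False by simp
  qed
  moreover have "\<sigma> \<ge> 0" unfolding \<sigma>_def using nonneg by (rule sum_nonneg)
  ultimately have \<sigma>: "\<sigma> > 0" by simp
  interpret weighted_adjacency E S "\<lambda>v. x v / \<sigma>"
    by unfold_locales
      (use S \<sigma> nonneg in \<open>auto simp: \<sigma>_def sum_divide_distrib[symmetric]\<close>)
  have "\<sigma>\<^sup>2 \<le> real m" using sum_squared_le_sum_of_squares[of x S] one S(2) by (simp add: \<sigma>_def)
  have c1: "cliques 1 S = (\<lambda>v. [v]) ` S"
    by (auto simp: cliques_def length_Suc_conv)
  have nb: "common S [v] = nbrs S v" for v
    using E_sym by (auto simp: common_def nbrs_def)
  have "clique_weight 2 = (\<Sum>v\<in>S. x v / \<sigma> * (\<Sum>u\<in>nbrs S v. x u / \<sigma>))"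
    using clique_weight_Suc[of 1] unfolding c1
    by (simp add: sum.reindex inj_on_def common_weight_def nb numeral_2_eq_2)
  also have "\<dots> = (\<Sum>v\<in>S. \<mu> / \<sigma>\<^sup>2 * (x v)\<^sup>2)"
    using eig by (intro sum.cong) (auto simp: sum_divide_distrib[symmetric] power2_eq_square)
  also have "\<dots> = \<mu> / \<sigma>\<^sup>2" by (simp only: sum_distrib_left[symmetric] one mult_1_right)
  finally have "clique_weight 2 = \<mu> / \<sigma>\<^sup>2" .
  moreover have "1 - 1 / real r + \<delta> \<le> \<mu> / \<sigma>\<^sup>2"
  proof -
    have "0 \<le> 1 - 1 / real r + \<delta>" using assms(4,5) by (simp add: add_increasing2)
    then have "(1 - 1 / real r + \<delta>) * \<sigma>\<^sup>2 \<le> (1 - 1 / real r + \<delta>) * real m"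
      using \<open>\<sigma>\<^sup>2 \<le> real m\<close> by (intro mult_left_mono)
    then have "(1 - 1 / real r + \<delta>) * \<sigma>\<^sup>2 \<le> \<mu>" using assms(7) by linarith
    then show ?thesis using \<sigma> by (simp add: pos_le_divide_eq)
  qed
  ultimately have "real r * \<delta> * (1 / real r) ^ (r - 1) \<le> clique_weight (Suc r)"
    using assms(4-6) by (intro clique_weight_ge) auto
  also have "\<dots> \<le> real (card (cliques (Suc r) S)) * (1 / \<mu>) ^ Suc r"
  proof (rule clique_weight_le_card)
    fix v assume v: "v \<in> S"
    have "\<mu> * x v \<le> \<sigma>" unfolding eig[OF v, symmetric] \<sigma>_def
      using S(1) nonneg by (intro sum_mono2) (auto simp: nbrs_def)
    then show "x v / \<sigma> \<le> 1 / \<mu>" using \<sigma> assms(8) by (simp add: field_simps)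
  qed (use assms(8) in simp)
  also have "\<dots> = real (card (cliques (Suc r) S)) / \<mu> ^ Suc r" by (simp add: power_one_over)
  finally show ?thesis using assms(8) by (simp only: pos_le_divide_eq zero_less_power)
qed

text \<open>The eigenvalue divided by \<open>m - 1\<close> never falls, so \<mu> stays at least
  \<open>\<mu>\<^sub>0 * (m - 1) / (n - 1)\<close>. Through \<open>gap\<close>, a vertex violating
  the degree condition with threshold \<tau> therefore admits a further deletion with parameter
  \<open>e\<close>. Writing \<open>n\<close> for \<open>m\<close> in the gain makes it uniform, so
  that the gains form a power.\<close>

lemma deletion_process:
  fixes e \<tau> :: real
  defines "g \<equiv> 2 * e / (1 + 2 * e)"
  assumes V: "finite V" "card V = n" "perron V \<mu>\<^sub>0 x\<^sub>0" "\<mu>\<^sub>0 > 0" and e: "e \<ge> 0" and K: "K + 3 \<le> n"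
    and gap: "\<And>m. n - K \<le> m \<Longrightarrow> m \<le> n \<Longrightarrow> \<tau> * real m \<le> \<mu>\<^sub>0 * (real m - 1) / (real n - 1) - e * real m"
  shows "(\<exists>S k \<mu> x. S \<subseteq> V \<and> k \<le> K \<and> card S = n - k \<and> perron S \<mu> x \<and>
      \<mu> * (real n - 1) \<ge> \<mu>\<^sub>0 * (real n - real k - 1) * (1 + g / real n) ^ k \<and>
      ((\<forall>v\<in>S. real (card (nbrs S v)) > \<tau> * real (card S)) \<or> k = K))"
proof -
  have g0: "g \<ge> 0" using e by (simp add: g_def)
  let ?Q = "\<lambda>S k \<mu> x. S \<subseteq> V \<and> card S = n - k \<and> perron S \<mu> x \<and>
      \<mu> * (real n - 1) \<ge> \<mu>\<^sub>0 * (real n - real k - 1) * (1 + g / real n) ^ k"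
  \<comment> \<open>Induction on the number \<open>j\<close> of permitted deletions; once the degree
    condition holds, the state is kept.\<close>
  have "\<exists>S k \<mu> x. k \<le> j \<and> ?Q S k \<mu> x \<and>
      ((\<forall>v\<in>S. real (card (nbrs S v)) > \<tau> * real (card S)) \<or> k = j)" if "j \<le> K" for j
    using that
  proof (induction j)
    case 0
    then show ?case using V by (intro exI[of _ V] exI[of _ 0] exI[of _ \<mu>\<^sub>0] exI[of _ x\<^sub>0]) auto
  next
    case (Suc j)
    then obtain S k \<mu> x where S: "k \<le> j" "?Q S k \<mu> x"
        "(\<forall>v\<in>S. real (card (nbrs S v)) > \<tau> * real (card S)) \<or> k = j" by auto
    show ?case
    proof (cases "\<forall>v\<in>S. real (card (nbrs S v)) > \<tau> * real (card S)")
      case True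
      with S show ?thesis by (meson le_Suc_eq)
    next
      case False
      then have k: "k = j" using S by blast
      define m where "m = n - j"
      have m: "card S = m" "m \<ge> 3" "m \<le> n" "real m = real n - real j" "n - K \<le> m"
        using S(2) Suc.prems K k by (auto simp: m_def)
      have n1: "real n - 1 > 0" using m by linarith
      have pow: "(1 + g / real n) ^ j \<ge> 1" using g0 by (intro one_le_power) simp
      have mu: "\<mu> * (real n - 1) \<ge> \<mu>\<^sub>0 * (real m - 1) * (1 + g / real n) ^ j"
        using S(2) k m by simp
      have base: "0 < \<mu>\<^sub>0 * (real m - 1)" using V(4) m by (intro mult_pos_pos) auto
      have "\<mu>\<^sub>0 * (real m - 1) * 1 \<le> \<mu>\<^sub>0 * (real m - 1) * (1 + g / real n) ^ j"
        using pow base by (intro mult_left_mono) auto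
      then have mu1: "\<mu>\<^sub>0 * (real m - 1) \<le> \<mu> * (real n - 1)" using mu by linarith
      then have mu2: "\<mu>\<^sub>0 * (real m - 1) / (real n - 1) \<le> \<mu>" using n1 by (simp add: pos_divide_le_eq)
      have "0 < \<mu> * (real n - 1)" using mu1 base by linarith
      then have mupos: "\<mu> > 0" using n1 by (simp add: zero_less_mult_iff)
      from False obtain u where u: "u \<in> S" "real (card (nbrs S u)) \<le> \<tau> * real (card S)" by force
      then have "real (card (nbrs S u)) \<le> \<mu> - e * real m"
        using gap[OF m(5,3)] mu2 m(1) by simp
      moreover have "finite S" using S(2) V(1) finite_subset by blast
      ultimately obtain w \<mu>' x' where w: "w \<in> S" "perron (S - {w}) \<mu>' x'"
        and mu': "\<mu>' * (real m - 1) \<ge> \<mu> * (real m - 2) * (1 + 2 * e / ((1 + 2 * e) * real m))"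
        using perron_delete_min[of S m \<mu> x e u] S(2) m mupos e u(1) by blast
      have "g / real n \<le> 2 * e / ((1 + 2 * e) * real m)"
        unfolding g_def divide_divide_eq_left using e m
        by (intro divide_left_mono mult_left_mono mult_pos_pos) auto
      then have "\<mu> * (real m - 2) * (1 + g / real n) \<le> \<mu> * (real m - 2) * (1 + 2 * e / ((1 + 2 * e) * real m))"
        using mupos m by (intro mult_left_mono) auto
      with mu' have "\<mu> * (real m - 2) * (1 + g / real n) \<le> \<mu>' * (real m - 1)" by linarith
      then have "(\<mu> * (real m - 2) * (1 + g / real n)) * (real n - 1) \<le> (\<mu>' * (real m - 1)) * (real n - 1)"
        using n1 by (intro mult_right_mono) auto
      moreover have "(\<mu>\<^sub>0 * (real m - 1) * (1 + g / real n) ^ j) * ((real m - 2) * (1 + g / real n)) \<le>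
          (\<mu> * (real n - 1)) * ((real m - 2) * (1 + g / real n))"
        using mu g0 m by (intro mult_right_mono mult_nonneg_nonneg) auto
      ultimately have "(real m - 1) * (\<mu>\<^sub>0 * (real m - 2) * (1 + g / real n) ^ Suc j) \<le>
          (real m - 1) * (\<mu>' * (real n - 1))"
        by (simp add: mult_ac)
      then have "\<mu>\<^sub>0 * (real m - 2) * (1 + g / real n) ^ Suc j \<le> \<mu>' * (real n - 1)"
        using m by (simp del: power_Suc)
      moreover have "real m - 2 = real n - real (Suc j) - 1" using m by simp
      moreover have "card (S - {w}) = n - Suc j" using w m by (simp add: m_def)
      ultimately have "?Q (S - {w}) (Suc j) \<mu>' x'" using S(2) w by (metis Diff_subset subset_trans)
      then show ?thesis by (intro exI[of _ "S - {w}"] exI[of _ "Suc j"] exI[of _ \<mu>'] exI[of _ x']) blast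
    qed
  qed
  from this[of K] show ?thesis by (metis order_refl)
qed

section \<open>Quadratic forms of r-partite graphs\<close>

definition proper_colouring :: "nat \<Rightarrow> 'a set \<Rightarrow> ('a \<Rightarrow> nat) \<Rightarrow> bool" where
  "proper_colouring r S f \<longleftrightarrow> (\<forall>v\<in>S. f v < r) \<and> (\<forall>u\<in>S. \<forall>v\<in>S. E u v \<longrightarrow> f u \<noteq> f v)"

text \<open>The squared total weight splits into edges, missing pairs between classes, and pairs
  within a class; the last part is the sum of the squared class weights, whose excess over its
  minimum is the imbalance. For nonnegative \<open>z\<close> both deficits are nonnegative: dropping
  them gives the Turan-type bound, keeping them gives its stability.\<close>

lemma quad_form_proper_colouring:
  fixes z :: "'a \<Rightarrow> real"
  assumes S: "finite S" and f: "proper_colouring r S f" and r: "r \<ge> 1"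
  shows "quad_form S z = (1 - 1 / real r) * (sum z S)\<^sup>2
    - (\<Sum>i<r. (sum z {v\<in>S. f v = i} - sum z S / real r)\<^sup>2)
    - (\<Sum>u\<in>S. \<Sum>w\<in>S. if f u \<noteq> f w \<and> \<not> E u w then z u * z w else 0)"
proof -
  let ?P = "\<lambda>i. sum z {v\<in>S. f v = i}" and ?\<sigma> = "sum z S"
  have fr: "f ` S \<subseteq> {..<r}" using f by (auto simp: proper_colouring_def)
  have "?\<sigma>\<^sup>2 = (\<Sum>u\<in>S. \<Sum>w\<in>S. z u * z w)"
    by (simp add: power2_eq_square sum_product)
  also have "\<dots> = (\<Sum>u\<in>S. \<Sum>w\<in>S. (if E u w then z u * z w else 0)
      + (if f u \<noteq> f w \<and> \<not> E u w then z u * z w else 0) + (if f w = f u then z u * z w else 0))"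
  proof (intro sum.cong refl)
    fix u w assume "u \<in> S" "w \<in> S"
    then have "E u w \<Longrightarrow> f w \<noteq> f u" using f unfolding proper_colouring_def by metis
    then show "z u * z w = (if E u w then z u * z w else 0)
      + (if f u \<noteq> f w \<and> \<not> E u w then z u * z w else 0) + (if f w = f u then z u * z w else 0)"
      by auto
  qed
  also have "\<dots> = quad_form S z + (\<Sum>u\<in>S. \<Sum>w\<in>S. if f u \<noteq> f w \<and> \<not> E u w then z u * z w else 0)
      + (\<Sum>u\<in>S. \<Sum>w\<in>S. if f w = f u then z u * z w else 0)"
    by (simp only: sum.distrib quad_form_def)
  also have "(\<Sum>u\<in>S. \<Sum>w\<in>S. if f w = f u then z u * z w else 0) = (\<Sum>u\<in>S. z u * ?P (f u))"
  proof (intro sum.cong refl)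
    fix u
    have "(\<Sum>w\<in>S. if f w = f u then z u * z w else 0) = (\<Sum>w\<in>{w\<in>S. f w = f u}. z u * z w)"
      using S by (intro sum.mono_neutral_cong_right) auto
    then show "(\<Sum>w\<in>S. if f w = f u then z u * z w else 0) = z u * ?P (f u)"
      by (simp add: sum_distrib_left)
  qed
  also have "(\<Sum>u\<in>S. z u * ?P (f u)) = (\<Sum>i<r. \<Sum>u\<in>{u\<in>S. f u = i}. z u * ?P (f u))"
    by (rule sum.group[OF S _ fr, symmetric]) simp
  also have "\<dots> = (\<Sum>i<r. (?P i)\<^sup>2)"
  proof (intro sum.cong refl)
    fix i
    have "(\<Sum>u\<in>{u\<in>S. f u = i}. z u * ?P (f u)) = (\<Sum>u\<in>{u\<in>S. f u = i}. z u * ?P i)"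
      by (intro sum.cong) auto
    then show "(\<Sum>u\<in>{u\<in>S. f u = i}. z u * ?P (f u)) = (?P i)\<^sup>2"
      by (simp only: power2_eq_square sum_distrib_right)
  qed
  finally have 1: "?\<sigma>\<^sup>2 = quad_form S z +
      (\<Sum>u\<in>S. \<Sum>w\<in>S. if f u \<noteq> f w \<and> \<not> E u w then z u * z w else 0) + (\<Sum>i<r. (?P i)\<^sup>2)" .
  have tot: "(\<Sum>i<r. ?P i) = ?\<sigma>" by (rule sum.group[OF S _ fr]) simp
  have "(\<Sum>i<r. (?P i - ?\<sigma> / real r)\<^sup>2) =
      (\<Sum>i<r. (?P i)\<^sup>2 + (- 2 * ?\<sigma> / real r) * ?P i + (?\<sigma> / real r)\<^sup>2)"
    by (intro sum.cong) (auto simp: power2_eq_square algebra_simps)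
  also have "\<dots> = (\<Sum>i<r. (?P i)\<^sup>2) + (- 2 * ?\<sigma> / real r) * ?\<sigma> + real r * (?\<sigma> / real r)\<^sup>2"
    by (simp only: sum.distrib sum_distrib_left[symmetric] tot) simp
  also have "\<dots> = (\<Sum>i<r. (?P i)\<^sup>2) - ?\<sigma>\<^sup>2 / real r"
    using r by (simp add: power2_eq_square field_simps)
  finally have 2: "(\<Sum>i<r. (?P i - ?\<sigma> / real r)\<^sup>2) = (\<Sum>i<r. (?P i)\<^sup>2) - ?\<sigma>\<^sup>2 / real r" .
  have "(1 - 1 / real r) * ?\<sigma>\<^sup>2 = ?\<sigma>\<^sup>2 - ?\<sigma>\<^sup>2 / real r" by (simp add: left_diff_distrib)
  then show ?thesis using 1 2 by linarith
qed

lemma perron_le_of_proper_colouring: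
  assumes "finite S" "perron S \<mu> x" "proper_colouring r S f" "r \<ge> 1"
  shows "\<mu> \<le> (1 - 1 / real r) * real (card S)"
proof -
  have x: "\<And>v. v \<in> S \<Longrightarrow> 0 \<le> x v" "(\<Sum>v\<in>S. (x v)\<^sup>2) = 1"
    using assms(2) by (auto simp: perron_def)
  have "0 \<le> (\<Sum>u\<in>S. \<Sum>w\<in>S. if f u \<noteq> f w \<and> \<not> E u w then x u * x w else 0)"
    using x by (intro sum_nonneg) auto
  moreover have "0 \<le> (\<Sum>i<r. (sum x {v \<in> S. f v = i} - sum x S / real r)\<^sup>2)" by (intro sum_nonneg) auto
  ultimately have "\<mu> \<le> (1 - 1 / real r) * (sum x S)\<^sup>2"
    unfolding perron_quad_form[OF assms(1,2), symmetric] quad_form_proper_colouring[OF assms(1,3,4)]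
    by linarith
  also have "\<dots> \<le> (1 - 1 / real r) * real (card S)"
    using sum_squared_le_sum_of_squares[of x S] x assms(4) by (intro mult_left_mono) auto
  finally show ?thesis .
qed

text \<open>The two deficits and the gap between the squares of \<open>m\<close> and of the total
  weight are all \<open>O(b)\<close> times the square of \<open>m\<close>. The gap makes the entries
  nearly constant, the imbalance makes the parts nearly equal, and the missing weight leaves few
  vertices with \<open>\<beta> * m\<close> missing neighbours.\<close>

lemma partite_near_regular:
  fixes b \<beta> :: real
  assumes S: "finite S" "card S = m" "m > 0" and P: "perron S \<mu> x"
    and f: "proper_colouring r S f" and r: "r \<ge> 2"
    and mu: "\<mu> \<ge> (1 - 1 / real r - b) * real m" and b: "b \<ge> 0" and \<beta>: "\<beta> > 0"
  shows "\<exists>B\<subseteq>S. real (card B) \<le> (16 * b + 4 * b / \<beta>) * real m \<and>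
    (\<forall>v\<in>S - B. real (card (nbrs (S - B) v)) >
       (1 - 1 / real r - 3 * sqrt b - \<beta> - (16 * b + 4 * b / \<beta>)) * real m)"
proof -
  let ?m = "real m"
  have m: "?m > 0" using S by simp
  \<comment> \<open>Scaled so that the constant vector of the same norm has all entries 1.\<close>
  define z where "z v = sqrt ?m * x v" for v
  have z0: "\<And>v. v \<in> S \<Longrightarrow> 0 \<le> z v" using P by (auto simp: z_def perron_def)
  have zz: "(\<Sum>v\<in>S. (z v)\<^sup>2) = ?m"
    using P by (simp add: z_def power_mult_distrib sum_distrib_left[symmetric] perron_def)
  define \<sigma> where "\<sigma> = sum z S"
  define miss where "miss = (\<Sum>u\<in>S. \<Sum>w\<in>S. if f u \<noteq> f w \<and> \<not> E u w then z u * z w else 0)"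
  define p where "p i = sum z {v\<in>S. f v = i}" for i
  have miss0: "0 \<le> miss" unfolding miss_def using z0 by (intro sum_nonneg) auto
  have var0: "0 \<le> (\<Sum>i<r. (p i - \<sigma> / real r)\<^sup>2)" by (intro sum_nonneg) auto
  have \<sigma>0: "0 \<le> \<sigma>" unfolding \<sigma>_def using z0 by (rule sum_nonneg)
  have "\<sigma>\<^sup>2 \<le> ?m\<^sup>2" using sum_squared_le_sum_of_squares[of z S] zz S(2)
    by (simp add: \<sigma>_def power2_eq_square)
  then have \<sigma>m: "\<sigma> \<le> ?m" using m by (simp add: power2_le_iff_abs_le)
  have a: "1 / 2 \<le> 1 - 1 / real r" using r by (simp add: field_simps)
  have "quad_form S z = ?m * \<mu>"
    using quad_form_scale[of S "sqrt ?m" x] perron_quad_form[OF S(1) P] by (simp add: z_def[abs_def])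
  moreover have "(1 - 1 / real r - b) * ?m\<^sup>2 \<le> ?m * \<mu>"
    using mult_left_mono[OF mu, of ?m] by (simp add: power2_eq_square mult_ac)
  ultimately have main: "(1 - 1 / real r - b) * ?m\<^sup>2 \<le>
      (1 - 1 / real r) * \<sigma>\<^sup>2 - (\<Sum>i<r. (p i - \<sigma> / real r)\<^sup>2) - miss"
    using quad_form_proper_colouring[OF S(1) f, of z] r by (simp add: \<sigma>_def miss_def p_def)
  have le: "(1 - 1 / real r) * \<sigma>\<^sup>2 \<le> (1 - 1 / real r) * ?m\<^sup>2"
    using \<open>\<sigma>\<^sup>2 \<le> ?m\<^sup>2\<close> a by (intro mult_left_mono) auto
  have var: "(\<Sum>i<r. (p i - \<sigma> / real r)\<^sup>2) \<le> b * ?m\<^sup>2" and miss: "miss \<le> b * ?m\<^sup>2"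
    using main le miss0 var0 by (simp_all add: left_diff_distrib)
  have 1: "(1 - 1 / real r) * (?m\<^sup>2 - \<sigma>\<^sup>2) \<le> b * ?m\<^sup>2"
    using main miss0 var0 by (simp add: algebra_simps)
  have "1 / 2 * (?m\<^sup>2 - \<sigma>\<^sup>2) \<le> (1 - 1 / real r) * (?m\<^sup>2 - \<sigma>\<^sup>2)"
    using a \<open>\<sigma>\<^sup>2 \<le> ?m\<^sup>2\<close> by (intro mult_right_mono) auto
  from order_trans[OF this 1] have "?m\<^sup>2 - \<sigma>\<^sup>2 \<le> 2 * b * ?m\<^sup>2" by simp
  moreover have "\<sigma>\<^sup>2 \<le> \<sigma> * ?m" using \<sigma>m \<sigma>0 by (simp add: power2_eq_square mult_left_mono)
  ultimately have "?m * (?m - \<sigma>) \<le> ?m * (2 * b * ?m)" by (simp add: power2_eq_square algebra_simps)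
  then have "?m - \<sigma> \<le> 2 * b * ?m" using m by (simp only: mult_le_cancel_left_pos)
  moreover have "(\<Sum>v\<in>S. (z v - 1)\<^sup>2) = 2 * (?m - \<sigma>)"
  proof -
    have "(\<Sum>v\<in>S. (z v - 1)\<^sup>2) = (\<Sum>v\<in>S. (z v)\<^sup>2 - 2 * z v + 1)"
      by (intro sum.cong) (auto simp: power2_eq_square algebra_simps)
    also have "\<dots> = ?m - 2 * \<sigma> + ?m"
      by (simp add: sum.distrib sum_subtractf zz sum_distrib_left[symmetric] S(2) \<sigma>_def)
    finally show ?thesis by simp
  qed
  ultimately have dev: "(\<Sum>v\<in>S. (z v - 1)\<^sup>2) \<le> 4 * b * ?m" by simp
  \<comment> \<open>Of the error, \<open>2 * sqrt b\<close> comes from counting vertices instead of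
    their weight and \<open>sqrt b\<close> from the imbalance.\<close>
  have part: "real (card {v\<in>S. f v = i}) \<le> ?m / real r + 3 * sqrt b * ?m" if "i < r" for i
  proof -
    let ?A = "{v\<in>S. f v = i}"
    have cA: "real (card ?A) \<le> ?m" using card_mono[OF S(1), of ?A] S(2) by auto
    have "(\<Sum>v\<in>?A. 1 - z v)\<^sup>2 \<le> (\<Sum>v\<in>?A. (1 - z v)\<^sup>2) * real (card ?A)"
      by (rule sum_squared_le_sum_of_squares)
    also have "\<dots> \<le> (4 * b * ?m) * ?m"
    proof (intro mult_mono cA)
      have "(\<Sum>v\<in>?A. (1 - z v)\<^sup>2) \<le> (\<Sum>v\<in>S. (1 - z v)\<^sup>2)"
        using S(1) by (intro sum_mono2) auto
      then show "(\<Sum>v\<in>?A. (1 - z v)\<^sup>2) \<le> 4 * b * ?m" using dev by (simp add: power2_commute)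
    qed (use b m in auto)
    also have "\<dots> = (2 * sqrt b * ?m)\<^sup>2" using b by (simp add: power_mult_distrib power2_eq_square)
    finally have "(\<Sum>v\<in>?A. 1 - z v) \<le> 2 * sqrt b * ?m"
      by (rule power2_le_imp_le) (use b m in auto)
    then have 1: "real (card ?A) - p i \<le> 2 * sqrt b * ?m" by (simp add: sum_subtractf p_def)
    have "(p i - \<sigma> / real r)\<^sup>2 \<le> (\<Sum>i<r. (p i - \<sigma> / real r)\<^sup>2)"
      using that by (intro member_le_sum) auto
    also have "\<dots> \<le> (sqrt b * ?m)\<^sup>2" using var b by (simp add: power_mult_distrib)
    finally have "p i - \<sigma> / real r \<le> sqrt b * ?m"
      by (rule power2_le_imp_le) (use b m in auto)
    moreover have "\<sigma> / real r \<le> ?m / real r" using \<sigma>m by (intro divide_right_mono) auto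
    ultimately show ?thesis using 1 by linarith
  qed
  \<comment> \<open>Once the entries below \<open>1 / 2\<close> are discarded, every missing pair
    weighs at least \<open>1 / 4\<close>, so \<open>miss\<close> bounds the number of missing
    pairs.\<close>
  define B1 where "B1 = {v\<in>S. z v < 1 / 2}"
  define M where "M v = {u\<in>S - B1. f u \<noteq> f v \<and> \<not> E v u}" for v
  define B2 where "B2 = {v\<in>S - B1. \<beta> * ?m \<le> real (card (M v))}"
  have B1: "real (card B1) \<le> 16 * b * ?m"
  proof -
    have "(\<Sum>v\<in>B1. 1 / 4) \<le> (\<Sum>v\<in>B1. (z v - 1)\<^sup>2)"
    proof (rule sum_mono)
      fix v assume "v \<in> B1"
      then have "1 / 2 \<le> 1 - z v" by (simp add: B1_def)
      then have "(1 / 2)\<^sup>2 \<le> (1 - z v)\<^sup>2" by (intro power_mono) auto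
      then show "1 / 4 \<le> (z v - 1)\<^sup>2" by (simp add: power2_commute power_divide)
    qed
    also have "\<dots> \<le> (\<Sum>v\<in>S. (z v - 1)\<^sup>2)" using S(1) by (intro sum_mono2) (auto simp: B1_def)
    finally show ?thesis using dev by simp
  qed
  have B2: "real (card B2) \<le> 4 * b / \<beta> * ?m"
  proof -
    have "(\<Sum>u\<in>B2. \<beta> * ?m / 4) \<le>
        (\<Sum>u\<in>B2. \<Sum>w\<in>S. if f u \<noteq> f w \<and> \<not> E u w then z u * z w else 0)"
    proof (rule sum_mono)
      fix u assume u: "u \<in> B2"
      have "\<beta> * ?m / 4 \<le> (\<Sum>w\<in>M u. 1 / 4)" using u by (simp add: B2_def)
      also have "\<dots> \<le> (\<Sum>w\<in>M u. z u * z w)"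
      proof (rule sum_mono)
        fix w assume "w \<in> M u"
        then have "1 / 2 \<le> z w" "1 / 2 \<le> z u" using u by (auto simp: M_def B2_def B1_def)
        then have "1 / 2 * (1 / 2) \<le> z u * z w" by (intro mult_mono) auto
        then show "1 / 4 \<le> z u * z w" by simp
      qed
      also have "\<dots> = (\<Sum>w\<in>M u. if f u \<noteq> f w \<and> \<not> E u w then z u * z w else 0)"
        by (intro sum.cong) (auto simp: M_def)
      also have "\<dots> \<le> (\<Sum>w\<in>S. if f u \<noteq> f w \<and> \<not> E u w then z u * z w else 0)"
        using S(1) u z0 by (intro sum_mono2) (auto simp: M_def B2_def)
      finally show "\<beta> * ?m / 4 \<le> \<dots>" .
    qed
    also have "\<dots> \<le> miss"
      unfolding miss_def using S(1) z0 by (intro sum_mono2) (auto simp: B2_def intro!: sum_nonneg)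
    also have "\<dots> \<le> b * ?m\<^sup>2" by (rule miss)
    finally have "?m * (real (card B2) * \<beta>) \<le> ?m * (4 * b * ?m)"
      by (simp add: power2_eq_square mult_ac)
    then have "real (card B2) * \<beta> \<le> 4 * b * ?m" using m by (simp only: mult_le_cancel_left_pos)
    then show ?thesis using \<beta> by (simp add: pos_le_divide_eq)
  qed
  let ?B = "B1 \<union> B2"
  have sub: "?B \<subseteq> S" by (auto simp: B1_def B2_def)
  have finB: "finite B1" "finite B2" using S(1) by (auto simp: B1_def B2_def)
  have "real (card ?B) \<le> real (card B1) + real (card B2)"
    using card_Un_le[of B1 B2] by linarith
  then have cB: "real (card ?B) \<le> (16 * b + 4 * b / \<beta>) * ?m"
    using B1 B2 by (simp add: algebra_simps)
  moreover have "real (card (nbrs (S - ?B) v)) >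
       (1 - 1 / real r - 3 * sqrt b - \<beta> - (16 * b + 4 * b / \<beta>)) * ?m" if v: "v \<in> S - ?B" for v
  proof -
    have "S \<subseteq> nbrs (S - ?B) v \<union> {u\<in>S. f u = f v} \<union> M v \<union> ?B"
      by (auto simp: nbrs_def M_def)
    then have "card S \<le> card (nbrs (S - ?B) v \<union> {u\<in>S. f u = f v} \<union> M v \<union> ?B)"
      using S(1) finB by (intro card_mono) (auto simp: M_def)
    also have "\<dots> \<le> card (nbrs (S - ?B) v \<union> {u\<in>S. f u = f v} \<union> M v) + card ?B" by (rule card_Un_le)
    also have "\<dots> \<le> card (nbrs (S - ?B) v \<union> {u\<in>S. f u = f v}) + card (M v) + card ?B"
      by (intro add_right_mono card_Un_le)
    also have "\<dots> \<le> card (nbrs (S - ?B) v) + card {u\<in>S. f u = f v} + card (M v) + card ?B"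
      by (intro add_right_mono card_Un_le)
    finally have "?m \<le> real (card (nbrs (S - ?B) v)) + real (card {u\<in>S. f u = f v})
        + real (card (M v)) + real (card ?B)"
      using S(2) by linarith
    moreover have "real (card (M v)) < \<beta> * ?m" using v by (auto simp: B2_def)
    moreover have "f v < r" using v f by (auto simp: proper_colouring_def)
    ultimately have "real (card (nbrs (S - ?B) v)) > ?m - (?m / real r + 3 * sqrt b * ?m) - \<beta> * ?m
        - (16 * b + 4 * b / \<beta>) * ?m"
      using part[of "f v"] cB by linarith
    then show ?thesis by (simp add: algebra_simps)
  qed
  ultimately show ?thesis using sub by blast
qed

end

section \<open>Graphs of large minimum degree without large joints\<close>

lemma set_remove_nth_subset:
  "set (remove_nth i xs) \<subseteq> {xs ! j | j. j < length xs \<and> j \<noteq> i}"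
proof
  fix x assume "x \<in> set (remove_nth i xs)"
  then consider "x \<in> set (take i xs)" | "x \<in> set (drop (Suc i) xs)" by (auto simp: remove_nth_def)
  then show "x \<in> {xs ! j | j. j < length xs \<and> j \<noteq> i}"
  proof cases
    case 1
    then obtain j where "j < length (take i xs)" "x = take i xs ! j" by (metis in_set_conv_nth)
    then show ?thesis by (auto intro!: exI[of _ j])
  next
    case 2
    then obtain j where "j < length (drop (Suc i) xs)" "x = drop (Suc i) xs ! j"
      by (metis in_set_conv_nth)
    then show ?thesis by (auto intro!: exI[of _ "Suc i + j"])
  qed
qed

context adjacency
begin

section \<open>Colourings, their monochromatic edges and their missing pairs\<close>

definition mono_edges :: "'a set \<Rightarrow> ('a \<Rightarrow> nat) \<Rightarrow> ('a \<times> 'a) set" where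
  "mono_edges S f = {(u, v). u \<in> S \<and> v \<in> S \<and> E u v \<and> f u = f v}"

definition missing :: "'a set \<Rightarrow> ('a \<Rightarrow> nat) \<Rightarrow> ('a \<times> 'a) set" where
  "missing S f = {(u, v). u \<in> S \<and> v \<in> S \<and> f u \<noteq> f v \<and> \<not> E u v}"

lemma finite_mono_edges [simp]: "finite S \<Longrightarrow> finite (mono_edges S f)"
  by (rule finite_subset[of _ "S \<times> S"]) (auto simp: mono_edges_def)

lemma finite_missing [simp]: "finite S \<Longrightarrow> finite (missing S f)"
  by (rule finite_subset[of _ "S \<times> S"]) (auto simp: missing_def)

text \<open>A missing pair lies in at most \<open>h ^ (card T - 2)\<close> of the
  \<open>h ^ card T\<close> choices of one vertex from each \<open>N l\<close>, so the bound
  \<open>few\<close> spoils at most half of the choices.\<close>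

lemma transversal_cliques:
  assumes S: "finite S" and T: "finite T"
    and N: "\<And>l. l \<in> T \<Longrightarrow> N l \<subseteq> S" "\<And>l v. l \<in> T \<Longrightarrow> v \<in> N l \<Longrightarrow> f v = l"
      "\<And>l. l \<in> T \<Longrightarrow> card (N l) = h"
    and few: "2 * card (missing S f) \<le> h\<^sup>2"
  shows "h ^ card T \<le> 2 * card (cliques (card T) (\<Union>l\<in>T. N l))"
proof (cases "h = 0")
  case True
  then show ?thesis by (cases "card T") auto
next
  case False
  let ?t = "card T"
  define Bad where "Bad = {g \<in> PiE T N. \<exists>i\<in>T. \<exists>j\<in>T. i \<noteq> j \<and> \<not> E (g i) (g j)}"
  define X where "X = {(u, v) \<in> missing S f. f u \<in> T \<and> f v \<in> T}"
  define box where "box p = PiE T (N(f (fst p) := {fst p}, f (snd p) := {snd p}))" for p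
  have finX: "finite X" and Xle: "card X \<le> card (missing S f)"
    using S finite_subset[of X "missing S f"] card_mono[of "missing S f" X] by (auto simp: X_def)
  have finN: "finite (N l)" if "l \<in> T" for l using N(1)[OF that] S finite_subset by blast
  have finPi: "finite (PiE T N)" using T finN by (intro finite_PiE) auto
  have "Bad \<subseteq> (\<Union>p\<in>X. box p)"
  proof
    fix g assume "g \<in> Bad"
    then obtain i j where g: "g \<in> PiE T N" "i \<in> T" "j \<in> T" "i \<noteq> j" "\<not> E (g i) (g j)"
      by (auto simp: Bad_def)
    have gi: "g i \<in> N i" "g j \<in> N j" using g by auto
    have "f (g i) = i" "f (g j) = j" using gi N(2) g by auto
    moreover have "g i \<in> S" "g j \<in> S" using gi N(1) g by blast+
    ultimately have "(g i, g j) \<in> X" "g \<in> box (g i, g j)"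
      using g by (auto simp: X_def missing_def box_def PiE_def Pi_def)
    then show "g \<in> (\<Union>p\<in>X. box p)" by blast
  qed
  moreover have finbox: "finite (box p)" for p unfolding box_def
    by (intro finite_PiE T) (use finN in auto)
  ultimately have "card Bad \<le> card (\<Union>p\<in>X. box p)" using finX by (intro card_mono) auto
  also have "\<dots> \<le> (\<Sum>p\<in>X. card (box p))" by (rule card_UN_le[OF finX])
  finally have "card Bad * h\<^sup>2 \<le> (\<Sum>p\<in>X. card (box p) * h\<^sup>2)"
    by (metis mult_le_mono1 sum_distrib_right)
  also have "\<dots> = (\<Sum>p\<in>X. h ^ ?t)"
  proof (rule sum.cong[OF refl])
    fix p assume "p \<in> X"
    then have p: "f (fst p) \<in> T" "f (snd p) \<in> T" "f (fst p) \<noteq> f (snd p)"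
      by (auto simp: X_def missing_def)
    let ?i = "f (fst p)" and ?j = "f (snd p)"
    have "card (box p) = (\<Prod>l\<in>T. card ((N(?i := {fst p}, ?j := {snd p})) l))"
      unfolding box_def by (rule card_PiE[OF T])
    also have "\<dots> = (\<Prod>l\<in>T - {?i, ?j}. h)"
      using T N(3) p(3) by (intro prod.mono_neutral_cong_right) auto
    also have "\<dots> = h ^ (?t - 2)"
      using p T by (simp add: card_Diff_subset numeral_2_eq_2)
    finally have "card (box p) = h ^ (?t - 2)" .
    moreover have "card {?i, ?j} \<le> ?t" using p T by (intro card_mono) auto
    then have "?t - 2 + 2 = ?t" using p(3) by simp
    ultimately show "card (box p) * h\<^sup>2 = h ^ ?t" by (metis power_add)
  qed
  finally have "card Bad * h\<^sup>2 \<le> card X * h ^ ?t" by simp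
  also have "\<dots> \<le> card (missing S f) * h ^ ?t" using Xle by (rule mult_le_mono1)
  finally have "2 * (card Bad * h\<^sup>2) \<le> 2 * card (missing S f) * h ^ ?t" by simp
  also have "\<dots> \<le> h\<^sup>2 * h ^ ?t" using few by (rule mult_le_mono1)
  finally have "h\<^sup>2 * (2 * card Bad) \<le> h\<^sup>2 * h ^ ?t" by (simp add: mult_ac)
  then have bad: "2 * card Bad \<le> h ^ ?t" using False by simp
  have cPi: "card (PiE T N) = h ^ ?t" using card_PiE[OF T, of N] N(3) by simp
  have "Bad \<subseteq> PiE T N" by (auto simp: Bad_def)
  then have "card (PiE T N - Bad) = h ^ ?t - card Bad"
    using card_Diff_subset[of Bad "PiE T N"] finPi finite_subset cPi by metis
  then have good: "h ^ ?t \<le> 2 * card (PiE T N - Bad)" using bad by linarith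
  \<comment> \<open>A fixed enumeration of \<open>T\<close> turns choice functions injectively into
    ordered cliques.\<close>
  define ts where "ts = sorted_list_of_set T"
  have ts: "set ts = T" "distinct ts" "length ts = ?t" using T by (auto simp: ts_def)
  have "inj_on (\<lambda>g. map g ts) (PiE T N - Bad)"
    using ts(1) by (intro inj_onI PiE_ext[of _ T N]) auto
  moreover have "(\<lambda>g. map g ts) ` (PiE T N - Bad) \<subseteq> cliques ?t (\<Union>l\<in>T. N l)"
  proof clarify
    fix g assume g: "g \<in> PiE T N" "g \<notin> Bad"
    have "inj_on g T"
    proof (rule inj_onI)
      fix i j assume ij: "i \<in> T" "j \<in> T" "g i = g j"
      have "g i \<in> N i" "g j \<in> N j" using PiE_mem[OF g(1)] ij by blast+
      then show "i = j" using N(2) ij by metis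
    qed
    then show "map g ts \<in> cliques ?t (\<Union>l\<in>T. N l)"
      using g ts by (auto simp: cliques_def distinct_map pairwise_def Bad_def)
  qed
  ultimately have "card (PiE T N - Bad) \<le> card (cliques ?t (\<Union>l\<in>T. N l))"
    using T finN by (intro card_inj_on_le) auto
  with good show ?thesis by linarith
qed

lemma card_mono_edges_remove:
  assumes "finite S" "v \<in> S"
  shows "card (mono_edges S f) = card (mono_edges (S - {v}) f) + 2 * card {u \<in> nbrs S v. f u = f v}"
proof -
  let ?A = "{u \<in> nbrs S v. f u = f v}"
  have fin: "finite ?A" using assms by simp
  have "mono_edges S f = mono_edges (S - {v}) f \<union> ({v} \<times> ?A \<union> ?A \<times> {v})"
    using assms E_sym E_irrefl by (auto simp: mono_edges_def nbrs_def)
  moreover have "mono_edges (S - {v}) f \<inter> ({v} \<times> ?A \<union> ?A \<times> {v}) = {}" by (auto simp: mono_edges_def)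
  moreover have "({v} \<times> ?A) \<inter> (?A \<times> {v}) = {}" using E_irrefl by (auto simp: nbrs_def)
  ultimately show ?thesis using fin assms by (simp add: card_Un_disjoint card_cartesian_product)
qed

text \<open>In a colouring with the fewest monochromatic edges, moving a single vertex
  \<open>v\<close> to class \<open>j\<close> brings no improvement, and it affects only the edges at
  \<open>v\<close>.\<close>

lemma ex_optimal_colouring:
  assumes S: "finite S" and f0: "\<forall>v\<in>S. f0 v < r"
  shows "\<exists>f. (\<forall>v\<in>S. f v < r) \<and> card (mono_edges S f) \<le> card (mono_edges S f0) \<and>
    (\<forall>v\<in>S. \<forall>j<r. card {u \<in> nbrs S v. f u = f v} \<le> card {u \<in> nbrs S v. f u = j})"
proof -
  obtain f where f: "\<forall>v\<in>S. f v < r"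
    and min: "\<And>g. \<forall>v\<in>S. g v < r \<Longrightarrow> card (mono_edges S f) \<le> card (mono_edges S g)"
    using ex_has_least_nat[of "\<lambda>f. \<forall>v\<in>S. f v < r" f0 "\<lambda>f. card (mono_edges S f)"] f0 by blast
  have "card {u \<in> nbrs S v. f u = f v} \<le> card {u \<in> nbrs S v. f u = j}"
    if v: "v \<in> S" and "j < r" for v j
  proof -
    let ?g = "f(v := j)"
    have "card (mono_edges S f) \<le> card (mono_edges S ?g)" using f that by (intro min) auto
    moreover have "mono_edges (S - {v}) ?g = mono_edges (S - {v}) f" by (auto simp: mono_edges_def)
    moreover have "{u \<in> nbrs S v. ?g u = ?g v} = {u \<in> nbrs S v. f u = j}"
      using E_irrefl by (auto simp: nbrs_def)
    ultimately show ?thesis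
      using card_mono_edges_remove[OF S v, of f] card_mono_edges_remove[OF S v, of ?g] by simp
  qed
  with f min[OF f0] show ?thesis by blast
qed

section \<open>Counting cliques under a minimum degree condition\<close>

lemma card_common_ge:
  fixes t :: real
  assumes S: "finite S" "card S = m" and deg: "\<And>v. v \<in> S \<Longrightarrow> real (card (nbrs S v)) \<ge> (1 - t) * real m"
    and "set xs \<subseteq> S"
  shows "real (card (common S xs)) \<ge> (1 - real (length xs) * t) * real m"
  using assms(4)
proof (induction xs)
  case Nil
  then show ?case using S by (simp add: common_def)
next
  case (Cons x xs)
  have "common S xs \<subseteq> common S (x # xs) \<union> (S - nbrs S x)"
    using E_sym by (auto simp: common_def nbrs_def)
  then have "card (common S xs) \<le> card (common S (x # xs) \<union> (S - nbrs S x))"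
    using S by (intro card_mono) auto
  also have "\<dots> \<le> card (common S (x # xs)) + card (S - nbrs S x)" by (rule card_Un_le)
  finally have "real (card (common S xs)) \<le> real (card (common S (x # xs))) + real (card (S - nbrs S x))"
    by linarith
  moreover have "real (card (S - nbrs S x)) = real m - real (card (nbrs S x))"
  proof -
    have "nbrs S x \<subseteq> S" by (auto simp: nbrs_def)
    then show ?thesis using S card_Diff_subset[of "nbrs S x" S] card_mono[of S "nbrs S x"]
      by (simp add: of_nat_diff)
  qed
  ultimately show ?case using Cons deg[of x] by (simp add: algebra_simps)
qed

text \<open>Greedy extension: each vertex of a clique rules out at most \<open>t * m\<close>
  vertices, so a clique with fewer than \<open>r\<close> vertices has at least \<open>q * m\<close>
  common neighbours.\<close>

lemma card_cliques_ge:
  fixes t q :: real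
  assumes S: "finite S" "card S = m" and deg: "\<And>v. v \<in> S \<Longrightarrow> real (card (nbrs S v)) \<ge> (1 - t) * real m"
    and "0 \<le> t" "0 \<le> q" "q \<le> 1 - (real r - 1) * t" and "k \<le> r"
  shows "real (card (cliques k S)) \<ge> (q * real m) ^ k"
  using assms(7)
proof (induction k)
  case (Suc k)
  have "q * real m \<le> real (card (common S xs))" if "xs \<in> cliques k S" for xs
  proof -
    have "real k * t \<le> (real r - 1) * t" using Suc.prems assms(4) by (intro mult_right_mono) auto
    then have "q * real m \<le> (1 - real k * t) * real m" using assms(6) by (intro mult_right_mono) auto
    also have "\<dots> \<le> real (card (common S xs))"
      using card_common_ge[OF S deg, of xs] that by (auto simp: cliques_def)
    finally show ?thesis .
  qed
  then have "(\<Sum>xs\<in>cliques k S. q * real m) \<le> (\<Sum>xs\<in>cliques k S. real (card (common S xs)))"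
    by (intro sum_mono)
  also have "\<dots> = real (card (cliques (Suc k) S))" by (simp add: card_cliques_Suc[OF S(1)])
  finally have "real (card (cliques k S)) * (q * real m) \<le> real (card (cliques (Suc k) S))" by simp
  moreover have "(q * real m) ^ k * (q * real m) \<le> real (card (cliques k S)) * (q * real m)"
    using Suc assms(5) by (intro mult_right_mono) auto
  ultimately show ?case by (simp add: mult.commute)
qed simp

definition common_edges :: "'a set \<Rightarrow> 'a list \<Rightarrow> ('a \<times> 'a) set" where
  "common_edges S xs = {(u, v). u \<in> common S xs \<and> v \<in> common S xs \<and> E u v}"

lemma finite_common_edges [simp]: "finite S \<Longrightarrow> finite (common_edges S xs)"
  by (rule finite_subset[of _ "S \<times> S"]) (auto simp: common_edges_def common_def)

lemma card_cliques_Suc_Suc: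
  assumes "finite S"
  shows "card (cliques (Suc (Suc k)) S) = (\<Sum>xs\<in>cliques k S. card (common_edges S xs))"
proof -
  have 1: "card (common_edges S xs) = (\<Sum>x\<in>common S xs. card (common S (x # xs)))" for xs
  proof -
    have "common_edges S xs = (SIGMA x:common S xs. common S (x # xs))"
      using E_sym by (auto simp: common_edges_def common_def)
    then show ?thesis using assms by simp
  qed
  have "card (cliques (Suc (Suc k)) S) = (\<Sum>ys\<in>cliques (Suc k) S. card (common S ys))"
    by (rule card_cliques_Suc[OF assms])
  also have "\<dots> = (\<Sum>ys\<in>cliques (Suc k) S. card (common S (ys ! 0 # remove_nth 0 ys)))"
    by (intro sum.cong refl) (auto simp: cliques_def remove_nth_def length_Suc_conv)
  also have "\<dots> = (\<Sum>xs\<in>cliques k S. \<Sum>x\<in>common S xs. card (common S (x # xs)))"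
    using assms by (rule sum_cliques_Suc) simp
  finally show ?thesis by (simp add: 1)
qed

lemma markov_count:
  fixes t :: real
  assumes "finite X" "t > 0"
  shows "t * real (card {x\<in>X. real (g x) > t}) \<le> (\<Sum>x\<in>X. real (g x))"
proof -
  have "t * real (card {x\<in>X. real (g x) > t}) = (\<Sum>x\<in>{x\<in>X. real (g x) > t}. t)" by simp
  also have "\<dots> \<le> (\<Sum>x\<in>{x\<in>X. real (g x) > t}. real (g x))" by (intro sum_mono) auto
  also have "\<dots> \<le> (\<Sum>x\<in>X. real (g x))" using assms by (intro sum_mono2) auto
  finally show ?thesis .
qed

text \<open>There are \<open>k + 2\<close> requirements on \<open>Q\<close>. Counting
  \<open>(k + 2)\<close>-cliques by extensions of \<open>Q\<close> or by edges in a common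
  neighbourhood, Markov's inequality shows that each fails for at most
  \<open>card (cliques (k + 2) S) / (\<eta> * m)\<close> cliques; by \<open>few\<close>, some clique
  fails none.\<close>

lemma ex_typical_clique:
  fixes \<eta> :: real
  assumes S: "finite S" "card S = m" "m > 0" and \<eta>: "\<eta> > 0"
    and few: "real (k + 2) * real (card (cliques (k + 2) S)) < \<eta> * real m * real (card (cliques (k + 1) S))"
  shows "\<exists>Q\<in>cliques (k + 1) S. real (card (common S Q)) \<le> \<eta> * real m \<and>
    (\<forall>i\<le>k. real (card (common_edges S (remove_nth i Q))) \<le> \<eta> * (real m)\<^sup>2)"
proof (rule ccontr)
  assume no: "\<not> ?thesis"
  let ?C = "cliques (Suc k) S" and ?c = "real (card (cliques (Suc (Suc k)) S))"
  define B0 where "B0 = {Q\<in>?C. real (card (common S Q)) > \<eta> * real m}"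
  define B where "B i = {Q\<in>?C. real (card (common_edges S (remove_nth i Q))) > \<eta> * (real m)\<^sup>2}" for i
  have B0: "\<eta> * real m * real (card B0) \<le> ?c"
    unfolding B0_def card_cliques_Suc[OF S(1), of "Suc k"] of_nat_sum
    using S \<eta> by (intro markov_count) auto
  have B: "\<eta> * real m * real (card (B i)) \<le> ?c" if "i \<le> k" for i
  proof -
    let ?X = "{xs\<in>cliques k S. real (card (common_edges S xs)) > \<eta> * (real m)\<^sup>2}"
    have "card (B i) = (\<Sum>Q\<in>?C. if real (card (common_edges S (remove_nth i Q))) > \<eta> * (real m)\<^sup>2 then 1 else 0)"
      using S(1) by (simp add: B_def sum.If_cases Int_def)
    also have "\<dots> = (\<Sum>xs\<in>cliques k S. \<Sum>x\<in>common S xs.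
        if real (card (common_edges S xs)) > \<eta> * (real m)\<^sup>2 then 1 else 0)"
      using sum_cliques_Suc[OF S(1) that,
          of "\<lambda>xs x. if real (card (common_edges S xs)) > \<eta> * (real m)\<^sup>2 then 1 else 0 :: nat"] by simp
    \<comment> \<open>A \<open>k\<close>-clique extends to at most \<open>m\<close> cliques
      \<open>Q\<close>; hence the threshold for edges has one more factor \<open>m\<close> than the
      one for vertices.\<close>
    also have "\<dots> \<le> (\<Sum>xs\<in>cliques k S. if real (card (common_edges S xs)) > \<eta> * (real m)\<^sup>2 then m else 0)"
      using card_mono[OF S(1)] S(2) by (intro sum_mono) (auto simp: common_def)
    also have "\<dots> = m * card ?X" using S(1) by (simp add: sum.If_cases Int_def)
    finally have "real (card (B i)) \<le> real m * real (card ?X)" by (metis of_nat_le_iff of_nat_mult)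
    then have "\<eta> * real m * real (card (B i)) \<le> \<eta> * real m * (real m * real (card ?X))"
      using \<eta> by (intro mult_left_mono) auto
    also have "\<dots> = \<eta> * (real m)\<^sup>2 * real (card ?X)" by (simp add: power2_eq_square)
    also have "\<dots> \<le> ?c"
      unfolding card_cliques_Suc_Suc[OF S(1)] of_nat_sum
      using S \<eta> by (intro markov_count) auto
    finally show ?thesis .
  qed
  have "?C \<subseteq> B0 \<union> (\<Union>i\<le>k. B i)"
    using no by (auto simp: B0_def B_def not_le)
  then have "card ?C \<le> card (B0 \<union> (\<Union>i\<le>k. B i))"
    using S(1) by (intro card_mono) (auto simp: B0_def B_def)
  also have "\<dots> \<le> card B0 + card (\<Union>i\<le>k. B i)" by (rule card_Un_le)
  also have "\<dots> \<le> card B0 + (\<Sum>i\<le>k. card (B i))" by (intro add_left_mono card_UN_le) simp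
  finally have "real (card ?C) \<le> real (card B0) + (\<Sum>i\<le>k. real (card (B i)))"
    by (metis of_nat_add of_nat_le_iff of_nat_sum)
  then have "\<eta> * real m * real (card ?C) \<le> \<eta> * real m * (real (card B0) + (\<Sum>i\<le>k. real (card (B i))))"
    using \<eta> by (intro mult_left_mono) auto
  also have "\<dots> = \<eta> * real m * real (card B0) + (\<Sum>i\<le>k. \<eta> * real m * real (card (B i)))"
    by (simp only: distrib_left sum_distrib_left)
  also have "\<dots> \<le> ?c + (\<Sum>i\<le>k. ?c)" using B0 B by (intro add_mono sum_mono) auto
  also have "\<dots> = real (k + 2) * ?c" by (simp add: algebra_simps)
  finally show False using few by simp
qed

text \<open>The members of \<open>Q\<close> have together at most
  \<open>(1 + r * \<epsilon>) * m\<close> non-neighbours. All but \<open>\<eta> * m\<close> vertices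
  account for one of these, so only few, the set \<open>U\<close>, can account for two. Outside
  \<open>U\<close> a monochromatic edge lies in the common neighbourhood of \<open>r - 1\<close>
  members of \<open>Q\<close>.\<close>

lemma ex_colouring_few_mono_edges:
  fixes \<eta> \<epsilon> :: real
  assumes S: "finite S" "card S = m" "m > 0" and r: "r = k + 1"
    and deg: "\<And>v. v \<in> S \<Longrightarrow> real (card (nbrs S v)) \<ge> (1 - (1 / real r + \<epsilon>)) * real m"
    and Q: "Q \<in> cliques r S" "real (card (common S Q)) \<le> \<eta> * real m"
      "\<And>i. i \<le> k \<Longrightarrow> real (card (common_edges S (remove_nth i Q))) \<le> \<eta> * (real m)\<^sup>2"
  shows "\<exists>f. (\<forall>v\<in>S. f v < r) \<and>
    real (card (mono_edges S f)) \<le> (2 * real r * \<epsilon> + (real r + 2) * \<eta>) * (real m)\<^sup>2"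
proof -
  have len: "length Q = r" and QS: "set Q \<subseteq> S" using Q by (auto simp: cliques_def)
  define U where "U = {w\<in>S. \<forall>i<r. w \<notin> common S (remove_nth i Q)}"
  \<comment> \<open>Colour 0 on \<open>U\<close> is arbitrary, since all edges meeting
    \<open>U\<close> are counted separately. The choice operator matters only for common neighbours
    of all of \<open>Q\<close>, which fit every class.\<close>
  define f where "f w = (if w \<in> U \<or> w \<notin> S then 0 else SOME i. i < r \<and> w \<in> common S (remove_nth i Q))" for w
  have f: "f w < r \<and> w \<in> common S (remove_nth (f w) Q)" if "w \<in> S - U" for w
  proof -
    have "\<exists>i. i < r \<and> w \<in> common S (remove_nth i Q)" using that by (auto simp: U_def)
    from someI_ex[OF this] show ?thesis using that by (simp add: f_def)
  qed
  have fr: "f w < r" if "w \<in> S" for w using f[of w] that r by (cases "w \<in> U") (auto simp: f_def)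
  have finU: "finite U" and US: "U \<subseteq> S" using S by (auto simp: U_def)
  define non where "non w = {i \<in> {..<r}. \<not> E w (Q ! i)}" for w
  have non: "(if w \<in> common S Q then 0 else 1) + (if w \<in> U then 1 else 0) \<le> card (non w)"
    if w: "w \<in> S" for w
  proof -
    have fin: "finite (non w)" by (simp add: non_def)
    have "\<not> card (non w) \<le> 1" if "w \<in> U"
    proof
      assume "card (non w) \<le> 1"
      then have "\<exists>i<r. non w \<subseteq> {i}"
      proof (cases "non w = {}")
        case True
        then show ?thesis using r by auto
      next
        case False
        then have "card (non w) = 1" using \<open>card (non w) \<le> 1\<close> fin
          by (metis card_0_eq le_antisym One_nat_def Suc_leI not_gr_zero)
        then obtain i where "non w = {i}" by (auto simp: card_1_singleton_iff)
        moreover from this have "i < r" by (auto simp: non_def)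
        ultimately show ?thesis by auto
      qed
      then obtain i where i: "i < r" "non w \<subseteq> {i}" by blast
      have "w \<in> common S (remove_nth i Q)"
        using set_remove_nth_subset[of i Q] i w len by (fastforce simp: common_def non_def)
      with that i show False by (auto simp: U_def)
    qed
    moreover have "card (non w) \<noteq> 0" if nc: "w \<notin> common S Q"
    proof -
      obtain i where "i < r" "\<not> E w (Q ! i)"
        using nc w len by (auto simp: common_def in_set_conv_nth)
      then have "i \<in> non w" by (simp add: non_def)
      with fin show ?thesis by auto
    qed
    ultimately show ?thesis by auto
  qed
  have "real m - real (card (common S Q)) + real (card U) =
      real (\<Sum>w\<in>S. (if w \<in> common S Q then 0 else 1) + (if w \<in> U then 1 else 0))"
  proof -
    have "common S Q \<subseteq> S" by (auto simp: common_def)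
    then have "card (S - common S Q) = m - card (common S Q)" "card (common S Q) \<le> m"
      using S card_Diff_subset[of "common S Q" S] card_mono[of S "common S Q"] by auto
    moreover have "S \<inter> - common S Q = S - common S Q" by auto
    moreover have "S \<inter> U = U" using US by auto
    ultimately show ?thesis using S(1) by (simp add: sum.distrib sum.If_cases of_nat_diff)
  qed
  also have "\<dots> \<le> real (\<Sum>w\<in>S. card (non w))"
    using non by (intro of_nat_mono sum_mono)
  also have "(\<Sum>w\<in>S. card (non w)) = (\<Sum>w\<in>S. \<Sum>i<r. if \<not> E w (Q ! i) then 1 else 0)"
    by (simp add: non_def sum.If_cases Int_def)
  also have "\<dots> = (\<Sum>i<r. \<Sum>w\<in>S. if \<not> E w (Q ! i) then 1 else 0)" by (rule sum.swap)
  also have "\<dots> = (\<Sum>i<r. card (S - nbrs S (Q ! i)))"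
  proof (rule sum.cong[OF refl])
    fix i
    have "{w \<in> S. \<not> E w (Q ! i)} = S - nbrs S (Q ! i)" using E_sym by (auto simp: nbrs_def)
    then show "(\<Sum>w\<in>S. if \<not> E w (Q ! i) then 1 else 0) = card (S - nbrs S (Q ! i))"
      using S(1) by (simp add: sum.If_cases Int_def)
  qed
  also have "real \<dots> \<le> (\<Sum>i<r. (1 / real r + \<epsilon>) * real m)"
  proof (unfold of_nat_sum, rule sum_mono)
    fix i assume "i \<in> {..<r}"
    then have "Q ! i \<in> S" using len QS by (metis lessThan_iff nth_mem subset_iff)
    moreover have "nbrs S (Q ! i) \<subseteq> S" by (auto simp: nbrs_def)
    then have "real (card (S - nbrs S (Q ! i))) = real m - real (card (nbrs S (Q ! i)))"
      using S card_Diff_subset[of "nbrs S (Q ! i)" S] card_mono[of S "nbrs S (Q ! i)"]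
      by (simp add: of_nat_diff)
    ultimately show "real (card (S - nbrs S (Q ! i))) \<le> (1 / real r + \<epsilon>) * real m"
      using deg[of "Q ! i"] by (simp add: algebra_simps)
  qed
  also have "\<dots> = (1 + real r * \<epsilon>) * real m" using r by (simp add: field_simps)
  finally have "real (card U) \<le> real r * \<epsilon> * real m + \<eta> * real m"
    using Q(2) by (simp add: algebra_simps)
  then have U: "real (card U) * real m \<le> (real r * \<epsilon> + \<eta>) * (real m)\<^sup>2"
    using mult_right_mono[of "real (card U)" "(real r * \<epsilon> + \<eta>) * real m" "real m"]
    by (simp add: algebra_simps power2_eq_square)
  have "mono_edges S f \<subseteq> U \<times> S \<union> S \<times> U \<union> (\<Union>i<r. common_edges S (remove_nth i Q))"
  proof (rule subrelI)
    fix u v assume "(u, v) \<in> mono_edges S f"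
    then have uv: "u \<in> S" "v \<in> S" "E u v" "f u = f v" by (auto simp: mono_edges_def)
    show "(u, v) \<in> U \<times> S \<union> S \<times> U \<union> (\<Union>i<r. common_edges S (remove_nth i Q))"
    proof (cases "u \<in> U \<or> v \<in> U")
      case False
      then have "(u, v) \<in> common_edges S (remove_nth (f u) Q)" "f u < r"
        using f[of u] f[of v] uv by (auto simp: common_edges_def)
      then show ?thesis by blast
    qed (use uv in blast)
  qed
  then have "card (mono_edges S f) \<le> card (U \<times> S \<union> S \<times> U \<union> (\<Union>i<r. common_edges S (remove_nth i Q)))"
    using S(1) finU by (intro card_mono) auto
  also have "\<dots> \<le> card (U \<times> S \<union> S \<times> U) + card (\<Union>i<r. common_edges S (remove_nth i Q))"
    by (rule card_Un_le)
  also have "\<dots> \<le> (card (U \<times> S) + card (S \<times> U)) + (\<Sum>i<r. card (common_edges S (remove_nth i Q)))"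
    by (intro add_mono card_Un_le card_UN_le) simp
  finally have "real (card (mono_edges S f)) \<le>
      real ((card (U \<times> S) + card (S \<times> U)) + (\<Sum>i<r. card (common_edges S (remove_nth i Q))))"
    by (rule of_nat_mono)
  also have "\<dots> = 2 * (real (card U) * real m) + (\<Sum>i<r. real (card (common_edges S (remove_nth i Q))))"
    by (simp add: card_cartesian_product S(2))
  also have "\<dots> \<le> 2 * ((real r * \<epsilon> + \<eta>) * (real m)\<^sup>2) + (\<Sum>i<r. \<eta> * (real m)\<^sup>2)"
    using U Q(3) r by (intro add_mono mult_left_mono sum_mono) auto
  also have "\<dots> = (2 * real r * \<epsilon> + (real r + 2) * \<eta>) * (real m)\<^sup>2"
    by (simp add: algebra_simps)
  finally show ?thesis using fr by blast
qed


lemma card_cliques_Suc_le: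
  assumes S: "finite S"
  shows "card (cliques (Suc k) S) \<le> (\<Sum>v\<in>S. card (cliques k (nbrs S v)))"
proof -
  have "cliques (Suc k) S \<subseteq> (\<Union>v\<in>S. (#) v ` cliques k (nbrs S v))"
  proof
    fix xs assume xs: "xs \<in> cliques (Suc k) S"
    then obtain v ys where v: "xs = v # ys" by (cases xs) (auto simp: cliques_def)
    with xs have "ys \<in> cliques k S" "v \<in> common S ys" by (simp_all add: Cons_in_cliques_iff)
    then have "v \<in> S" "ys \<in> cliques k (nbrs S v)" by (auto simp: common_def nbrs_def cliques_def)
    with v show "xs \<in> (\<Union>v\<in>S. (#) v ` cliques k (nbrs S v))" by blast
  qed
  then have "card (cliques (Suc k) S) \<le> card (\<Union>v\<in>S. (#) v ` cliques k (nbrs S v))"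
    using S by (intro card_mono) auto
  also have "\<dots> \<le> (\<Sum>v\<in>S. card ((#) v ` cliques k (nbrs S v)))"
    by (rule card_UN_le[OF S])
  also have "\<dots> = (\<Sum>v\<in>S. card (cliques k (nbrs S v)))"
    by (intro sum.cong refl card_image) (auto simp: inj_on_def)
  finally show ?thesis .
qed

lemma real_card_cliques_Suc_le:
  assumes "finite S" "card S \<le> m" "0 \<le> J" "\<And>v. v \<in> S \<Longrightarrow> real (card (cliques k (nbrs S v))) \<le> J"
  shows "real (card (cliques (Suc k) S)) \<le> real m * J"
proof -
  have "real (card (cliques (Suc k) S)) \<le> real (\<Sum>v\<in>S. card (cliques k (nbrs S v)))"
    by (rule of_nat_mono[OF card_cliques_Suc_le[OF assms(1)]])
  also have "\<dots> \<le> (\<Sum>v\<in>S. J)" unfolding of_nat_sum using assms by (intro sum_mono) auto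
  also have "\<dots> \<le> real m * J" using assms by (simp add: mult_right_mono)
  finally show ?thesis .
qed

text \<open>In \<open>S \<times> S\<close> the pairs within a class, diagonal included, number at
  least \<open>m\<^sup>2 / r\<close> by convexity; the missing pairs and the bichromatic edges are
  disjoint from them, and the degrees force \<open>d * m\<^sup>2\<close> edges. The second bound
  compares the degree sum of a class with the room outside it.\<close>

lemma card_missing_and_class_bounds:
  assumes S: "finite S" "card S = m" and f: "\<forall>v\<in>S. f v < r" and r: "r > 0"
    and deg: "\<And>v. v \<in> S \<Longrightarrow> real (card (nbrs S v)) \<ge> d * real m"
  shows "real (card (missing S f)) \<le> (1 - 1 / real r - d) * (real m)\<^sup>2 + real (card (mono_edges S f))"
    and "real (card {v\<in>S. f v = i}) * (d * real m) \<le>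
      real (card {v\<in>S. f v = i}) * (real m - real (card {v\<in>S. f v = i})) + real (card (mono_edges S f))"
proof -
  define A where "A i = {v\<in>S. f v = i}" for i
  have finA: "finite (A i)" for i using S by (simp add: A_def)
  define same where "same = (SIGMA u:S. A (f u))"
  define Ed where "Ed = (SIGMA u:S. nbrs S u)"
  have fr: "f ` S \<subseteq> {..<r}" using f by auto
  have "(\<Sum>i<r. card (A i)) = card S"
    unfolding A_def using sum.group[OF S(1) _ fr, of "\<lambda>_. 1 :: nat"] by simp
  then have tot: "(\<Sum>i<r. real (card (A i))) = real m" using S(2) by (metis of_nat_sum)
  have "card same = (\<Sum>u\<in>S. card (A (f u)))" unfolding same_def using S finA by simp
  also have "\<dots> = (\<Sum>i<r. \<Sum>u\<in>A i. card (A (f u)))"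
    unfolding A_def by (rule sum.group[OF S(1) _ fr, symmetric]) simp
  also have "\<dots> = (\<Sum>i<r. card (A i) * card (A i))"
    by (intro sum.cong refl) (auto simp: A_def)
  finally have "real (card same) = (\<Sum>i<r. (real (card (A i)))\<^sup>2)"
    by (simp add: power2_eq_square)
  moreover have "(real m)\<^sup>2 \<le> (\<Sum>i<r. (real (card (A i)))\<^sup>2) * real r"
    using sum_squared_le_sum_of_squares[of "\<lambda>i. real (card (A i))" "{..<r}"] tot by simp
  ultimately have same: "(real m)\<^sup>2 / real r \<le> real (card same)" using r by (simp add: field_simps)
  have "real (card Ed) = (\<Sum>u\<in>S. real (card (nbrs S u)))" unfolding Ed_def using S by simp
  also have "\<dots> \<ge> (\<Sum>u\<in>S. d * real m)" using deg by (intro sum_mono) auto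
  finally have Ed: "d * (real m)\<^sup>2 \<le> real (card Ed)" using S(2) by (simp add: power2_eq_square mult_ac)
  have fin: "finite same" "finite Ed" "finite (missing S f)" "finite (mono_edges S f)"
    using S finA by (auto simp: same_def Ed_def)
  have "mono_edges S f \<subseteq> Ed" by (auto simp: mono_edges_def Ed_def nbrs_def)
  then have "card (Ed - mono_edges S f) + card (mono_edges S f) = card Ed"
    using fin by (metis card_Diff_subset card_mono le_add_diff_inverse2)
  moreover have "card (same \<union> missing S f \<union> (Ed - mono_edges S f)) = card same + card (missing S f) + card (Ed - mono_edges S f)"
  proof -
    have "(same \<union> missing S f) \<inter> (Ed - mono_edges S f) = {}" "same \<inter> missing S f = {}"
      by (auto simp: same_def missing_def Ed_def mono_edges_def A_def nbrs_def)
    then show ?thesis using fin by (simp add: card_Un_disjoint)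
  qed
  moreover have "card (same \<union> missing S f \<union> (Ed - mono_edges S f)) \<le> card (S \<times> S)"
    using S by (intro card_mono) (auto simp: same_def missing_def Ed_def A_def nbrs_def)
  ultimately have "card same + card (missing S f) + card Ed \<le> m * m + card (mono_edges S f)"
    using S(2) by (simp add: card_cartesian_product)
  then have "real (card same) + real (card (missing S f)) + real (card Ed) \<le> real m * real m + real (card (mono_edges S f))"
    by (metis of_nat_add of_nat_le_iff of_nat_mult)
  then show "real (card (missing S f)) \<le> (1 - 1 / real r - d) * (real m)\<^sup>2 + real (card (mono_edges S f))"
    using same Ed by (simp add: algebra_simps power2_eq_square)
  have "(SIGMA u:A i. nbrs S u) \<subseteq> A i \<times> (S - A i) \<union> mono_edges S f"
    by (auto simp: A_def mono_edges_def nbrs_def)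
  then have "card (SIGMA u:A i. nbrs S u) \<le> card (A i \<times> (S - A i) \<union> mono_edges S f)"
    using S finA fin by (intro card_mono) auto
  also have "\<dots> \<le> card (A i \<times> (S - A i)) + card (mono_edges S f)" by (rule card_Un_le)
  also have "card (A i \<times> (S - A i)) = card (A i) * card (S - A i)" by (rule card_cartesian_product)
  finally have 1: "real (card (SIGMA u:A i. nbrs S u)) \<le> real (card (A i)) * real (card (S - A i)) + real (card (mono_edges S f))"
    by (metis of_nat_add of_nat_le_iff of_nat_mult)
  have "A i \<subseteq> S" by (auto simp: A_def)
  then have 2: "real (card (S - A i)) = real m - real (card (A i))"
    using S finA card_Diff_subset[of "A i" S] card_mono[of S "A i"] by (simp add: of_nat_diff)
  have "real (card (SIGMA u:A i. nbrs S u)) = (\<Sum>u\<in>A i. real (card (nbrs S u)))" using S finA by simp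
  also have "\<dots> \<ge> (\<Sum>u\<in>A i. d * real m)" using deg by (intro sum_mono) (auto simp: A_def)
  finally have "real (card (A i)) * (d * real m) \<le> real (card (SIGMA u:A i. nbrs S u))" by simp
  from order_trans[OF this 1] show "real (card {v\<in>S. f v = i}) * (d * real m) \<le>
      real (card {v\<in>S. f v = i}) * (real m - real (card {v\<in>S. f v = i})) + real (card (mono_edges S f))"
    unfolding 2 unfolding A_def .
qed

text \<open>
  A typical \<open>r\<close>-clique \<open>Q\<close> has few common neighbours, and any \<open>r - 1\<close> of its vertices have few
  edges in their common neighbourhood. Classifying the vertices by the member of \<open>Q\<close> to which they
  are not adjacent gives an \<open>r\<close>-colouring with few monochromatic edges. In an optimal colouring, a
  vertex with many neighbours in its own class has many in every class, and a monochromatic edge has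
  many common neighbours in every other class; both produce a large joint, as almost all pairs
  between the classes are edges.
\<close>

lemma partite_of_small_joints:
  fixes J :: real and r :: nat
  defines "J \<equiv> 1 / (32 * real r ^ (2 * r + 9))"
  assumes S: "finite S" "card S = m" "m > 0" and r2: "r \<ge> 2"
    and deg: "\<And>v. v \<in> S \<Longrightarrow> real (card (nbrs S v)) \<ge> (1 - 1 / real r - 1 / (48 * real r ^ 4)) * real m"
    and joint: "\<And>u v. u \<in> S \<Longrightarrow> v \<in> S \<Longrightarrow> E u v \<Longrightarrow>
      real (card (cliques (r - 1) (nbrs S u \<inter> nbrs S v))) \<le> J * real m ^ (r - 1)"
  shows "\<exists>f. proper_colouring r S f"
proof -
  obtain k where r: "r = Suc k" using r2 by (cases r) auto
  define R where "R = real r"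
  define M where "M = real m"
  define u where "u = 1 / R"
  define \<epsilon> where "\<epsilon> = u ^ 4 / 48"
  have R: "R \<ge> 2" and M: "M > 0" using r2 S by (auto simp: R_def M_def)
  have u: "u > 0" "u \<le> 1 / 2" "R * u = 1" using R by (auto simp: u_def field_simps)
  have u2: "u\<^sup>2 \<le> u / 2" using mult_left_mono[OF u(2), of u] u by (simp add: power2_eq_square)
  have u3: "u ^ 3 \<le> u\<^sup>2 / 2" using mult_left_mono[OF u(2), of "u\<^sup>2"] u by (simp add: power2_eq_square power3_eq_cube)
  have u4: "u ^ 4 \<le> u ^ 3 / 2" using mult_left_mono[OF u(2), of "u ^ 3"] u by (simp add: power3_eq_cube power4_eq_xxxx)
  have u2p: "u\<^sup>2 > 0" "u ^ 3 > 0" "u ^ 4 > 0" using u by auto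
  have \<epsilon>0: "\<epsilon> > 0" using u2p by (simp add: \<epsilon>_def)
  have J0: "J > 0" using R by (simp add: J_def R_def)
  have eps: "1 / (48 * real r ^ 4) = \<epsilon>" by (simp add: \<epsilon>_def u_def R_def power_one_over)
  have deg': "real (card (nbrs S v)) \<ge> (1 - (1 / real r + \<epsilon>)) * real m" if "v \<in> S" for v
    using deg[OF that] unfolding eps by (simp add: diff_diff_eq)
  have Rr: "1 / real r = u" by (simp add: u_def R_def)

  \<comment> \<open>Choosing the first member \<open>w\<close> of an \<open>r\<close>-clique in the
    neighbourhood of \<open>v\<close> leaves an \<open>(r - 1)\<close>-clique in the joint of the
    edge \<open>v w\<close>. Choosing \<open>v\<close> as well bounds the
    \<open>(r + 1)\<close>-cliques.\<close>
  have nbC: "real (card (cliques r (nbrs S v))) \<le> real m * (J * real m ^ k)" if v: "v \<in> S" for v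
    unfolding r
  proof (rule real_card_cliques_Suc_le)
    fix w assume w: "w \<in> nbrs S v"
    have "nbrs (nbrs S v) w = nbrs S v \<inter> nbrs S w" by (auto simp: nbrs_def)
    then show "real (card (cliques k (nbrs (nbrs S v) w))) \<le> J * real m ^ k"
      using joint[of v w] w v r by (auto simp: nbrs_def)
  qed (use S J0 card_mono[of S "nbrs S v"] in \<open>auto simp: nbrs_def\<close>)
  have C: "real (card (cliques (Suc r) S)) \<le> J * M ^ Suc r"
  proof -
    have "real (card (cliques (Suc r) S)) \<le> real m * (real m * (J * real m ^ k))"
      using S J0 nbC by (intro real_card_cliques_Suc_le) auto
    then show ?thesis by (simp add: r M_def mult_ac)
  qed
  have tot: "real (card (cliques r S)) \<ge> (M * u / 2) ^ r"
  proof -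
    have "u / 2 \<le> 1 - (real r - 1) * (1 / real r + \<epsilon>)"
    proof -
      have "(real r - 1) * (1 / real r + \<epsilon>) = 1 - u + R * \<epsilon> - \<epsilon>"
      proof -
        have "(real r - 1) * (1 / real r + \<epsilon>) = (R - 1) * (u + \<epsilon>)" by (simp only: Rr R_def)
        also have "\<dots> = R * u - u + R * \<epsilon> - \<epsilon>" by (simp add: algebra_simps)
        finally show ?thesis unfolding u(3) .
      qed
      moreover have "R * \<epsilon> = u ^ 3 / 48" using u(3) by (simp add: \<epsilon>_def power4_eq_xxxx power3_eq_cube mult.assoc[symmetric])
      ultimately show ?thesis using u2 u3 \<epsilon>0 u by simp
    qed
    then have "(u / 2 * real m) ^ r \<le> real (card (cliques r S))"
      using S(1,2) deg' u \<epsilon>0 by (intro card_cliques_ge[where t = "1 / real r + \<epsilon>" and r = r]) auto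
    then show ?thesis by (simp add: M_def mult.commute)
  qed
  \<comment> \<open>\<open>(2 * R) ^ r\<close> cancels the lower bound
    \<open>(M * u / 2) ^ r\<close> on the number of \<open>r\<close>-cliques; \<open>R + 2\<close>
    exceeds the number \<open>r + 1\<close> of requirements on a typical clique, so the inequality
    below is strict.\<close>
  define \<eta> where "\<eta> = (R + 2) * (2 * R) ^ r * J"
  have \<eta>0: "\<eta> > 0" using R J0 by (simp add: \<eta>_def)
  have "\<exists>Q\<in>cliques (k + 1) S. real (card (common S Q)) \<le> \<eta> * real m \<and>
    (\<forall>i\<le>k. real (card (common_edges S (remove_nth i Q))) \<le> \<eta> * (real m)\<^sup>2)"
  proof (rule ex_typical_clique[OF S \<eta>0])
    have "real (k + 2) * real (card (cliques (k + 2) S)) \<le> (R + 1) * (J * M ^ Suc r)"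
      using C by (intro mult_mono) (auto simp: R_def r)
    also have "\<dots> < (R + 2) * (J * M ^ Suc r)" using J0 M by simp
    also have "\<dots> = \<eta> * M * (M * u / 2) ^ r"
    proof -
      have "(2 * R) ^ r * (M * u / 2) ^ r = (M * (R * u)) ^ r"
        unfolding power_mult_distrib[symmetric] by (simp add: mult.left_commute)
      then show ?thesis unfolding u(3) by (simp add: \<eta>_def mult_ac)
    qed
    also have "\<dots> \<le> \<eta> * M * real (card (cliques r S))"
      using tot \<eta>0 M by (intro mult_left_mono) auto
    finally show "real (k + 2) * real (card (cliques (k + 2) S)) < \<eta> * real m * real (card (cliques (k + 1) S))"
      by (simp add: r M_def)
  qed
  then obtain Q where Q: "Q \<in> cliques r S" "real (card (common S Q)) \<le> \<eta> * real m"
    "\<And>i. i \<le> k \<Longrightarrow> real (card (common_edges S (remove_nth i Q))) \<le> \<eta> * (real m)\<^sup>2"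
    by (auto simp: r)
  obtain f0 where f0: "\<forall>v\<in>S. f0 v < r"
    and in0: "real (card (mono_edges S f0)) \<le> (2 * real r * \<epsilon> + (real r + 2) * \<eta>) * (real m)\<^sup>2"
    using ex_colouring_few_mono_edges[OF S, of r k \<epsilon> Q \<eta>] deg' Q r by auto
  \<comment> \<open>Of the exponent \<open>2 * r + 9\<close> in \<open>J\<close>,
    \<open>(2 * R) ^ r\<close> uses up \<open>2 * r\<close> and the two factors \<open>R + 2\<close>
    use 2; three more give \<open>u ^ 3\<close>, and the last four supply the numerical
    constant.\<close>
  have eta: "(R + 2) * \<eta> \<le> u ^ 3 / 128"
  proof -
    have "(2 * R) ^ r \<le> (R * R) ^ r" using R by (intro power_mono mult_right_mono) auto
    also have "\<dots> = R ^ (2 * r)" by (simp add: power_mult power2_eq_square)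
    finally have "(2 * R) ^ r * J \<le> R ^ (2 * r) * J" using J0 by (intro mult_right_mono) auto
    also have "\<dots> = 1 / (32 * R ^ 9)" using R by (simp add: J_def R_def[symmetric] power_add)
    finally have "\<eta> \<le> (R + 2) * (1 / (32 * R ^ 9))"
      unfolding \<eta>_def mult.assoc using R by (intro mult_left_mono) auto
    then have "(R + 2) * \<eta> \<le> (R + 2) * ((R + 2) * (1 / (32 * R ^ 9)))"
      using R by (intro mult_left_mono) auto
    also have "\<dots> \<le> (2 * R) * ((2 * R) * (1 / (32 * R ^ 9)))"
      using R by (intro mult_mono) auto
    also have "\<dots> = u ^ 7 / 8"
    proof -
      have "1 / R ^ 9 = u ^ 7 * (u * u)" by (simp add: u_def power_one_over[symmetric] eval_nat_numeral)
      then have "R * R * (1 / R ^ 9) = u ^ 7 * (R * u) * (R * u)" by (simp add: mult_ac)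
      then show ?thesis unfolding u(3) by (simp add: mult_ac)
    qed
    also have "\<dots> = u ^ 3 * u ^ 4 / 8" by (simp add: power_add[symmetric])
    also have "\<dots> \<le> u ^ 3 * (1 / 16) / 8"
    proof -
      have "u ^ 4 \<le> (1 / 2) ^ 4" using u by (intro power_mono) auto
      then show ?thesis using u2p by (intro divide_right_mono mult_left_mono) (auto simp: power_divide)
    qed
    finally show ?thesis by simp
  qed
  have a: "2 * real r * \<epsilon> = u ^ 3 / 24"
    using u(3) by (simp add: \<epsilon>_def R_def[symmetric] power4_eq_xxxx power3_eq_cube mult.assoc[symmetric])
  have "2 * real r * \<epsilon> + (real r + 2) * \<eta> \<le> u ^ 3 / 24 + u ^ 3 / 128"
    unfolding a using eta by (intro add_left_mono) (simp add: R_def)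
  also have "\<dots> \<le> u ^ 3 / 20" using u2p by simp
  finally have "2 * real r * \<epsilon> + (real r + 2) * \<eta> \<le> u ^ 3 / 20" .
  then have "(2 * real r * \<epsilon> + (real r + 2) * \<eta>) * (real m)\<^sup>2 \<le> u ^ 3 / 20 * M\<^sup>2"
    unfolding M_def by (intro mult_right_mono) auto
  with in0 have in0: "real (card (mono_edges S f0)) \<le> u ^ 3 / 20 * M\<^sup>2" by linarith
  obtain f where f: "\<forall>v\<in>S. f v < r" and in1: "card (mono_edges S f) \<le> card (mono_edges S f0)"
    and opt: "\<And>v j. v \<in> S \<Longrightarrow> j < r \<Longrightarrow> card {w \<in> nbrs S v. f w = f v} \<le> card {w \<in> nbrs S v. f w = j}"
    using ex_optimal_colouring[OF S(1) f0] by blast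
  have ins: "real (card (mono_edges S f)) \<le> u ^ 3 / 20 * M\<^sup>2" using in0 in1 by linarith
  define p where "p i = real (card {v\<in>S. f v = i})" for i
  have r0: "r > 0" using r2 by simp
  note cls = card_missing_and_class_bounds[OF S(1,2) f r0 deg']
  have "real (card (missing S f)) \<le> (1 - u - (1 - (u + \<epsilon>))) * M\<^sup>2 + real (card (mono_edges S f))"
    using cls(1) by (simp add: Rr M_def)
  then have "real (card (missing S f)) \<le> \<epsilon> * M\<^sup>2 + u ^ 3 / 20 * M\<^sup>2" using ins by simp
  also have "\<dots> = (\<epsilon> + u ^ 3 / 20) * M\<^sup>2" by (simp add: algebra_simps)
  also have "\<dots> \<le> (u\<^sup>2 / 32) * M\<^sup>2"
  proof (rule mult_right_mono)
    show "\<epsilon> + u ^ 3 / 20 \<le> u\<^sup>2 / 32" unfolding \<epsilon>_def using u3 u4 u2p by linarith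
  qed simp
  finally have miss: "2 * real (card (missing S f)) \<le> (u / 4 * M)\<^sup>2"
    by (simp add: power_mult_distrib power_divide)
  \<comment> \<open>A quarter of the average class size: large enough to outweigh the missing pairs,
    small enough to survive in every other class within a joint.\<close>
  define h where "h = nat \<lceil>u / 4 * M\<rceil>"
  have h: "u / 4 * M \<le> real h" by (simp add: h_def of_nat_ceiling)
  have h_le: "h \<le> c" if "u / 4 * M \<le> real c" for c
    using that unfolding h_def by (simp add: nat_le_iff ceiling_le_iff)
  have "(u / 4 * M)\<^sup>2 \<le> (real h)\<^sup>2" using h u M by (intro power_mono) auto
  with miss have "real (2 * card (missing S f)) \<le> real (h\<^sup>2)" by simp
  then have few: "2 * card (missing S f) \<le> h\<^sup>2" by (simp only: of_nat_le_iff)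
  have big: "2 * J * M ^ t < real h ^ t" if t: "t \<le> r" for t
  proof -
    have "4 ^ r \<le> R ^ (r + 9)"
    proof (cases "r \<ge> 4")
      case True
      then have "4 ^ r \<le> R ^ r" by (intro power_mono) (auto simp: R_def)
      also have "\<dots> \<le> R ^ (r + 9)" using R by (intro power_increasing) auto
      finally show ?thesis .
    next
      case False
      with r2 have "r = 2 \<or> r = 3" by auto
      then show ?thesis by (auto simp: R_def)
    qed
    then have "(4 * R) ^ r \<le> R ^ (r + 9) * R ^ r"
      unfolding power_mult_distrib using R by (intro mult_right_mono) auto
    also have "\<dots> = R ^ (2 * r + 9)" 
      unfolding power_add[symmetric] by (rule arg_cong[of _ _ "power R"]) simp
    also have "\<dots> < 16 * R ^ (2 * r + 9)" using R by simp
    finally have "1 / (16 * R ^ (2 * r + 9)) < 1 / (4 * R) ^ r"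
      using R by (intro divide_strict_left_mono mult_pos_pos) auto
    moreover have "2 * J = 1 / (16 * R ^ (2 * r + 9))" by (simp add: J_def R_def)
    moreover have "(u / 4) ^ r = 1 / (4 * R) ^ r" 
    proof -
      have "u / 4 = 1 / (4 * R)" by (simp add: u_def)
      then show ?thesis by (simp only: power_one_over)
    qed
    ultimately have "2 * J < (u / 4) ^ r" by simp
    also have "\<dots> \<le> (u / 4) ^ t" using u t by (intro power_decreasing) auto
    finally have "2 * J * M ^ t < (u / 4) ^ t * M ^ t" using M by (intro mult_strict_right_mono) auto
    also have "\<dots> = (u / 4 * M) ^ t" by (rule power_mult_distrib[symmetric])
    also have "\<dots> \<le> real h ^ t" using h u M by (intro power_mono) auto
    finally show ?thesis .
  qed
  \<comment> \<open>Applied to a neighbourhood with all \<open>r\<close> classes, and to the joint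
    of a monochromatic edge with the \<open>r - 1\<close> other classes.\<close>
  have many: "J * M ^ card T < real (card (cliques (card T) X))"
    if T: "T \<subseteq> {..<r}" and X: "X \<subseteq> S"
      and Z: "\<And>j. j \<in> T \<Longrightarrow> u / 4 * M \<le> real (card {w\<in>X. f w = j})" for T X
  proof -
    have finT: "finite T" using T finite_subset by blast
    have finX: "finite X" using X S(1) finite_subset by blast
    have "\<exists>N. N \<subseteq> {w\<in>X. f w = j} \<and> card N = h" if "j \<in> T" for j
      using obtain_subset_with_card_n[OF h_le[OF Z[OF that]]] by blast
    then obtain N where N: "\<And>j. j \<in> T \<Longrightarrow> N j \<subseteq> {w\<in>X. f w = j} \<and> card (N j) = h" by metis
    have "h ^ card T \<le> 2 * card (cliques (card T) (\<Union>l\<in>T. N l))"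
      using N X by (intro transversal_cliques[OF S(1) finT _ _ _ few]) blast+
    also have "\<dots> \<le> 2 * card (cliques (card T) X)"
    proof -
      have "(\<Union>l\<in>T. N l) \<subseteq> X" using N by blast
      then show ?thesis using finX by (intro mult_left_mono card_mono cliques_mono) auto
    qed
    finally have "real h ^ card T \<le> 2 * real (card (cliques (card T) X))"
      by (metis of_nat_le_iff of_nat_mult of_nat_numeral of_nat_power)
    moreover have "card T \<le> r" using card_mono[OF _ T] by simp
    ultimately show ?thesis using big[of "card T"] by linarith
  qed
  have own: "real (card {w \<in> nbrs S v. f w = f v}) < u / 4 * M" if v: "v \<in> S" for v
  proof (rule ccontr)
    assume "\<not> ?thesis"
    then have "u / 4 * M \<le> real (card {w \<in> nbrs S v. f w = j})" if "j \<in> {..<r}" for j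
      using opt[OF v, of j] that by (simp add: not_less)
    then have "J * M ^ card {..<r} < real (card (cliques (card {..<r}) (nbrs S v)))"
      by (intro many) (auto simp: nbrs_def)
    then show False using nbC[OF v] by (simp add: r M_def mult_ac)
  qed
  \<comment> \<open>By the degree condition each vertex of class \<open>i\<close> has at least
    \<open>p i - (u + \<epsilon>) * M\<close> neighbours inside the class, so an oversized class
    would contain too many monochromatic edges.\<close>
  have p_le: "p i \<le> (u + \<epsilon> + u\<^sup>2 / 20) * M" for i
  proof (rule ccontr)
    assume "\<not> ?thesis"
    then have gt: "p i > (u + \<epsilon>) * M + u\<^sup>2 / 20 * M" by (simp add: algebra_simps)
    have pu: "p i > u * M"
    proof -
      have "(u + \<epsilon>) * M = u * M + \<epsilon> * M" by (simp add: algebra_simps)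
      moreover have "\<epsilon> * M > 0" "u\<^sup>2 / 20 * M > 0" using \<epsilon>0 M u2p by simp_all
      ultimately show ?thesis using gt by linarith
    qed
    have p0: "p i > 0" using pu mult_pos_pos[OF u(1) M] by linarith
    have "p i * ((1 - (u + \<epsilon>)) * M) \<le> p i * (M - p i) + real (card (mono_edges S f))"
      using cls(2)[of i] by (simp add: p_def M_def Rr)
    then have ub: "p i * (p i - (u + \<epsilon>) * M) \<le> u ^ 3 / 20 * M\<^sup>2" using ins by (simp add: algebra_simps)
    have "(u * M) * (u\<^sup>2 / 20 * M) < p i * (p i - (u + \<epsilon>) * M)"
      using gt pu u M p0 by (intro mult_strict_mono) auto
    from less_le_trans[OF this ub] show False by (simp add: power3_eq_cube power2_eq_square)
  qed
  have fr: "f ` S \<subseteq> {..<r}" using f by auto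
  have "(\<Sum>i<r. card {v\<in>S. f v = i}) = card S"
    using sum.group[OF S(1) _ fr, of "\<lambda>_. 1 :: nat"] by simp
  then have ptot: "(\<Sum>i<r. p i) = M" using S(2) unfolding p_def M_def by (metis of_nat_sum)
  \<comment> \<open>The other \<open>r - 1\<close> classes exceed \<open>u * M\<close> by less than
    \<open>6 / 100 * u * M\<close> altogether.\<close>
  have p_ge: "94 / 100 * u * M \<le> p i" if i: "i < r" for i
  proof -
    have "M = p i + (\<Sum>j\<in>{..<r} - {i}. p j)" using sum.remove[of "{..<r}" i p] i ptot by simp
    also have "\<dots> \<le> p i + (\<Sum>j\<in>{..<r} - {i}. (u + \<epsilon> + u\<^sup>2 / 20) * M)"
      using p_le by (intro add_left_mono sum_mono) auto
    also have "\<dots> = p i + (R - 1) * (u + \<epsilon> + u\<^sup>2 / 20) * M"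
      using i r2 by (simp add: R_def of_nat_diff)
    also have "(R - 1) * (u + \<epsilon> + u\<^sup>2 / 20) \<le> 1 - 94 / 100 * u"
    proof -
      have e: "R * \<epsilon> = u ^ 3 / 48" "R * u\<^sup>2 = u"
        using u(3) by (simp_all add: \<epsilon>_def power4_eq_xxxx power3_eq_cube power2_eq_square mult.assoc[symmetric])
      have "(R - 1) * (u + \<epsilon> + u\<^sup>2 / 20) = R * u - u + R * \<epsilon> - \<epsilon> + R * u\<^sup>2 / 20 - u\<^sup>2 / 20"
        by (simp add: left_diff_distrib distrib_left)
      also have "\<dots> = 1 - u + u ^ 3 / 48 - \<epsilon> + u / 20 - u\<^sup>2 / 20" unfolding e u(3) by simp
      also have "\<dots> \<le> 1 - 94 / 100 * u" using u2 u3 \<epsilon>0 u u2p by linarith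
      finally show ?thesis .
    qed
    finally show ?thesis using M by (simp add: algebra_simps mult_right_mono)
  qed
  have "f v \<noteq> f w" if vw: "v \<in> S" "w \<in> S" "E v w" for v w
  proof
    assume eq: "f v = f w"
    \<comment> \<open>A vertex spends almost its whole allowance of non-neighbours on its own class,
      so few are left in any other class.\<close>
    have near: "real (card {z\<in>S. f z = j \<and> \<not> E x z}) \<le> (u / 4 + u + \<epsilon>) * M - p (f x)"
      if x: "x \<in> S" and j: "j \<noteq> f x" for x j
    proof -
      let ?Z = "{z\<in>S. f z = j \<and> \<not> E x z}" and ?A = "{z\<in>S. f z = f x}"
      have "nbrs S x \<subseteq> {z\<in>nbrs S x. f z = f x} \<union> (S - (?A \<union> ?Z))" by (auto simp: nbrs_def)
      then have "card (nbrs S x) \<le> card ({z\<in>nbrs S x. f z = f x} \<union> (S - (?A \<union> ?Z)))"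
        using S(1) by (intro card_mono) auto
      also have "\<dots> \<le> card {z\<in>nbrs S x. f z = f x} + card (S - (?A \<union> ?Z))" by (rule card_Un_le)
      finally have 1: "real (card (nbrs S x)) \<le> real (card {z\<in>nbrs S x. f z = f x}) + real (card (S - (?A \<union> ?Z)))"
        by linarith
      have "card (?A \<union> ?Z) = card ?A + card ?Z" using S(1) j by (intro card_Un_disjoint) auto
      moreover have "card (S - (?A \<union> ?Z)) = card S - card (?A \<union> ?Z)" "card (?A \<union> ?Z) \<le> card S"
        using S(1) by (auto intro!: card_Diff_subset card_mono)
      ultimately have "real (card (S - (?A \<union> ?Z))) = M - p (f x) - real (card ?Z)"
        using S(2) by (simp add: M_def p_def of_nat_diff)
      moreover have "(1 - (u + \<epsilon>)) * M \<le> real (card (nbrs S x))" using deg'[OF x] by (simp add: Rr M_def)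
      moreover have "(1 - (u + \<epsilon>)) * M = M - (u + \<epsilon>) * M" "(u / 4 + u + \<epsilon>) * M = u / 4 * M + (u + \<epsilon>) * M"
        by (simp_all add: algebra_simps)
      ultimately show ?thesis using 1 own[OF x] by linarith
    qed
    let ?X = "nbrs S v \<inter> nbrs S w" and ?T = "{..<r} - {f v}"
    have "u / 4 * M \<le> real (card {z\<in>?X. f z = j})" if j: "j \<in> ?T" for j
    proof -
      let ?Zv = "{z\<in>S. f z = j \<and> \<not> E v z}" and ?Zw = "{z\<in>S. f z = j \<and> \<not> E w z}"
      have "{z\<in>S. f z = j} \<subseteq> {z\<in>?X. f z = j} \<union> (?Zv \<union> ?Zw)" by (auto simp: nbrs_def)
      then have "card {z\<in>S. f z = j} \<le> card ({z\<in>?X. f z = j} \<union> (?Zv \<union> ?Zw))"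
        using S(1) by (intro card_mono) auto
      also have "\<dots> \<le> card {z\<in>?X. f z = j} + card (?Zv \<union> ?Zw)" by (rule card_Un_le)
      also have "\<dots> \<le> card {z\<in>?X. f z = j} + (card ?Zv + card ?Zw)" by (intro add_left_mono card_Un_le)
      finally have "p j \<le> real (card {z\<in>?X. f z = j}) + (real (card ?Zv) + real (card ?Zw))"
        unfolding p_def by linarith
      moreover have "real (card ?Zv) \<le> (u / 4 + u + \<epsilon>) * M - p (f v)"
        "real (card ?Zw) \<le> (u / 4 + u + \<epsilon>) * M - p (f v)"
        using near[of v j] near[of w j] vw j eq by auto
      moreover have "94 / 100 * u * M \<le> p j" "94 / 100 * u * M \<le> p (f v)"
        using p_ge f vw j by auto
      \<comment> \<open>In multiples of \<open>u * M\<close>, what remains is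
        \<open>0.94 - 2 * (1.26 - 0.94) = 0.30\<close>, more than the required
        \<open>1 / 4\<close>.\<close>
      moreover have "(u / 4 + u + \<epsilon>) * M \<le> (63 / 50) * u * M"
      proof (rule mult_right_mono)
        show "u / 4 + u + \<epsilon> \<le> (63 / 50) * u" unfolding \<epsilon>_def using u2 u3 u4 u by linarith
      qed (use M in simp)
      moreover have "(63 / 50) * u * M = (63 / 50) * (u * M)" "u / 4 * M = (u * M) / 4"
        "94 / 100 * u * M = 94 / 100 * (u * M)" by simp_all
      moreover have "u * M > 0" using u M by simp
      ultimately show ?thesis by linarith
    qed
    then have "J * M ^ card ?T < real (card (cliques (card ?T) ?X))"
      by (intro many) (auto simp: nbrs_def)
    moreover have "card ?T = r - 1" using f vw by simp
    ultimately show False using joint[OF vw] by (simp add: M_def)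
  qed
  with f show ?thesis unfolding proper_colouring_def by blast
qed

end

section \<open>Embedding the target graph\<close>

text \<open>
  The exponent in \<open>D\<close> is such that the upper bound on \<open>c\<close> gives \<open>3 c D ^ (r - 2) ln (3 D) \<le> 1\<close>, which
  is what the blow-up lemma needs for parts of size \<open>c ln n\<close>.
\<close>

lemma blowup_constants:
  fixes r :: nat and c :: real
  defines "R \<equiv> real r" and "D \<equiv> 256 * r ^ (2 * r + 11)"
  assumes r: "r \<ge> 2" and c: "0 < c" "c \<le> 1 / (2 * real r ^ ((2 * r + 9) * (r + 1)))"
  shows "ln (3 * real D) * sqrt c \<le> 1" and "3 * c * real D ^ (r - 2) * ln (3 * real D) \<le> 1"
proof -
  have R: "R \<ge> 2" using r by (simp add: R_def)
  have c': "c * R ^ ((2 * r + 9) * (r + 1)) \<le> 1 / 2"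
    using c(2) R by (simp add: R_def field_simps)
  have D: "real D = 256 * R ^ (2 * r + 11)" by (simp add: D_def R_def)
  have "ln (3 * real D) = ln 768 + real (2 * r + 11) * ln R"
    unfolding D using R by (simp add: ln_mult ln_realpow)
  also have "\<dots> \<le> 10 + real (2 * r + 11) * (R - 1)"
  proof (intro add_mono mult_left_mono)
    have "ln (768 :: real) \<le> ln (2 ^ 10)" by (subst ln_le_cancel_iff) auto
    also have "\<dots> = 10 * ln 2" by (subst ln_realpow) auto
    also have "\<dots> \<le> 10" using ln_le_minus_one[of 2] by simp
    finally show "ln (768 :: real) \<le> 10" .
    show "ln R \<le> R - 1" using R by (intro ln_le_minus_one) auto
  qed simp
  also have "\<dots> = 2 * R\<^sup>2 + 9 * R - 1" by (simp add: R_def algebra_simps power2_eq_square)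
  also have "\<dots> \<le> 8 * R\<^sup>2"
  proof -
    have "2 * R \<le> R\<^sup>2" unfolding power2_eq_square using R by (intro mult_right_mono) auto
    then show ?thesis using R by linarith
  qed
  also have "\<dots> \<le> R ^ 3 * R\<^sup>2"
  proof (rule mult_right_mono)
    have "2 ^ 3 \<le> R ^ 3" using R by (intro power_mono) auto
    then show "8 \<le> R ^ 3" by simp
  qed simp
  also have "\<dots> = R ^ 5" by (simp add: power_add[symmetric])
  finally have ln: "ln (3 * real D) \<le> R ^ 5" .
  have "real D \<ge> 256 * 1" unfolding D using R by (intro mult_left_mono one_le_power) auto
  then have ln0: "ln (3 * real D) \<ge> 0" by (intro ln_ge_zero) auto
  have "R ^ 5 * sqrt c = sqrt (R ^ 10 * c)"
  proof -
    have "R ^ 10 = (R ^ 5)\<^sup>2" by (simp only: power_mult[symmetric]) simp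
    moreover have "sqrt ((R ^ 5)\<^sup>2) = R ^ 5" using R by (intro real_sqrt_unique) auto
    ultimately show ?thesis by (simp only: real_sqrt_mult)
  qed
  also have "\<dots> \<le> sqrt 1"
  proof (rule real_sqrt_le_mono)
    have "10 \<le> (2 * r + 9) * (r + 1)" using r by simp
    then have "R ^ 10 \<le> R ^ ((2 * r + 9) * (r + 1))" using R by (intro power_increasing) auto
    then have "R ^ 10 * c \<le> R ^ ((2 * r + 9) * (r + 1)) * c" using c by (intro mult_right_mono) auto
    then show "R ^ 10 * c \<le> 1" using c' by (simp add: mult.commute)
  qed
  finally have "R ^ 5 * sqrt c \<le> 1" by simp
  moreover have "ln (3 * real D) * sqrt c \<le> R ^ 5 * sqrt c" using ln c by (intro mult_right_mono) auto
  ultimately show "ln (3 * real D) * sqrt c \<le> 1" by linarith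
  obtain q where q: "r = q + 2" using r by (metis add.commute le_iff_add)
  have "256 ^ q \<le> R ^ (4 * r)"
  proof (cases "r \<ge> 4")
    case True
    then have "(4::real) ^ 4 \<le> R ^ 4" by (intro power_mono) (auto simp: R_def)
    then have "(256 :: real) ^ q \<le> (R ^ 4) ^ q" by (intro power_mono) auto
    also have "\<dots> \<le> R ^ (4 * r)" using R q unfolding power_mult[symmetric] by (intro power_increasing) auto
    finally show ?thesis .
  next
    case False
    with r have "r = 2 \<or> r = 3" by auto
    then show ?thesis using q by (auto simp: R_def)
  qed
  then have "real D ^ q \<le> R ^ (4 * r) * R ^ ((2 * r + 11) * q)"
    unfolding D power_mult_distrib power_mult[symmetric] using R by (intro mult_right_mono) auto
  then have "c * real D ^ q * R ^ 5 \<le> c * (R ^ (4 * r) * R ^ ((2 * r + 11) * q)) * R ^ 5"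
    using c R by (intro mult_right_mono mult_left_mono) auto
  \<comment> \<open>The exponent \<open>(2 * r + 9) * (r + 1)\<close> leaves a surplus of 26 powers
    of \<open>R\<close>, which absorbs the factor 3.\<close>
  then have "(c * real D ^ q * R ^ 5) * R ^ 26 \<le> (c * (R ^ (4 * r) * R ^ ((2 * r + 11) * q)) * R ^ 5) * R ^ 26"
    by (rule mult_right_mono) (use R in auto)
  also have "\<dots> = c * R ^ ((2 * r + 9) * (r + 1))"
  proof -
    have "4 * r + (2 * r + 11) * q + 5 + 26 = (2 * r + 9) * (r + 1)" by (simp add: q algebra_simps)
    then show ?thesis by (simp only: power_add[symmetric] mult.assoc)
  qed
  also have "\<dots> \<le> 1 / 2" by (rule c')
  finally have "(c * real D ^ q * R ^ 5) * R ^ 26 \<le> 1 / 2" .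
  moreover have "(c * real D ^ q * R ^ 5) * 2 ^ 26 \<le> (c * real D ^ q * R ^ 5) * R ^ 26"
    using c R by (intro mult_left_mono power_mono) auto
  ultimately have "3 * (c * real D ^ q * R ^ 5) \<le> 1" by simp
  moreover have "c * real D ^ q * ln (3 * real D) \<le> c * real D ^ q * R ^ 5"
    using c ln by (intro mult_left_mono) auto
  ultimately show "3 * c * real D ^ (r - 2) * ln (3 * real D) \<le> 1" using q by simp
qed

context adjacency
begin

text \<open>Everything is bounded by powers of \<open>B = 3 * D\<close>. The first bound on the
  constants gives \<open>B ^ (2 * s) \<le> n powr (2 * sqrt c)\<close>, the loss in passing from
  \<open>n\<close> to \<open>t\<close>. The second gives \<open>B ^ (3 * m) \<le> n\<close> for
  \<open>m = s * D ^ (r - 2)\<close>, the largest size in the binomial conditions of the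
  blow-up.\<close>

lemma clique_blowup_log:
  fixes r n :: nat and c :: real
  defines "D \<equiv> 256 * r ^ (2 * r + 11)"
    and "s \<equiv> nat \<lfloor>c * ln (real n)\<rfloor>" and "t \<equiv> nat \<lceil>real n powr (1 - 2 * sqrt c)\<rceil>"
  assumes r: "r \<ge> 2" and n: "n \<ge> 2" and c: "2 / ln (real n) \<le> c" "c \<le> 1 / (2 * real r ^ ((2 * r + 9) * (r + 1)))"
    and V: "finite V" "card V = n" and M: "M \<subseteq> cliques r V" "2 * r * n ^ r \<le> D * card M"
  shows "s \<ge> 2" and "\<exists>a W. (\<forall>i<s. length (a i) = r - 1) \<and> W \<subseteq> V \<and> t \<le> card W \<and>
      (\<forall>i<s. \<forall>w\<in>W. w # a i \<in> M) \<and>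
      (\<forall>i<s. \<forall>i'<s. \<forall>j<r - 1. \<forall>j'<r - 1. j \<noteq> j' \<longrightarrow> E (a i ! j) (a i' ! j')) \<and>
      (\<forall>j<r - 1. inj_on (\<lambda>i. a i ! j) {..<s})"
proof -
  define L where "L = ln (real n)"
  have L: "L > 0" using n by (simp add: L_def)
  have cL: "c * L \<ge> 2" using c(1) L by (simp add: L_def field_simps)
  then have c0: "c > 0" using L by (metis less_le_trans zero_less_mult_pos2 zero_less_numeral)
  have s_le: "real s \<le> c * L"
    unfolding s_def L_def[symmetric] using cL by (intro of_nat_floor) auto
  show s2: "s \<ge> 2" unfolding s_def L_def[symmetric] using cL by (simp add: le_nat_iff le_floor_iff)
  have D0: "D > 0" using r by (simp add: D_def)
  define B where "B = 3 * real D"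
  have B: "B \<ge> 3" using D0 by (simp add: B_def)
  note const = blowup_constants[OF r c0 c(2), folded D_def, folded B_def]
  have lnB: "ln B \<ge> 0" using B by (intro ln_ge_zero) auto
  obtain q where q: "r = q + 2" using r by (metis add.commute le_iff_add)
  define m where "m = s * D ^ q"
  have m1: "m \<ge> 1" using s2 D0 by (simp add: m_def Suc_leI)
  have exp_pow: "B ^ k = exp (real k * ln B)" for k
    using B by (simp add: exp_of_nat_mult)
  have Bm: "B ^ (3 * m) \<le> real n"
  proof -
    have "real (3 * m) * ln B = 3 * real s * real D ^ q * ln B" by (simp add: m_def)
    also have "\<dots> \<le> 3 * (c * L) * real D ^ q * ln B"
      using s_le lnB by (intro mult_right_mono mult_left_mono) auto
    also have "\<dots> = (3 * c * real D ^ q * ln B) * L" by simp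
    also have "\<dots> \<le> 1 * L" using const(2) L q by (intro mult_right_mono) auto
    finally have "B ^ (3 * m) \<le> exp L" unfolding exp_pow by simp
    then show ?thesis using n by (simp add: L_def)
  qed
  have lin: "real k \<le> B ^ k" for k
  proof -
    have "real k \<le> 2 ^ k" using of_nat_less_two_power[of k] by (simp add: less_imp_le)
    also have "\<dots> \<le> B ^ k" using B by (intro power_mono) auto
    finally show ?thesis .
  qed
  have DB: "real D \<le> B" by (simp add: B_def)
  have c1: "D * k * (D * k choose k) \<le> n" if k: "1 \<le> k" "k \<le> m" for k
  proof -
    have "real (D * k * (D * k choose k)) = real D * real k * real (D * k choose k)" by simp
    also have "\<dots> \<le> B * B ^ k * B ^ k"
      using DB lin[of k] binomial_mult_le[of D k] B unfolding B_def by (intro mult_mono) auto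
    also have "\<dots> = B ^ (1 + k + k)" by (simp add: power_add)
    also have "\<dots> \<le> B ^ (3 * m)" using B k by (intro power_increasing) auto
    finally show ?thesis using Bm by linarith
  qed
  have c2: "D ^ r * s \<le> n"
  proof -
    have "real (D ^ r * s) = real D * real D * real m" by (simp add: q m_def power_add power2_eq_square)
    also have "\<dots> \<le> B * B * B ^ m" using DB lin[of m] B by (intro mult_mono) auto
    also have "\<dots> = B ^ (2 + m)" by (simp add: power_add power2_eq_square)
    also have "\<dots> \<le> B ^ (3 * m)" using B m1 by (intro power_increasing) auto
    finally show ?thesis using Bm by linarith
  qed
  have k: "r = Suc (r - 1)" "r - 1 \<noteq> 0" using r by auto
  have ex: "\<exists>a W. (\<forall>i<s. length (a i) = r - 1) \<and> W \<subseteq> V \<and>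
      n \<le> D * (if r - 1 = 0 then 1 else D * s choose s) * card W \<and>
      (\<forall>i<s. \<forall>w\<in>W. w # a i \<in> M) \<and>
      (\<forall>i<s. \<forall>i'<s. \<forall>j<r - 1. \<forall>j'<r - 1. j \<noteq> j' \<longrightarrow> E (a i ! j) (a i' ! j')) \<and>
      (\<forall>j<r - 1. inj_on (\<lambda>i. a i ! j) {..<s})"
  proof (rule clique_blowup[OF V])
    show "M \<subseteq> cliques (Suc (r - 1)) V" "2 * Suc (r - 1) * n ^ Suc (r - 1) \<le> D * card M"
      "D ^ Suc (r - 1) * s \<le> n" using M c2 k by auto
    fix j assume "1 \<le> j" "j < r - 1"
    then have "D ^ j \<le> D ^ q" using D0 q by (intro power_increasing) auto
    then show "D * (s * D ^ j) * (D * (s * D ^ j) choose (s * D ^ j)) \<le> n"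
      using s2 D0 by (intro c1) (auto simp: m_def Suc_leI)
  qed (use D0 s2 in auto)
  have tW: "t \<le> card W" if "n \<le> D * (D * s choose s) * card W" for W :: "'a set"
  proof -
    have "real n \<le> real (D * (D * s choose s) * card W)" using that by (simp only: of_nat_le_iff)
    also have "\<dots> = (real D * real (D * s choose s)) * real (card W)" by simp
    also have "\<dots> \<le> (B ^ s * B ^ s) * real (card W)"
    proof (intro mult_right_mono mult_mono)
      have "B ^ 1 \<le> B ^ s" using B s2 by (intro power_increasing) auto
      then show "real D \<le> B ^ s" using DB by simp
      show "real (D * s choose s) \<le> B ^ s" unfolding B_def by (rule binomial_mult_le)
    qed (use B in auto)
    also have "B ^ s * B ^ s = exp (2 * (real s * ln B))" unfolding exp_pow exp_add[symmetric] by simp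
    also have "\<dots> \<le> exp (2 * sqrt c * L)"
    proof -
      have "real s * ln B \<le> c * L * ln B" using s_le lnB by (intro mult_right_mono)
      also have "\<dots> = (ln B * sqrt c) * (sqrt c * L)" using c0 by simp
      also have "\<dots> \<le> 1 * (sqrt c * L)" using const(1) c0 L by (intro mult_right_mono) auto
      finally show ?thesis by simp
    qed
    finally have "real n \<le> exp (2 * sqrt c * L) * real (card W)" by (simp add: mult_right_mono)
    moreover have "real n powr (1 - 2 * sqrt c) = real n / exp (2 * sqrt c * L)"
      using n by (simp add: powr_def L_def left_diff_distrib exp_diff)
    ultimately have "real n powr (1 - 2 * sqrt c) \<le> real (card W)"
      by (simp only: pos_divide_le_eq[OF exp_gt_zero] mult.commute)
    then show ?thesis unfolding t_def by (simp add: nat_le_iff ceiling_le_iff)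
  qed
  obtain a W where aW: "\<forall>i<s. length (a i) = r - 1" "W \<subseteq> V" "n \<le> D * (D * s choose s) * card W"
      "\<forall>i<s. \<forall>w\<in>W. w # a i \<in> M"
      "\<forall>i<s. \<forall>i'<s. \<forall>j<r - 1. \<forall>j'<r - 1. j \<noteq> j' \<longrightarrow> E (a i ! j) (a i' ! j')"
      "\<forall>j<r - 1. inj_on (\<lambda>i. a i ! j) {..<s}"
    using ex unfolding if_not_P[OF k(2)] by (elim exE conjE)
  show "\<exists>a W. (\<forall>i<s. length (a i) = r - 1) \<and> W \<subseteq> V \<and> t \<le> card W \<and>
      (\<forall>i<s. \<forall>w\<in>W. w # a i \<in> M) \<and>
      (\<forall>i<s. \<forall>i'<s. \<forall>j<r - 1. \<forall>j'<r - 1. j \<noteq> j' \<longrightarrow> E (a i ! j) (a i' ! j')) \<and>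
      (\<forall>j<r - 1. inj_on (\<lambda>i. a i ! j) {..<s})"
    by (intro exI[of _ a] exI[of _ W] conjI aW(1,2,4,5,6) tW[OF aW(3)])
qed

text \<open>\<open>e i j\<close> is the image of the vertex \<open>(i, j)\<close>. Images of
  different parts are disjoint because their vertices are adjacent and \<open>E\<close> has no
  loops; the last conjunct is the additional edge.\<close>

definition embeds_K_plus :: "'a set \<Rightarrow> nat list \<Rightarrow> bool" where
  "embeds_K_plus V p \<longleftrightarrow> (\<exists>e. (\<forall>i<length p. inj_on (e i) {..<p ! i} \<and> e i ` {..<p ! i} \<subseteq> V) \<and>
     (\<forall>i<length p. \<forall>i'<length p. i \<noteq> i' \<longrightarrow> (\<forall>j<p ! i. \<forall>j'<p ! i'. E (e i j) (e i' j'))) \<and>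
     E (e 0 0) (e 0 (1::nat)))"

text \<open>
  The first part consists of \<open>u\<close>, \<open>v\<close> and vertices of coordinate \<open>r - 2\<close> of the tuples \<open>a i\<close>, so
  \<open>u\<close> and \<open>v\<close> need not be adjacent to this coordinate.
\<close>

lemma embeds_K_plusI:
  assumes r: "r \<ge> 2" and s: "s \<ge> 2"
    and a: "\<And>i. i < s \<Longrightarrow> length (a i) = r - 1" and W: "W \<subseteq> V" "t \<le> card W" "finite V"
    and aW: "\<And>i w. i < s \<Longrightarrow> w \<in> W \<Longrightarrow> w # a i \<in> cliques r V"
    and cross: "\<And>i i' j j'. i < s \<Longrightarrow> i' < s \<Longrightarrow> j < r - 1 \<Longrightarrow> j' < r - 1 \<Longrightarrow> j \<noteq> j' \<Longrightarrow>
      E (a i ! j) (a i' ! j')"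
    and inj: "\<And>j. j < r - 1 \<Longrightarrow> inj_on (\<lambda>i. a i ! j) {..<s}" and t: "t > 0"
    and uv: "u \<in> V" "v \<in> V" "E u v"
    and uvW: "\<And>w. w \<in> W \<Longrightarrow> E u w \<and> E v w"
    and uva: "\<And>i j. i < s \<Longrightarrow> j < r - 2 \<Longrightarrow> E u (a i ! j) \<and> E v (a i ! j)"
  shows "embeds_K_plus V (replicate (r - 1) s @ [t])"
proof -
  have finW: "finite W" using W finite_subset by blast
  obtain w where w: "inj_on w {..<t}" "w ` {..<t} \<subseteq> W"
    using card_le_inj[of "{..<t}" W] finW W(2) by auto
  have "W \<noteq> {}" using W(2) t by auto
  then obtain w0 where w0: "w0 \<in> W" by blast
  have aV: "a i ! j \<in> V" if "i < s" "j < r - 1" for i j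
    using aW[OF that(1) w0] a[OF that(1)] that by (auto simp: cliques_def)
  have aw: "E w (a i ! j)" if "w \<in> W" "i < s" "j < r - 1" for w i j
  proof -
    have "a i ! j \<in> set (a i)" using a[OF that(2)] that by simp
    then show ?thesis using aW[OF that(2,1)] by (auto simp: cliques_def pairwise_insert)
  qed
  define U where "U = (\<lambda>i. a i ! (r - 2)) ` {..<s}"
  have cU: "card U = s" unfolding U_def using inj[of "r - 2"] r by (simp add: card_image)
  \<comment> \<open>The vertices \<open>u\<close> and \<open>v\<close> may belong to
    \<open>U\<close>; without them there are still enough vertices to complete the first
    part.\<close>
  have "s - 2 \<le> card (U - {u, v})"
    using diff_card_le_card_Diff[of "{u, v}" U] cU card_insert_le_m1[of 2 "{v}" u]
    by (auto simp: card_insert_if split: if_splits)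
  then obtain g where g: "inj_on g {..<s - 2}" "g ` {..<s - 2} \<subseteq> U - {u, v}"
    using card_le_inj[of "{..<s - 2}" "U - {u, v}"] by (auto simp: U_def)
  define e0 where "e0 j = (if j = 0 then u else if j = 1 then v else g (j - 2))" for j :: nat
  have uneqv: "u \<noteq> v" using uv E_irrefl by blast
  have gU: "g (l - 2) \<in> U - {u, v}" if "l < s" "l \<noteq> 0" "l \<noteq> 1" for l
  proof -
    have "l - 2 \<in> {..<s - 2}" using that by auto
    then show ?thesis using g(2) by blast
  qed
  have e0_in: "e0 j \<in> {u, v} \<union> U" if "j < s" for j
    using gU[OF that] by (auto simp: e0_def)
  have e0_inj: "inj_on e0 {..<s}"
  proof (rule inj_onI)
    fix i j assume ij: "i \<in> {..<s}" "j \<in> {..<s}" "e0 i = e0 j"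
    have gn: "g (l - 2) \<noteq> u \<and> g (l - 2) \<noteq> v" if "l < s" "l \<noteq> 0" "l \<noteq> 1" for l
      using gU[OF that] by blast
    consider "i = 0" | "i = 1" | "i \<noteq> 0" "i \<noteq> 1" by blast
    then show "i = j"
    proof cases
      case 1
      then show ?thesis using ij uneqv gn[of j] by (auto simp: e0_def split: if_splits)
    next
      case 2
      then show ?thesis using ij uneqv gn[of j] by (auto simp: e0_def split: if_splits)
    next
      case 3
      then have "j \<noteq> 0" "j \<noteq> 1" using ij gn[of i] by (auto simp: e0_def split: if_splits)
      with 3 ij have "g (i - 2) = g (j - 2)" "i - 2 \<in> {..<s - 2}" "j - 2 \<in> {..<s - 2}"
        by (auto simp: e0_def)
      then have "i - 2 = j - 2" using g(1) by (auto dest: inj_onD)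
      with 3 \<open>j \<noteq> 0\<close> \<open>j \<noteq> 1\<close> show ?thesis by auto
    qed
  qed
  \<comment> \<open>As the first part draws on the last coordinate \<open>r - 2\<close>, a middle
    part \<open>i\<close> takes coordinate \<open>i - 1\<close>; the last part lies in
    \<open>W\<close>.\<close>
  define e where "e i j = (if i = 0 then e0 j else if i < r - 1 then a j ! (i - 1) else w j)" for i j
  let ?p = "replicate (r - 1) s @ [t]"
  have len: "length ?p = r" using r by simp
  have p: "?p ! i = (if i < r - 1 then s else t)" if "i < r" for i
    using that by (auto simp: nth_append)
  have "inj_on (e i) {..<?p ! i}" if ir: "i < r" for i
  proof -
    consider "i = 0" | "0 < i" "i < r - 1" | "i = r - 1" "i \<noteq> 0" using ir by linarith
    then show ?thesis
    proof cases
      case 1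
      then show ?thesis using e0_inj p[OF that] r by (simp add: e_def[abs_def])
    next
      case 2
      then show ?thesis using inj[of "i - 1"] p[OF that] by (simp add: e_def[abs_def])
    next
      case 3
      then show ?thesis using w(1) p[OF that] by (simp add: e_def[abs_def])
    qed
  qed
  moreover have "e i j \<in> V" if "i < r" "j < ?p ! i" for i j
  proof -
    have "U \<subseteq> V" using aV r by (auto simp: U_def)
    then have "e0 j \<in> V" if "j < s" using e0_in[OF that] uv by blast
    then show ?thesis using that p[OF that(1)] aV[of j "i - 1"] w(2) W(1) r
      by (auto simp: e_def split: if_splits)
  qed
  moreover have "E (e i j) (e i' j')" if ii: "i < r" "i' < r" "i \<noteq> i'" "j < ?p ! i" "j' < ?p ! i'" for i i' j j'
  proof -
    have *: "E (e i j) (e i' j')" if "i < i'" "i' < r" "j < ?p ! i" "j' < ?p ! i'" for i i' j j'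
    proof (cases "i = 0")
      case True
      have js: "j < s" using that p[of i] True r by simp
      show ?thesis
      proof (cases "i' < r - 1")
        case True
        then have j': "j' < s" "i' - 1 < r - 2" using that p[of i'] by auto
        have "E x (a j' ! (i' - 1))" if "x \<in> {u, v} \<union> U" for x
          using that uva[OF j'] cross[of _ j' "r - 2" "i' - 1"] j' by (auto simp: U_def)
        then show ?thesis using e0_in[OF js] True \<open>i = 0\<close> that by (simp add: e_def)
      next
        case False
        then have "j' < t" using that p[of i'] by auto
        then have wj: "w j' \<in> W" using w by auto
        have "E x (w j')" if "x \<in> {u, v} \<union> U" for x
          using that uvW[OF wj] E_sym[OF aw[OF wj, of _ "r - 2"]] r by (auto simp: U_def)
        then show ?thesis using e0_in[OF js] False \<open>i = 0\<close> that by (simp add: e_def)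
      qed
    next
      case False
      have ir: "i < r - 1" using that by linarith
      have js: "j < s" using that p[of i] ir by simp
      show ?thesis
      proof (cases "i' < r - 1")
        case True
        then have "j' < s" using that p[of i'] by simp
        then show ?thesis using cross[of j j' "i - 1" "i' - 1"] that False True ir js by (simp add: e_def)
      next
        case F: False
        then have "j' < t" using that p[of i'] by auto
        then have wj: "w j' \<in> W" using w by auto
        show ?thesis using E_sym[OF aw[OF wj js, of "i - 1"]] F False ir that by (simp add: e_def)
      qed
    qed
    show ?thesis using *[of i i' j j'] E_sym[OF *[of i' i j' j]] ii by (cases "i < i'") auto
  qed
  moreover have "E (e 0 0) (e 0 1)" using uv by (simp add: e_def e0_def)
  ultimately show ?thesis unfolding embeds_K_plus_def len by (intro exI[of _ e]) blast
qed

end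

text \<open>The subgraph \<open>H\<close> keeps only the arcs of \<open>G\<close> that lie over arcs
  of the target, so further edges among the image vertices are dropped. The isomorphism inverts the
  embedding; it is injective on arcs because \<open>G\<close> has no parallel arcs.\<close>

lemma contains_copy_K_plus:
  assumes G: "graph G" and e: "adjacency.embeds_K_plus (\<lambda>u v. u \<rightarrow>\<^bsub>G\<^esub> v) (verts G) p"
    and adj: "adjacency (\<lambda>u v. u \<rightarrow>\<^bsub>G\<^esub> v)"
  shows "contains_copy G (with_proj (K_plus p))"
proof -
  interpret graph G by (rule G)
  interpret adjacency "\<lambda>u v. u \<rightarrow>\<^bsub>G\<^esub> v" by (rule adj)
  obtain e where e: "\<forall>i<length p. inj_on (e i) {..<p ! i} \<and> e i ` {..<p ! i} \<subseteq> verts G"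
      "\<forall>i<length p. \<forall>i'<length p. i \<noteq> i' \<longrightarrow> (\<forall>j<p ! i. \<forall>j'<p ! i'. e i j \<rightarrow>\<^bsub>G\<^esub> e i' j')"
      "e 0 0 \<rightarrow>\<^bsub>G\<^esub> e 0 1"
    using e unfolding embeds_K_plus_def by (elim exE conjE)
  have inj: "inj_on (e i) {..<p ! i}" and eV: "\<And>j. j < p ! i \<Longrightarrow> e i j \<in> verts G" if "i < length p" for i
    using e(1) that by blast+
  have eE: "e i j \<rightarrow>\<^bsub>G\<^esub> e i' j'"
    if "i < length p" "i' < length p" "i \<noteq> i'" "j < p ! i" "j' < p ! i'" for i i' j j'
    using e(2) that by simp
  note e01 = e(3)
  define V where "V = (SIGMA i:{..<length p}. {..<p ! i})"
  define A where "A = {(u, v). u \<in> V \<and> v \<in> V \<and> (fst u \<noteq> fst v \<or> {u, v} = {(0, 0), (0, 1)})}"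
  have K: "with_proj (K_plus p) = \<lparr>verts = V, arcs = A, tail = fst, head = snd\<rparr>"
    by (simp add: K_plus_def with_proj_def V_def A_def Let_def)
  define \<phi> where "\<phi> x = e (fst x) (snd x)" for x
  have \<phi>E: "\<phi> x \<rightarrow>\<^bsub>G\<^esub> \<phi> y" if "(x, y) \<in> A" for x y
  proof (cases "fst x = fst y")
    case True
    with that have "{x, y} = {(0, 0), (0, 1)}" by (auto simp: A_def)
    then show ?thesis using e01 E_sym[OF e01] by (auto simp: \<phi>_def doubleton_eq_iff)
  next
    case False
    with that show ?thesis unfolding \<phi>_def by (intro eE) (auto simp: A_def V_def)
  qed
  have \<phi>inj: "inj_on \<phi> V"
  proof (rule inj_onI)
    fix x y assume xy: "x \<in> V" "y \<in> V" "\<phi> x = \<phi> y"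
    have "fst x = fst y"
    proof (rule ccontr)
      assume "fst x \<noteq> fst y"
      then have "\<phi> x \<rightarrow>\<^bsub>G\<^esub> \<phi> y" using xy by (intro \<phi>E) (auto simp: A_def)
      with xy show False using E_irrefl by simp
    qed
    moreover from this have "snd x = snd y"
      using xy inj[of "fst x"] by (auto simp: \<phi>_def V_def dest: inj_onD)
    ultimately show "x = y" by (simp add: prod_eq_iff)
  qed
  have \<phi>V: "\<phi> ` V \<subseteq> verts G" using eV by (auto simp: \<phi>_def V_def)
  define \<psi> where "\<psi> = the_inv_into V \<phi>"
  have \<psi>: "\<psi> (\<phi> x) = x" if "x \<in> V" for x
    unfolding \<psi>_def using \<phi>inj that by (rule the_inv_into_f_f)
  have AV: "x \<in> V" "y \<in> V" if "(x, y) \<in> A" for x y using that by (auto simp: A_def)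
  define H where "H = \<lparr>verts = \<phi> ` V,
    arcs = {a \<in> arcs G. \<exists>(x, y)\<in>A. tail G a = \<phi> x \<and> head G a = \<phi> y}, tail = tail G, head = head G\<rparr>"
  have wfH: "wf_digraph H" by unfold_locales (auto simp: H_def AV)
  have "subgraph H G"
    using wfH \<phi>V by (auto simp: subgraph_def H_def compatible_def intro: wf_digraph)
  moreover have "digraph_iso H (with_proj (K_plus p))"
  proof -
    define h where "h = \<lparr>iso_verts = \<psi>, iso_arcs = \<lambda>a. (\<psi> (tail G a), \<psi> (head G a)),
      iso_head = snd, iso_tail = fst\<rparr>"
    have "inj_on \<psi> (verts H)" using \<psi> by (auto simp: H_def inj_on_def)
    moreover have "inj_on (\<lambda>a. (\<psi> (tail G a), \<psi> (head G a))) (arcs H)"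
    proof (rule inj_onI)
      fix a a' assume aa: "a \<in> arcs H" "a' \<in> arcs H"
        "(\<psi> (tail G a), \<psi> (head G a)) = (\<psi> (tail G a'), \<psi> (head G a'))"
      then have "tail G a = tail G a'" "head G a = head G a'"
        using \<psi> AV by (auto simp: H_def)
      then show "a = a'" using aa no_multi_arcs[of a a'] by (auto simp: H_def arc_to_ends_def)
    qed
    ultimately have "pre_digraph.digraph_isomorphism H h"
      unfolding pre_digraph.digraph_isomorphism_def using wfH by (auto simp: h_def H_def)
    moreover have "with_proj (K_plus p) = app_iso h H"
    proof -
      have "\<psi> ` verts H = V" using \<psi> by (force simp: H_def)
      moreover have "(\<lambda>a. (\<psi> (tail G a), \<psi> (head G a))) ` arcs H = A"
      proof (intro equalityI subrelI)
        fix x y assume "(x, y) \<in> A"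
        moreover from \<phi>E[OF this] obtain a where "a \<in> arcs G" "tail G a = \<phi> x" "head G a = \<phi> y"
          by (auto simp: arcs_ends_def arc_to_ends_def)
        ultimately have "a \<in> arcs H" "(x, y) = (\<psi> (tail G a), \<psi> (head G a))"
          using \<psi> AV by (auto simp: H_def)
        then show "(x, y) \<in> (\<lambda>a. (\<psi> (tail G a), \<psi> (head G a))) ` arcs H" by blast
      next
        fix x y assume "(x, y) \<in> (\<lambda>a. (\<psi> (tail G a), \<psi> (head G a))) ` arcs H"
        then show "(x, y) \<in> A" using \<psi> AV by (auto simp: H_def)
      qed
      ultimately show ?thesis by (simp add: K app_iso_def h_def)
    qed
    ultimately show ?thesis unfolding digraph_iso_def by blast
  qed
  ultimately show ?thesis unfolding contains_copy_def by blast
qed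

abbreviation log_sizes :: "nat \<Rightarrow> real \<Rightarrow> nat \<Rightarrow> nat list" where
  "log_sizes r c n \<equiv>
    replicate (r - 1) (nat \<lfloor>c * ln (real n)\<rfloor>) @ [nat \<lceil>real n powr (1 - 2 * sqrt c)\<rceil>]"

context adjacency
begin

text \<open>The blow-up lies inside the neighbourhood of \<open>v\<close>, so \<open>v\<close> can
  join the part formed by coordinate \<open>r - 2\<close>; its edge to a vertex of that part is the
  additional one.\<close>

lemma embeds_K_plus_of_nbr_cliques:
  fixes r n :: nat and c :: real
  assumes r: "r \<ge> 2" and n: "n \<ge> 2" and c: "2 / ln (real n) \<le> c" "c \<le> 1 / (2 * real r ^ ((2 * r + 9) * (r + 1)))"
    and V: "finite V" "card V = n" and v: "v \<in> V"
    and many: "2 * r * n ^ r \<le> 256 * r ^ (2 * r + 11) * card (cliques r (nbrs V v))"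
  shows "embeds_K_plus V (log_sizes r c n)"
proof -
  define s where "s = nat \<lfloor>c * ln (real n)\<rfloor>"
  define t where "t = nat \<lceil>real n powr (1 - 2 * sqrt c)\<rceil>"
  have sub: "cliques r (nbrs V v) \<subseteq> cliques r V" by (rule cliques_mono) (auto simp: nbrs_def)
  note B = clique_blowup_log[OF r n c V sub many, folded s_def t_def]
  have s2: "s \<ge> 2" by (rule B(1))
  obtain a W where aW: "\<forall>i<s. length (a i) = r - 1" "W \<subseteq> V" "t \<le> card W"
      "\<forall>i<s. \<forall>w\<in>W. w # a i \<in> cliques r (nbrs V v)"
      "\<forall>i<s. \<forall>i'<s. \<forall>j<r - 1. \<forall>j'<r - 1. j \<noteq> j' \<longrightarrow> E (a i ! j) (a i' ! j')"
      "\<forall>j<r - 1. inj_on (\<lambda>i. a i ! j) {..<s}"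
    using B(2) by (elim exE conjE)
  have t0: "t > 0" using n by (simp add: t_def)
  have "W \<noteq> {}" using aW(3) t0 by auto
  then obtain w0 where w0: "w0 \<in> W" by blast
  have mem: "x \<in> V \<and> E v x" if "i < s" "w \<in> W" "x \<in> set (w # a i)" for i w x
    using aW(4) that by (auto simp: cliques_def nbrs_def)
  have ain: "a i ! j \<in> set (w0 # a i)" if "i < s" "j < r - 1" for i j
    using aW(1) that by simp
  let ?u = "a 0 ! (r - 2)"
  have u: "?u \<in> V \<and> E v ?u" using mem[OF _ w0 ain, of 0 "r - 2"] s2 r by simp
  show ?thesis unfolding s_def[symmetric] t_def[symmetric]
  proof (rule embeds_K_plusI[where a = a and W = W and u = ?u and v = v, OF r s2])
    show "w # a i \<in> cliques r V" if "i < s" "w \<in> W" for i w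
      using aW(4) sub that by blast
    show "E ?u w \<and> E v w" if "w \<in> W" for w
    proof
      show "E v w" using mem[of 0 w w] that s2 by simp
      have "w # a 0 \<in> cliques (Suc (r - 1)) (nbrs V v)" using aW(4) that s2 r by simp
      moreover have "?u \<in> set (a 0)" using aW(1) s2 r by simp
      ultimately have "E w ?u" by (simp add: Cons_in_cliques_iff common_def)
      then show "E ?u w" by (rule E_sym)
    qed
    show "E ?u (a i ! j) \<and> E v (a i ! j)" if "i < s" "j < r - 2" for i j
    proof
      show "E ?u (a i ! j)"
        using aW(5)[rule_format, of 0 i "r - 2" j] that s2 r by simp
      show "E v (a i ! j)" using mem[OF that(1) w0 ain, of j] that by simp
    qed
    show "E (a i ! j) (a i' ! j')" if "i < s" "i' < s" "j < r - 1" "j' < r - 1" "j \<noteq> j'" for i i' j j'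
      using aW(5) that by simp
    show "E ?u v" using u E_sym by blast
  qed (use aW u v t0 V in auto)
qed

lemma embeds_K_plus_of_joint:
  fixes r n :: nat and c :: real
  assumes r: "r \<ge> 2" and n: "n \<ge> 2" and c: "2 / ln (real n) \<le> c" "c \<le> 1 / (2 * real r ^ ((2 * r + 9) * (r + 1)))"
    and V: "finite V" "card V = n" and uv: "u \<in> V" "v \<in> V" "E u v"
    and Qs: "Qs \<subseteq> cliques (r - 1) (nbrs V u \<inter> nbrs V v)"
    and many: "2 * r * n ^ r \<le> 256 * r ^ (2 * r + 11) * (\<Sum>Q\<in>Qs. card (common V Q))"
  shows "embeds_K_plus V (log_sizes r c n)"
proof -
  define s where "s = nat \<lfloor>c * ln (real n)\<rfloor>"
  define t where "t = nat \<lceil>real n powr (1 - 2 * sqrt c)\<rceil>"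
  define F where "F = (\<lambda>(Q, w). insert_nth (r - 1) w Q :: 'a list)"
  define M where "M = F ` (SIGMA Q:Qs. common V Q)"
  have QV: "Qs \<subseteq> cliques (r - 1) V"
    using Qs cliques_mono[of "nbrs V u \<inter> nbrs V v" V "r - 1"] by (auto simp: nbrs_def)
  have sr: "Suc (r - 1) = r" using r by simp
  have bij: "bij_betw F (SIGMA Q:cliques (r - 1) V. common V Q) (cliques r V)"
    using bij_betw_insert_nth[of "r - 1" "r - 1" V] unfolding F_def sr by simp
  have sub: "M \<subseteq> cliques r V" using bij QV unfolding M_def bij_betw_def by blast
  have "inj_on F (SIGMA Q:Qs. common V Q)"
    using bij QV unfolding bij_betw_def by (elim conjE) (erule inj_on_subset, blast)
  then have "card M = card (SIGMA Q:Qs. common V Q)" unfolding M_def by (rule card_image)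
  also have "\<dots> = (\<Sum>Q\<in>Qs. card (common V Q))"
    using V(1) finite_subset[OF QV] by simp
  finally have many': "2 * r * n ^ r \<le> 256 * r ^ (2 * r + 11) * card M" using many by simp
  note B = clique_blowup_log[OF r n c V sub many', folded s_def t_def]
  have s2: "s \<ge> 2" by (rule B(1))
  obtain a W where aW: "\<forall>i<s. length (a i) = r - 1" "W \<subseteq> V" "t \<le> card W"
      "\<forall>i<s. \<forall>w\<in>W. w # a i \<in> M"
      "\<forall>i<s. \<forall>i'<s. \<forall>j<r - 1. \<forall>j'<r - 1. j \<noteq> j' \<longrightarrow> E (a i ! j) (a i' ! j')"
      "\<forall>j<r - 1. inj_on (\<lambda>i. a i ! j) {..<s}"
    using B(2) by (elim exE conjE)
  have t0: "t > 0" using n by (simp add: t_def)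
  have "W \<noteq> {}" using aW(3) t0 by auto
  then obtain w0 where w0: "w0 \<in> W" by blast
  have mem: "E u ((w # a i) ! j) \<and> E v ((w # a i) ! j)" if iw: "i < s" "w \<in> W" and j: "j < r - 1" for i w j
  proof -
    have "w # a i \<in> M" using aW(4) iw by blast
    then obtain Q z where Q: "Q \<in> Qs" "w # a i = insert_nth (r - 1) z Q"
      by (auto simp: M_def F_def)
    then have len: "length Q = r - 1" and Qset: "set Q \<subseteq> nbrs V u \<inter> nbrs V v"
      using Qs by (auto simp: cliques_def)
    have "(w # a i) ! j = Q ! j" unfolding Q(2) insert_nth_def using len j by (simp add: nth_append)
    moreover have "Q ! j \<in> set Q" using len j by simp
    ultimately show ?thesis using Qset by (auto simp: nbrs_def)
  qed
  show ?thesis unfolding s_def[symmetric] t_def[symmetric]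
  proof (rule embeds_K_plusI[where a = a and W = W and u = u and v = v, OF r s2])
    show "w # a i \<in> cliques r V" if "i < s" "w \<in> W" for i w
      using aW(4) sub that by blast
    show "E u w \<and> E v w" if "w \<in> W" for w
      using mem[of 0 w 0] that s2 r by simp
    show "E u (a i ! j) \<and> E v (a i ! j)" if "i < s" "j < r - 2" for i j
      using mem[OF that(1) w0, of "Suc j"] that by simp
    show "E (a i ! j) (a i' ! j')" if "i < s" "i' < s" "j < r - 1" "j' < r - 1" "j \<noteq> j'" for i i' j j'
      using aW(5) that by simp
  qed (use aW uv t0 V in auto)
qed

end

section \<open>Spectral stability\<close>

text \<open>The two bounds on \<open>c\<close> are compatible only if
  \<open>ln n \<ge> 4 * r ^ ((2 * r + 9) * (r + 1))\<close>. The power 20 is enough to absorb the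
  lower-order terms of the deletion process.\<close>

lemma order_ge_of_log:
  fixes r n :: nat and c :: real
  assumes r: "r \<ge> 2" and n: "n \<ge> 2"
    and c: "2 / ln (real n) \<le> c" "c \<le> 1 / (2 * real r ^ ((2 * r + 9) * (r + 1)))"
  shows "real r ^ 20 \<le> real n"
proof -
  have L: "ln (real n) > 0" using n by simp
  have R: "real r > 0" using r by simp
  have "20 \<le> (2 * r + 9) * (r + 1)"
  proof -
    have "13 * 3 \<le> (2 * r + 9) * (r + 1)" using r by (intro mult_mono) auto
    then show ?thesis by simp
  qed
  then have "real r ^ 20 \<le> real r ^ ((2 * r + 9) * (r + 1))" using r by (intro power_increasing) auto
  also have "2 / ln (real n) \<le> 1 / (2 * real r ^ ((2 * r + 9) * (r + 1)))" using c by linarith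
  then have "4 * real r ^ ((2 * r + 9) * (r + 1)) \<le> ln (real n)"
    using L R by (simp add: field_simps)
  then have "real r ^ ((2 * r + 9) * (r + 1)) \<le> ln (real n)" using R zero_le_power[of "real r" "(2 * r + 9) * (r + 1)"] by linarith
  also have "ln (real n) \<le> real n" using ln_le_minus_one[of "real n"] n by simp
  finally show ?thesis .
qed

section \<open>Numerical estimates for the growth of the eigenvalue under deletion\<close>

lemma deletion_gain_lower:
  fixes u :: real
  assumes "0 < u" "u \<le> 1 / 2"
  shows "u ^ 4 / 33 \<le> 2 * (u ^ 4 / 64) / (1 + 2 * (u ^ 4 / 64))"
proof -
  have "u ^ 4 \<le> 1" using assms by (intro power_le_one) auto
  then have "u ^ 4 * (1 + u ^ 4 / 32) \<le> u ^ 4 * (33 / 32)" using assms by (intro mult_left_mono) auto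
  moreover have "1 + 2 * (u ^ 4 / 64) > 0" using assms by (simp add: add_pos_nonneg)
  ultimately show ?thesis by (simp add: pos_le_divide_eq algebra_simps)
qed

text \<open>With \<open>K\<close> about \<open>N * u / 2\<close> the gains add up to about
  \<open>u ^ 5 / 66\<close>, and rounding \<open>K\<close> leaves \<open>u ^ 5 / 70\<close>. The
  factor \<open>a - b\<close> and the deficit \<open>b \<le> u ^ 5 / 2048\<close> reduce this to
  \<open>u ^ 5 / 160\<close>, and passing from \<open>m - 1\<close> to \<open>m\<close> to
  \<open>u ^ 5 / 256\<close>.\<close>

lemma density_gain:
  fixes u a b N K m g \<mu> \<mu>\<^sub>0 :: real
  assumes u: "0 < u" "u \<le> 1 / 2" and a: "a = 1 - u" and b: "0 \<le> b" "b \<le> u ^ 6 / 1024"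
    and N: "N * u ^ 5 \<ge> 32768" and K: "N * u / 2 - 1 \<le> K" "K \<le> N * u / 2" and m: "m = N - K"
    and g: "u ^ 4 / 33 \<le> g" and \<mu>\<^sub>0: "(a - b) * N \<le> \<mu>\<^sub>0"
    and \<mu>: "\<mu>\<^sub>0 * (m - 1) * (1 + K * (g / N)) \<le> \<mu> * (N - 1)"
  shows "(a + u ^ 5 / 256) * m \<le> \<mu>"
proof -
  have u5: "u ^ 5 > 0" "u ^ 5 \<le> 1" using u by (auto intro: power_le_one)
  have u4: "u ^ 4 > 0" "u ^ 4 \<le> 1" using u by (auto intro: power_le_one)
  have Npos: "N > 0"
  proof (rule ccontr)
    assume "\<not> N > 0"
    then have "N * u ^ 5 \<le> 0" using u5 by (simp add: mult_nonpos_nonneg)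
    with N show False by linarith
  qed
  have "N * u ^ 5 \<le> N * 1" using u5 Npos by (intro mult_left_mono) auto
  then have N1: "N \<ge> 32768" using N by linarith
  have b5: "b \<le> u ^ 5 / 2048"
  proof -
    have "u ^ 6 = u ^ 5 * u" by (simp add: eval_nat_numeral)
    also have "\<dots> \<le> u ^ 5 * (1 / 2)" using u u5 by (intro mult_left_mono) auto
    finally show ?thesis using b by linarith
  qed
  have ab: "a - b \<ge> 49 / 100" using b5 u5 u a by linarith
  have K0: "K \<ge> 0"
  proof -
    have "N * u \<ge> N * u ^ 5" using Npos u power_decreasing[of 1 5 u] by (intro mult_left_mono) auto
    then show ?thesis using K N by linarith
  qed
  have m_ge: "m \<ge> 3 / 4 * N"
  proof -
    have "N * u \<le> N * (1 / 2)" using u Npos by (intro mult_left_mono) auto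
    then show ?thesis using K m by linarith
  qed
  have G: "u ^ 5 / 70 \<le> K * (g / N)"
  proof -
    have "(N * u / 2 - 1) * (u ^ 4 / 33) \<le> K * g" using K K0 g u4 by (intro mult_mono) auto
    moreover have "(N * u / 2 - 1) * (u ^ 4 / 33) = N * u ^ 5 / 66 - u ^ 4 / 33"
    proof -
      have "N * u / 2 * (u ^ 4 / 33) = N * u ^ 5 / 66" by (simp add: eval_nat_numeral)
      then show ?thesis by (simp only: left_diff_distrib mult_1)
    qed
    moreover have "u ^ 4 / 33 \<le> N * u ^ 5 / 66 - N * u ^ 5 / 70" using u4 N by linarith
    ultimately have "N * u ^ 5 / 70 \<le> K * g" by linarith
    then have "u ^ 5 / 70 * N \<le> K * g" by (simp add: mult.commute)
    then show ?thesis using Npos by (simp add: pos_le_divide_eq)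
  qed
  define q where "q = (a - b) * (u ^ 5 / 70)"
  have "49 / 100 * (u ^ 5 / 70) \<le> q" unfolding q_def using ab u5 by (intro mult_right_mono) auto
  then have "a + u ^ 5 / 160 \<le> (a - b) + q" using b5 u5 by linarith
  also have "\<dots> = (a - b) * (1 + u ^ 5 / 70)" by (simp only: q_def distrib_left mult_1_right)
  also have "\<dots> \<le> (a - b) * (1 + K * (g / N))" using G ab by (intro mult_left_mono) auto
  finally have 1: "a + u ^ 5 / 160 \<le> (a - b) * (1 + K * (g / N))" .
  have apos: "a + u ^ 5 / 160 > 0" using a u u5 by (simp add: add_pos_pos)
  have "((a + u ^ 5 / 160) * (m - 1)) * (N - 1) \<le> ((a + u ^ 5 / 160) * (m - 1)) * N"
    using apos m_ge N1 by (intro mult_left_mono mult_nonneg_nonneg) auto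
  also have "\<dots> = (a + u ^ 5 / 160) * ((m - 1) * N)" by simp
  also have "\<dots> \<le> ((a - b) * (1 + K * (g / N))) * ((m - 1) * N)"
    using 1 m_ge N1 by (intro mult_right_mono mult_nonneg_nonneg) auto
  also have "\<dots> = ((a - b) * N) * ((m - 1) * (1 + K * (g / N)))" by simp
  also have "\<dots> \<le> \<mu>\<^sub>0 * ((m - 1) * (1 + K * (g / N)))"
  proof (rule mult_right_mono[OF \<mu>\<^sub>0])
    have "0 \<le> K * (g / N)" using G u5 by linarith
    then show "0 \<le> (m - 1) * (1 + K * (g / N))" using m_ge N1 by (intro mult_nonneg_nonneg) auto
  qed
  also have "\<dots> \<le> \<mu> * (N - 1)" using \<mu> by simp
  finally have 2: "(a + u ^ 5 / 160) * (m - 1) \<le> \<mu>" using N1 by simp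
  have "3 / 4 * (N * u ^ 5) \<le> m * u ^ 5"
    using mult_right_mono[OF m_ge, of "u ^ 5"] u5 by (simp add: mult_ac)
  then have "m * u ^ 5 \<ge> 24576" using N by linarith
  then have "(a + u ^ 5 / 256) * m \<le> (a + u ^ 5 / 160) * (m - 1)"
    using a u u5 by (simp add: algebra_simps)
  with 2 show ?thesis by linarith
qed

text \<open>Each deletion gains a relative amount \<open>g / N\<close>, while the bound
  \<open>\<mu> \<le> a * m\<close> leaves room only for making up the deficit \<open>b\<close>; so
  \<open>k * g\<close> is \<open>O(b * N)\<close>. The constant 70 leaves some slack over
  \<open>3300 / 49\<close>, which stems from \<open>a - b \<ge> 49 / 100\<close> and
  \<open>g \<ge> u ^ 4 / 33\<close>.\<close>

lemma few_deletions:
  fixes u a b N k m g \<mu> \<mu>\<^sub>0 :: real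
  assumes u: "0 < u" "u \<le> 1 / 2" and a: "a = 1 - u" and b: "0 \<le> b" "b \<le> 1 / 100"
    and N: "N * u ^ 4 \<ge> 65536" and k: "0 \<le> k" "k \<le> N / 4" and m: "m = N - k"
    and g: "u ^ 4 / 33 \<le> g" and \<mu>\<^sub>0: "(a - b) * N \<le> \<mu>\<^sub>0"
    and \<mu>: "\<mu>\<^sub>0 * (m - 1) * (1 + k * (g / N)) \<le> \<mu> * (N - 1)" and "\<mu> \<le> a * m"
  shows "k * u ^ 4 \<le> 70 * b * N" and "(a - 2 * b) * m \<le> \<mu>"
proof -
  have u4: "u ^ 4 > 0" "u ^ 4 \<le> 1" using u by (auto intro: power_le_one)
  have Npos: "N > 0"
  proof (rule ccontr)
    assume "\<not> N > 0"
    then have "N * u ^ 4 \<le> 0" using u4 by (simp add: mult_nonpos_nonneg)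
    with N show False by linarith
  qed
  have "N * u ^ 4 \<le> N * 1" using u4 Npos by (intro mult_left_mono) auto
  then have N1: "N \<ge> 65536" using N by linarith
  have ab: "a - b \<ge> 49 / 100" using b u a by linarith
  have m_ge: "m \<ge> 3 / 4 * N" using m k by linarith
  have m1: "m - 1 \<ge> N / 2" using m_ge N1 by linarith
  have "N * u ^ 4 / 2 \<le> (m - 1) * u ^ 4" using mult_right_mono[OF m1, of "u ^ 4"] u4(1) by (simp only: times_divide_eq_left less_imp_le)
  then have m1u: "(m - 1) * u ^ 4 \<ge> 32768" using N by linarith
  have g0: "g \<ge> 0" using g u4 by linarith
  have low: "((a - b) * N) * ((m - 1) * (1 + k * (g / N))) \<le> \<mu> * (N - 1)"
  proof -
    have "((a - b) * N) * ((m - 1) * (1 + k * (g / N))) \<le> \<mu>\<^sub>0 * ((m - 1) * (1 + k * (g / N)))"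
      using m1 N1 k g0 by (intro mult_right_mono[OF \<mu>\<^sub>0] mult_nonneg_nonneg add_nonneg_nonneg divide_nonneg_nonneg) auto
    then show ?thesis using \<mu> by simp
  qed
  have "\<mu> * (N - 1) \<le> (a * m) * (N - 1)" using assms(13) N1 by (intro mult_right_mono) auto
  with low have *: "((a - b) * N) * ((m - 1) * (1 + k * (g / N))) \<le> (a * m) * (N - 1)" by linarith
  have "N * (1 + k * (g / N)) = N + k * g" using Npos by (simp add: algebra_simps)
  then have **: "((a - b) * N) * ((m - 1) * (1 + k * (g / N))) = (a - b) * (m - 1) * (N + k * g)"
    by (metis (no_types, opaque_lifting) mult.assoc mult.commute)
  have "(a - b) * (m - 1) * (N + k * g) \<le> (a * m) * (N - 1)" using * unfolding ** .
  then have 1: "((a - b) * g * (m - 1)) * k \<le> a * k + b * (m - 1) * N"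
    unfolding m by (simp add: algebra_simps)
  have "49 / 100 * (u ^ 4 / 33) \<le> (a - b) * g" using ab g u4 by (intro mult_mono) auto
  then have "(49 / 100 * (u ^ 4 / 33)) * (m - 1) * k \<le> (a - b) * g * (m - 1) * k"
    using m1 N1 k by (intro mult_right_mono) auto
  moreover have "a * k \<le> ((m - 1) * u ^ 4 / 32768) * k" using m1u a u k by (intro mult_right_mono) auto
  ultimately have F: "(49 / 100 * (u ^ 4 / 33)) * (m - 1) * k - ((m - 1) * u ^ 4 / 32768) * k \<le> b * (m - 1) * N"
    using 1 by linarith
  define P where "P = (m - 1) * (k * u ^ 4)"
  have e: "(49 / 100 * (u ^ 4 / 33)) * (m - 1) * k = 49 / 3300 * P" "((m - 1) * u ^ 4 / 32768) * k = 1 / 32768 * P"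
    "(m - 1) * ((49 / 3300 - 1 / 32768) * (k * u ^ 4)) = (49 / 3300 - 1 / 32768) * P"
    "b * (m - 1) * N = (m - 1) * (b * N)"
    by (simp_all add: P_def)
  have "49 / 3300 * P - 1 / 32768 * P \<le> (m - 1) * (b * N)" using F unfolding e(1,2,4) .
  then have "(m - 1) * ((49 / 3300 - 1 / 32768) * (k * u ^ 4)) \<le> (m - 1) * (b * N)"
    unfolding e(3) left_diff_distrib[of _ _ P] .
  then have "(49 / 3300 - 1 / 32768) * (k * u ^ 4) \<le> b * N" using m1 N1 by (simp del: mult_le_cancel_left_pos add: mult_le_cancel_left)
  moreover have "1 / 70 * (k * u ^ 4) \<le> (49 / 3300 - 1 / 32768) * (k * u ^ 4)"
    using k u4 by (intro mult_right_mono) auto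
  ultimately have "1 / 70 * (k * u ^ 4) \<le> b * N" by (rule order_trans[rotated])
  then show k70: "k * u ^ 4 \<le> 70 * b * N" by simp
  have "0 \<le> k * (g / N)" using k g0 Npos by (intro mult_nonneg_nonneg divide_nonneg_nonneg) auto
  then have "((a - b) * N) * ((m - 1) * 1) \<le> ((a - b) * N) * ((m - 1) * (1 + k * (g / N)))"
    using ab m1 N1 by (intro mult_left_mono mult_nonneg_nonneg) auto
  with low have "(a - b) * N * (m - 1) \<le> \<mu> * (N - 1)" by (simp add: mult_ac)
  moreover have "(a - 2 * b) * m * (N - 1) \<le> (a - b) * N * (m - 1)"
  proof -
    have "a * k \<le> 1 * k" using a u k by (intro mult_right_mono) auto
    also have "k \<le> b * ((m - 1) * N)"
    proof -
      have "k * u ^ 4 \<le> u ^ 4 * (b * ((m - 1) * N))"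
      proof -
        have "70 * (b * N) \<le> (m - 1) * u ^ 4 * (b * N)"
          using m1u b Npos by (intro mult_right_mono) auto
        then show ?thesis using k70 by (simp add: mult_ac)
      qed
      then have "u ^ 4 * k \<le> u ^ 4 * (b * ((m - 1) * N))" by (simp add: mult_ac)
      then show ?thesis using u4 by (simp only: mult_le_cancel_left_pos)
    qed
    finally have "a * k \<le> b * ((m - 1) * N)" by simp
    moreover have "(a - b) * N * (m - 1) - (a - 2 * b) * m * (N - 1) = b * ((m - 1) * N) - a * k + 2 * b * (N - m)"
      unfolding m by (simp add: algebra_simps)
    moreover have "2 * b * (N - m) \<ge> 0" using b k m by simp
    ultimately show ?thesis by linarith
  qed
  ultimately have "((a - 2 * b) * m) * (N - 1) \<le> \<mu> * (N - 1)" by linarith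
  then show "(a - 2 * b) * m \<le> \<mu>" using N1 by simp
qed

context adjacency
begin

text \<open>If no neighbourhood had enough \<open>r\<close>-cliques for the blow-up, summing over
  the vertices of \<open>S\<close> would leave at most \<open>N * Z\<close> cliques on
  \<open>r + 1\<close> vertices, fewer than the spectral bound with surplus
  \<open>u ^ 5 / 256\<close> provides.\<close>

lemma embeds_K_plus_of_dense:
  fixes r n :: nat and c :: real
  assumes r: "r \<ge> 2" and n: "n \<ge> 2" and c: "2 / ln (real n) \<le> c" "c \<le> 1 / (2 * real r ^ ((2 * r + 9) * (r + 1)))"
    and V: "finite V" "card V = n" and S: "S \<subseteq> V" "card S = m" and P: "perron S \<mu> x"
    and m: "(1 - 1 / (2 * real r)) * real n \<le> real m"
    and \<mu>: "(1 - 1 / real r + (1 / real r) ^ 5 / 256) * real m \<le> \<mu>"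
  shows "embeds_K_plus V (log_sizes r c n)"
proof (rule ccontr)
  assume no: "\<not> ?thesis"
  define R where "R = real r"
  define N where "N = real n"
  define u where "u = 1 / R"
  have R: "R \<ge> 2" and N: "N > 0" using r n by (auto simp: R_def N_def)
  have u: "u > 0" "u \<le> 1 / 2" using R by (auto simp: u_def field_simps)
  have finS: "finite S" using S(1) V(1) finite_subset by blast
  have u5: "u ^ 5 > 0" "u ^ 5 \<le> u"
    using u power_decreasing[of 1 5 u] by auto
  have m34: "3 / 4 * N \<le> real m"
  proof -
    have "3 / 4 \<le> 1 - 1 / (2 * real r)" using r by (simp add: field_simps)
    then have "3 / 4 * N \<le> (1 - 1 / (2 * real r)) * N" using N by (intro mult_right_mono) auto
    then show ?thesis using m by (simp add: N_def)
  qed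
  have \<mu>N: "3 / 8 * N \<le> \<mu>"
  proof -
    have h: "1 / 2 \<le> 1 - u + u ^ 5 / 256" using u u5 by linarith
    have "1 / 2 * (3 / 4 * N) \<le> (1 - u + u ^ 5 / 256) * real m"
      by (rule mult_mono[OF h m34]) (use h N in linarith)+
    also have "\<dots> \<le> \<mu>" using \<mu> by (simp add: u_def R_def)
    finally show ?thesis by simp
  qed
  have \<mu>0: "\<mu> > 0" using \<mu>N N by linarith
  have "real r * (u ^ 5 / 256) * (1 / real r) ^ (r - 1) * \<mu> ^ Suc r \<le> real (card (cliques (Suc r) S))"
  proof (rule perron_many_cliques[OF finS S(2) P])
    have "u ^ 5 / 256 \<le> u" using u u5 by linarith
    then show "u ^ 5 / 256 \<le> 1 / real r" by (simp add: u_def R_def)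
    show "(1 - 1 / real r + u ^ 5 / 256) * real m \<le> \<mu>" using \<mu> by (simp add: u_def R_def)
  qed (use r u5 \<mu>0 in auto)
  moreover define Z where "Z = 2 * R * N ^ r / (256 * R ^ (2 * r + 11))"
  have "real (card (cliques (Suc r) S)) \<le> real n * Z"
  proof (rule real_card_cliques_Suc_le[OF finS])
    show "card S \<le> n" using card_mono[OF V(1) S(1)] V(2) by simp
    show "0 \<le> Z" using R N by (simp add: Z_def)
    fix v assume v: "v \<in> S"
    show "real (card (cliques r (nbrs S v))) \<le> Z"
    proof (rule ccontr)
      assume "\<not> ?thesis"
      then have "2 * R * N ^ r < 256 * R ^ (2 * r + 11) * real (card (cliques r (nbrs S v)))"
        using R unfolding Z_def by (simp add: not_le pos_divide_less_eq mult.commute)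
      then have "real (2 * r * n ^ r) < real (256 * r ^ (2 * r + 11) * card (cliques r (nbrs S v)))"
        by (simp add: R_def N_def)
      then have "2 * r * n ^ r < 256 * r ^ (2 * r + 11) * card (cliques r (nbrs S v))"
        by (simp only: of_nat_less_iff)
      also have "\<dots> \<le> 256 * r ^ (2 * r + 11) * card (cliques r (nbrs V v))"
        using V(1) S(1) by (intro mult_left_mono card_mono cliques_mono) (auto simp: nbrs_def)
      finally have "embeds_K_plus V (log_sizes r c n)"
        using v S(1) by (intro embeds_K_plus_of_nbr_cliques[OF r n c V]) auto
      with no show False by blast
    qed
  qed
  ultimately have "R * (u ^ 5 / 256) * u ^ (r - 1) * \<mu> ^ Suc r \<le> N * Z"
    by (simp add: R_def N_def u_def)
  moreover have "R * (u ^ 5 / 256) * u ^ (r - 1) * (3 / 8 * N) ^ Suc r \<le> R * (u ^ 5 / 256) * u ^ (r - 1) * \<mu> ^ Suc r"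
    using R u u5 \<mu>N N by (intro mult_left_mono power_mono mult_nonneg_nonneg) auto
  ultimately have main: "R * (u ^ 5 / 256) * u ^ (r - 1) * (3 / 8 * N) ^ Suc r \<le> N * Z" by linarith
  have Ru: "R * u = 1" using R by (simp add: u_def)
  define D where "D = R ^ (2 * r + 11)"
  have D: "D > 0" using R by (simp add: D_def)
  define X where "X = u ^ 5 * u ^ (r - 1)"
  have XD: "X * D = R ^ 6 * R ^ Suc r"
  proof -
    have "2 * r + 11 = 5 + (r - 1) + (6 + Suc r)" using r by simp
    then have "D = R ^ 5 * R ^ (r - 1) * (R ^ 6 * R ^ Suc r)" unfolding D_def by (simp only: power_add)
    then have "X * D = (R * u) ^ 5 * (R * u) ^ (r - 1) * (R ^ 6 * R ^ Suc r)"
      unfolding X_def by (simp only: power_mult_distrib mult_ac)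
    then show ?thesis unfolding Ru by simp
  qed
  have "(R * X / 256 * (3 / 8 * N) ^ Suc r) * (256 * D / R) \<le> (N * Z) * (256 * D / R)"
    using main R D unfolding X_def by (intro mult_right_mono) (auto simp: mult_ac)
  moreover have "(R * X / 256 * (3 / 8 * N) ^ Suc r) * (256 * D / R) = (X * D) * (3 / 8 * N) ^ Suc r"
    using R by simp
  moreover have "(N * Z) * (256 * D / R) = 2 * N ^ Suc r"
    using R D unfolding Z_def D_def[symmetric] by simp
  ultimately have "(X * D) * (3 / 8 * N) ^ Suc r \<le> 2 * N ^ Suc r" by (simp only:)
  moreover have "(X * D) * (3 / 8 * N) ^ Suc r = (R ^ 6 * (3 / 8 * R) ^ Suc r) * N ^ Suc r"
    unfolding XD by (simp only: power_mult_distrib mult_ac)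
  ultimately have "(R ^ 6 * (3 / 8 * R) ^ Suc r) * N ^ Suc r \<le> 2 * N ^ Suc r" by (simp only:)
  then have le2: "R ^ 6 * (3 / 8 * R) ^ Suc r \<le> 2" using N by simp
  \<comment> \<open>The value \<open>27 / 64\<close> is attained by the second factor at
    \<open>r = 2\<close>; for larger \<open>r\<close> that factor is at least 1.\<close>
  have "2 ^ 6 * (27 / 64) \<le> R ^ 6 * (3 / 8 * R) ^ Suc r"
  proof (rule mult_mono)
    show "2 ^ 6 \<le> R ^ 6" using R by (intro power_mono) auto
    show "27 / 64 \<le> (3 / 8 * R) ^ Suc r"
    proof (cases "r = 2")
      case True
      then show ?thesis by (simp add: R_def eval_nat_numeral)
    next
      case False
      then have "1 \<le> 3 / 8 * R" using r by (simp add: R_def)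
      then have "1 \<le> (3 / 8 * R) ^ Suc r" by (rule one_le_power)
      then show ?thesis by linarith
    qed
  qed (use R in auto)
  from order_trans[OF this le2] show False by simp
qed

text \<open>By the minimum degree each clique of the joint has at least \<open>m / (2 * r)\<close>
  common neighbours. The constant \<open>256 * r ^ (2 * r + 11)\<close> is
  \<open>32 * r ^ (2 * r + 9)\<close> times \<open>2 * r\<close> for this extension, 2 for
  \<open>n ^ r \<le> 2 * m ^ r\<close> and \<open>2 * r\<close> for the blow-up.\<close>

lemma embeds_K_plus_of_joint_min_degree:
  fixes r n :: nat and c :: real
  assumes r: "r \<ge> 2" and n: "n \<ge> 2" and c: "2 / ln (real n) \<le> c" "c \<le> 1 / (2 * real r ^ ((2 * r + 9) * (r + 1)))"
    and V: "finite V" "card V = n" and S: "S \<subseteq> V" "card S = m"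
    and m: "(1 - 1 / (2 * real r)) * real n \<le> real m"
    and deg: "\<And>v. v \<in> S \<Longrightarrow> real (card (nbrs S v)) \<ge> (1 - 1 / real r - 1 / (48 * real r ^ 4)) * real m"
    and uv: "u \<in> S" "v \<in> S" "E u v"
    and joint: "1 / (32 * real r ^ (2 * r + 9)) * real m ^ (r - 1) <
      real (card (cliques (r - 1) (nbrs S u \<inter> nbrs S v)))"
  shows "embeds_K_plus V (log_sizes r c n)"
proof (rule embeds_K_plus_of_joint[OF r n c V])
  let ?Qs = "cliques (r - 1) (nbrs S u \<inter> nbrs S v)"
  define R where "R = real r"
  have R: "R \<ge> 2" using r by (simp add: R_def)
  have finS: "finite S" using S(1) V(1) finite_subset by blast
  show "u \<in> V" "v \<in> V" "E u v" using uv S by auto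
  show "?Qs \<subseteq> cliques (r - 1) (nbrs V u \<inter> nbrs V v)"
    using S(1) by (intro cliques_mono) (auto simp: nbrs_def)
  have half: "real m / (2 * R) \<le> real (card (common V Q))" if "Q \<in> ?Qs" for Q
  proof -
    have Q: "set Q \<subseteq> S" "length Q = r - 1" using that by (auto simp: cliques_def nbrs_def)
    have deg': "real (card (nbrs S w)) \<ge> (1 - (1 / R + 1 / (48 * R ^ 4))) * real m" if "w \<in> S" for w
      using deg[OF that] by (simp add: R_def diff_diff_eq)
    have "(1 - real (length Q) * (1 / R + 1 / (48 * R ^ 4))) * real m \<le> real (card (common S Q))"
      by (rule card_common_ge[OF finS S(2) deg' Q(1)])
    moreover have "1 / (2 * R) * real m \<le> (1 - real (length Q) * (1 / R + 1 / (48 * R ^ 4))) * real m"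
    proof (rule mult_right_mono)
      have "real (length Q) * (1 / R + 1 / (48 * R ^ 4)) = (R - 1) * (1 / R + 1 / (48 * R ^ 4))"
        using Q(2) r by (simp add: R_def of_nat_diff)
      also have "\<dots> \<le> (R - 1) * (1 / R) + R * (1 / (48 * R ^ 4))"
        unfolding distrib_left using R by (intro add_left_mono mult_right_mono) auto
      also have "(R - 1) * (1 / R) = 1 - 1 / R" using R by (simp add: field_simps)
      also have "R * (1 / (48 * R ^ 4)) \<le> 1 / (2 * R)"
      proof -
        have "2 ^ 2 \<le> R ^ 2" using R by (intro power_mono) auto
        then have "R * R \<ge> 1" by (simp add: power2_eq_square)
        then have "R * R * (R * R) \<ge> 1 * (R * R)" by (intro mult_right_mono) auto
        then show ?thesis using R by (simp add: field_simps power4_eq_xxxx)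
      qed
      finally show "1 / (2 * R) \<le> 1 - real (length Q) * (1 / R + 1 / (48 * R ^ 4))"
        using R by simp
    qed simp
    moreover have "card (common S Q) \<le> card (common V Q)"
      using V(1) S(1) by (intro card_mono) (auto simp: common_def)
    ultimately show ?thesis by simp
  qed
  have "(1 / (32 * R ^ (2 * r + 9)) * real m ^ (r - 1)) * (real m / (2 * R)) \<le> real (card ?Qs) * (real m / (2 * R))"
    using joint R by (intro mult_right_mono) (auto simp: R_def)
  also have "\<dots> \<le> (\<Sum>Q\<in>?Qs. real (card (common V Q)))"
    using sum_mono[of ?Qs "\<lambda>_. real m / (2 * R)"] half by simp
  finally have sum: "(1 / (32 * R ^ (2 * r + 9)) * real m ^ (r - 1)) * (real m / (2 * R)) \<le>
      (\<Sum>Q\<in>?Qs. real (card (common V Q)))" .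
  \<comment> \<open>This is the reason for deleting no more than \<open>n / (2 * r)\<close>
    vertices: Bernoulli's inequality preserves half of \<open>n ^ r\<close>.\<close>
  have "real n ^ r \<le> 2 * real m ^ r"
  proof -
    have "1 + real r * (- (1 / (2 * real r))) \<le> (1 + - (1 / (2 * real r))) ^ r"
      using r by (intro Bernoulli_inequality) (simp add: field_simps)
    then have "1 / 2 \<le> (1 - 1 / (2 * real r)) ^ r" using r by simp
    then have "1 / 2 * real n ^ r \<le> (1 - 1 / (2 * real r)) ^ r * real n ^ r" by (intro mult_right_mono) auto
    also have "\<dots> = ((1 - 1 / (2 * real r)) * real n) ^ r" by (simp only: power_mult_distrib)
    also have "\<dots> \<le> real m ^ r"
    proof (rule power_mono[OF m])
      have "0 \<le> 1 - 1 / (2 * real r)" using r by (simp add: field_simps)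
      then show "0 \<le> (1 - 1 / (2 * real r)) * real n" by (rule mult_nonneg_nonneg) simp
    qed
    finally show ?thesis by simp
  qed
  then have "2 * R * real n ^ r \<le> 4 * R * real m ^ r" using R by simp
  also have "\<dots> = 256 * R ^ (2 * r + 11) * ((1 / (32 * R ^ (2 * r + 9)) * real m ^ (r - 1)) * (real m / (2 * R)))"
  proof -
    have 1: "R ^ (2 * r + 11) = R ^ (2 * r + 9) * (R * R)" by (simp add: power_add eval_nat_numeral)
    have 2: "real m ^ r = real m ^ (r - 1) * real m" using r by (cases r) auto
    have 3: "R ^ (2 * r + 9) > 0" "R > 0" using R by auto
    show ?thesis unfolding 1 2 using 3 by (simp add: field_simps)
  qed
  also have "\<dots> \<le> 256 * R ^ (2 * r + 11) * (\<Sum>Q\<in>?Qs. real (card (common V Q)))"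
    using sum R by (intro mult_left_mono) auto
  finally have "real (2 * r * n ^ r) \<le> real (256 * r ^ (2 * r + 11) * (\<Sum>Q\<in>?Qs. card (common V Q)))"
    by (simp add: R_def)
  then show "2 * r * n ^ r \<le> 256 * r ^ (2 * r + 11) * (\<Sum>Q\<in>?Qs. card (common V Q))"
    by (simp only: of_nat_le_iff)
qed

text \<open>Stated for a Perron pair and with \<beta> for the cube root of \<open>b\<close>, which
  keeps matrices and fractional powers out of the combinatorial argument.\<close>

lemma spectral_stability:
  fixes r n :: nat and c \<beta> :: real
  assumes r: "r \<ge> 2" and n: "n \<ge> 2" and c: "2 / ln (real n) \<le> c" "c \<le> 1 / (2 * real r ^ ((2 * r + 9) * (r + 1)))"
    and \<beta>: "\<beta> > 0" "\<beta> ^ 3 < (1 / real r) ^ 6 / 1024"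
    and V: "finite V" "card V = n" and P\<^sub>0: "perron V \<mu>\<^sub>0 x\<^sub>0"
    and \<mu>\<^sub>0: "(1 - 1 / real r - \<beta> ^ 3) * real n < \<mu>\<^sub>0"
  shows "embeds_K_plus V (log_sizes r c n) \<or>
    (\<exists>S f. S \<subseteq> V \<and> S \<noteq> {} \<and> proper_colouring r S f \<and> (1 - 4 * \<beta>) * real n \<le> real (card S) \<and>
      (\<forall>v\<in>S. (1 - 1 / real r - 7 * \<beta>) * real n < real (card (nbrs S v))))"
proof -
  define R where "R = real r"
  define N where "N = real n"
  define u where "u = 1 / R"
  define a where "a = 1 - u"
  define b where "b = \<beta> ^ 3"
  have R: "R \<ge> 2" using r by (simp add: R_def)
  have u: "u > 0" "u \<le> 1 / 2" "R * u = 1" using R by (auto simp: u_def field_simps)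
  have ru: "1 / real r = u" by (simp add: u_def R_def)
  have b: "b > 0" "b \<le> u ^ 6 / 1024" using \<beta> by (auto simp: b_def ru)
  have N20: "R ^ 20 \<le> N" unfolding R_def N_def by (rule order_ge_of_log[OF r n c])
  have N5: "N * u ^ 5 \<ge> 32768" and N4: "N * u ^ 4 \<ge> 65536"
  proof -
    have *: "R ^ 20 * u ^ k = R ^ (20 - k)" if "k \<le> 20" for k
    proof -
      have "R ^ 20 * u ^ k = R ^ (20 - k) * (R ^ k * u ^ k)"
        using that by (simp add: power_add[symmetric] flip: mult.assoc)
      then show ?thesis using u(3) by (simp add: power_mult_distrib[symmetric])
    qed
    have "2 ^ (20 - k) \<le> N * u ^ k" if "k \<le> 20" for k
    proof -
      have "2 ^ (20 - k) \<le> R ^ (20 - k)" using R by (intro power_mono) auto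
      also have "\<dots> = R ^ 20 * u ^ k" using *[OF that] by simp
      also have "\<dots> \<le> N * u ^ k" using N20 u by (intro mult_right_mono) auto
      finally show ?thesis .
    qed
    from this[of 5] this[of 4] show "N * u ^ 5 \<ge> 32768" "N * u ^ 4 \<ge> 65536" by simp_all
  qed
  have u4: "u ^ 4 > 0" "u ^ 4 \<le> 1" using u by (auto intro: power_le_one)
  have N0: "N > 0" using n by (simp add: N_def)
  have "N * u ^ 4 \<le> N * 1" using u4 N0 by (intro mult_left_mono) auto
  then have N1: "N \<ge> 65536" using N4 by linarith
  have u6: "u ^ 6 \<le> u ^ 4 / 4"
  proof -
    have "u ^ 6 = u ^ 4 * u ^ 2" by (simp add: power_add[symmetric])
    also have "\<dots> \<le> u ^ 4 * (1 / 2) ^ 2" using u u4 by (intro mult_left_mono power_mono) auto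
    finally show ?thesis by (simp add: power_divide)
  qed
  have ab: "a - b \<ge> 49 / 100" using b u6 u4 u by (simp add: a_def)
  have \<mu>0: "(a - b) * N \<le> \<mu>\<^sub>0" using \<mu>\<^sub>0 by (simp add: a_def b_def N_def ru)
  have "0 < (a - b) * N" using ab N0 by (intro mult_pos_pos) auto
  then have \<mu>0pos: "\<mu>\<^sub>0 > 0" using \<mu>0 by linarith
  \<comment> \<open>Smaller than the distance \<open>u ^ 4 / 48\<close> between \<tau> and
    \<open>a\<close>: the remaining \<open>u ^ 4 / 192\<close> absorbs \<open>b\<close> and the
    lower-order terms in \<open>gap\<close>.\<close>
  define e where "e = u ^ 4 / 64"
  define g where "g = 2 * e / (1 + 2 * e)"
  define \<tau> where "\<tau> = a - u ^ 4 / 48"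
  have g33: "u ^ 4 / 33 \<le> g" unfolding g_def e_def using u by (intro deletion_gain_lower) auto
  define K where "K = n div (2 * r)"
  have K: "N * u / 2 - 1 \<le> real K" "real K \<le> N * u / 2"
  proof -
    have eq: "N * u / 2 = real n / real (2 * r)" by (simp add: N_def u_def R_def)
    show "real K \<le> N * u / 2" unfolding eq K_def by (rule of_nat_div_le_of_nat)
    have "n < 2 * r * (K + 1)"
      using dividend_less_times_div[of "2 * r" n] r by (simp add: K_def algebra_simps)
    then have "real n < real (2 * r) * (real K + 1)" by (metis of_nat_1 of_nat_add of_nat_less_iff of_nat_mult)
    then have "real n / real (2 * r) < real K + 1" using r by (simp add: pos_divide_less_eq mult.commute)
    then have "real n / real (2 * r) - 1 \<le> real K" by simp
    then show "N * u / 2 - 1 \<le> real K" unfolding eq .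
  qed
  have K4: "real K \<le> N / 4"
  proof -
    have "N * u \<le> N * (1 / 2)" using u N0 by (intro mult_left_mono) auto
    then show ?thesis using K by linarith
  qed
  have K3: "K + 3 \<le> n"
  proof -
    have "real K + 3 \<le> real n" using K4 N1 by (simp add: N_def)
    then show ?thesis by linarith
  qed
  have gap: "\<tau> * real m \<le> \<mu>\<^sub>0 * (real m - 1) / (real n - 1) - e * real m" if m: "n - K \<le> m" "m \<le> n" for m
  proof -
    have mN: "real m \<ge> N / 2" using m K4 K3 by (simp add: N_def)
    have "(a - b) * (real m - 1) * (N - 1) \<le> (a - b) * (real m - 1) * N"
      using ab mN N1 by (intro mult_left_mono mult_nonneg_nonneg) auto
    also have "\<dots> = ((a - b) * N) * (real m - 1)" by simp
    also have "\<dots> \<le> \<mu>\<^sub>0 * (real m - 1)" using \<mu>0 mN N1 by (intro mult_right_mono) auto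
    finally have "(a - b) * (real m - 1) \<le> \<mu>\<^sub>0 * (real m - 1) / (N - 1)"
      using N1 by (simp add: pos_le_divide_eq)
    moreover have "(\<tau> + e) * real m \<le> (a - b) * (real m - 1)"
    proof -
      have "b \<le> u ^ 4 / 4096" using b u6 by linarith
      then have "\<tau> + e \<le> a - b - u ^ 4 / 256" using u4 unfolding \<tau>_def e_def by linarith
      then have "(\<tau> + e) * real m \<le> (a - b - u ^ 4 / 256) * real m" by (intro mult_right_mono) auto
      also have "\<dots> = (a - b) * real m - real m * u ^ 4 / 256" by (simp add: algebra_simps)
      finally have "(\<tau> + e) * real m \<le> (a - b) * real m - real m * u ^ 4 / 256" .
      moreover have "N * u ^ 4 / 2 \<le> real m * u ^ 4"
        using mult_right_mono[OF mN, of "u ^ 4"] u4 by simp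
      moreover have "a - b \<le> 1" using u b by (simp add: a_def)
      moreover have "(a - b) * (real m - 1) = (a - b) * real m - (a - b)" by (simp only: right_diff_distrib mult_1_right)
      ultimately show ?thesis using N4 by linarith
    qed
    ultimately show ?thesis by (simp add: N_def algebra_simps)
  qed
  have e0: "e \<ge> 0" using u4 by (simp add: e_def)
  obtain S k \<mu> x where S: "S \<subseteq> V" "k \<le> K" "card S = n - k" "perron S \<mu> x"
    and \<mu>: "\<mu>\<^sub>0 * (real n - real k - 1) * (1 + g / real n) ^ k \<le> \<mu> * (real n - 1)"
    and stop: "(\<forall>v\<in>S. real (card (nbrs S v)) > \<tau> * real (card S)) \<or> k = K"
    using deletion_process[OF V P\<^sub>0 \<mu>0pos e0 K3 gap] unfolding g_def by blast
  define m where "m = n - k"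
  have m: "card S = m" "real m = N - real k" using S K3 by (auto simp: m_def N_def of_nat_diff)
  have finS: "finite S" using S(1) V(1) finite_subset by blast
  have k4: "real k \<le> N / 4" and kK: "real k \<le> N * u / 2" using S(2) K4 K(2) by linarith+
  have m_large: "(1 - 1 / (2 * real r)) * real n \<le> real m"
    using kK m(2) by (simp add: N_def u_def R_def algebra_simps)
  have m0: "m > 0"
  proof -
    have "real m > 0" using k4 m N0 by simp
    then show ?thesis by simp
  qed
  have g0: "g \<ge> 0" using g33 u4 by linarith
  have \<mu>1: "\<mu>\<^sub>0 * (real m - 1) * (1 + real k * (g / N)) \<le> \<mu> * (N - 1)"
  proof -
    have "1 + real k * (g / N) \<le> (1 + g / N) ^ k"
      using g0 N0 by (intro Bernoulli_inequality) (simp add: order_trans[of "-1" 0])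
    then have "\<mu>\<^sub>0 * (real m - 1) * (1 + real k * (g / N)) \<le> \<mu>\<^sub>0 * (real m - 1) * (1 + g / N) ^ k"
      using \<mu>0pos m0 by (intro mult_left_mono mult_nonneg_nonneg) auto
    then show ?thesis using \<mu> m(2) by (simp add: N_def)
  qed
  show ?thesis
  proof (cases "\<forall>v\<in>S. real (card (nbrs S v)) > \<tau> * real m")
    case False
    with stop m have k: "k = K" by auto
    have "(a + u ^ 5 / 256) * real m \<le> \<mu>"
      using density_gain[OF u(1,2) a_def less_imp_le[OF b(1)] b(2) N5 K, of "real m" g \<mu>\<^sub>0 \<mu>] g33 \<mu>0 \<mu>1 m k by simp
    then have "(1 - 1 / real r + (1 / real r) ^ 5 / 256) * real m \<le> \<mu>" by (simp add: a_def ru)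
    from embeds_K_plus_of_dense[OF r n c V S(1) m(1) S(4) m_large this] show ?thesis by blast
  next
    case True
    have eps: "1 / (48 * real r ^ 4) = u ^ 4 / 48" by (simp add: u_def R_def power_one_over)
    have deg: "real (card (nbrs S v)) \<ge> (1 - 1 / real r - 1 / (48 * real r ^ 4)) * real m" if "v \<in> S" for v
      using True that unfolding eps ru \<tau>_def a_def by (simp add: less_imp_le)
    show ?thesis
    proof (cases "\<exists>y\<in>S. \<exists>z\<in>S. E y z \<and> 1 / (32 * real r ^ (2 * r + 9)) * real m ^ (r - 1) <
        real (card (cliques (r - 1) (nbrs S y \<inter> nbrs S z)))")
      case True
      then obtain y z where "y \<in> S" "z \<in> S" "E y z"
        "1 / (32 * real r ^ (2 * r + 9)) * real m ^ (r - 1) < real (card (cliques (r - 1) (nbrs S y \<inter> nbrs S z)))"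
        by blast
      from embeds_K_plus_of_joint_min_degree[OF r n c V S(1) m(1) m_large deg this] show ?thesis by blast
    next
      case False
      have "\<exists>f. proper_colouring r S f"
        using False by (intro partite_of_small_joints[OF finS m(1) m0 r deg]) (auto simp: not_less)
      then obtain f where f: "proper_colouring r S f" by blast
      have "\<mu> \<le> a * real m"
        using perron_le_of_proper_colouring[OF finS S(4) f] r m(1) by (simp add: a_def ru)
      moreover have "b \<le> 1 / 100" using b u6 u4 by linarith
      ultimately have few: "real k * u ^ 4 \<le> 70 * b * N" "(a - 2 * b) * real m \<le> \<mu>"
        using few_deletions[OF u(1,2) a_def less_imp_le[OF b(1)] _ N4 _ k4 m(2) g33 \<mu>0 \<mu>1] by auto
      \<comment> \<open>Here the bound \<open>b < 2 ^ (-10) * r ^ (-6)\<close> pays off: it turns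
        the \<open>r\<close>-dependent number \<open>70 * b * r ^ 4 * n\<close> of deletions into at
        most \<open>7 / 10 * \<beta> * n\<close>, so the constants of the conclusion are free of
        \<open>r\<close>.\<close>
      have \<beta>u: "\<beta> \<le> u\<^sup>2 / 10"
      proof -
        have "\<beta> ^ 3 \<le> (u\<^sup>2 / 10) ^ 3"
        proof -
          have "(u\<^sup>2 / 10) ^ 3 = u ^ 6 / 1000" by (simp add: power_divide power_mult[symmetric])
          moreover have "u ^ 6 > 0" using u by simp
          ultimately show ?thesis using b unfolding b_def by linarith
        qed
        then show ?thesis using power_le_imp_le_base[of \<beta> 2 "u\<^sup>2 / 10"] by (simp add: numeral_3_eq_3)
      qed
      have u2: "u\<^sup>2 \<le> 1 / 4" using power_mono[OF u(2), of 2] u by (simp add: power_divide)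
      then have \<beta>40: "\<beta> \<le> 1 / 40" using \<beta>u by linarith
      have "real k \<le> 7 / 10 * \<beta> * N"
      proof -
        have "\<beta>\<^sup>2 \<le> (u\<^sup>2 / 10)\<^sup>2" using \<beta>u \<beta> by (intro power_mono) auto
        also have "\<dots> = u ^ 4 / 100" by (simp add: power_divide power_mult[symmetric])
        finally have A: "70 * (\<beta>\<^sup>2 * (\<beta> * N)) \<le> 70 * (u ^ 4 / 100 * (\<beta> * N))"
          using \<beta> N0 by (intro mult_left_mono mult_right_mono) auto
        have "70 * b * N = 70 * (\<beta>\<^sup>2 * (\<beta> * N))" by (simp add: b_def eval_nat_numeral)
        from order_trans[OF few(1)[unfolded this] A]
        have "u ^ 4 * real k \<le> u ^ 4 * (7 / 10 * \<beta> * N)" by (simp add: mult_ac)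
        then show ?thesis using u4 by (simp only: mult_le_cancel_left_pos)
      qed
      then have mN: "(1 - 7 / 10 * \<beta>) * N \<le> real m" using m(2) by (simp add: algebra_simps)
      have mle: "real m \<le> N" using m(2) by simp
      \<comment> \<open>The deficit has grown to \<open>2 * b\<close>, and \<beta> itself is the
        threshold for missing neighbours. In multiples of \<beta> the losses in degree are then at
        most \<open>0.7 + 1 + 0.22 < 2\<close>, apart from the deleted vertices.\<close>
      obtain B where B: "B \<subseteq> S" "real (card B) \<le> (16 * (2 * b) + 4 * (2 * b) / \<beta>) * real m"
        and Bdeg: "\<And>v. v \<in> S - B \<Longrightarrow> real (card (nbrs (S - B) v)) >
          (1 - 1 / real r - 3 * sqrt (2 * b) - \<beta> - (16 * (2 * b) + 4 * (2 * b) / \<beta>)) * real m"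
        using partite_near_regular[OF finS m(1) m0 S(4) f r, of "2 * b" \<beta>] few(2) b \<beta>
        by (auto simp: a_def ru)
      have small: "16 * (2 * b) + 4 * (2 * b) / \<beta> \<le> 22 / 100 * \<beta>"
      proof -
        have "\<beta>\<^sup>2 \<le> 1 / 40 * \<beta>" using \<beta> \<beta>40 by (simp add: power2_eq_square mult_right_mono)
        moreover have "\<beta> ^ 3 = \<beta>\<^sup>2 * \<beta>" by (simp add: eval_nat_numeral)
        moreover have "\<beta>\<^sup>2 * \<beta> \<le> \<beta>\<^sup>2 * (1 / 40)" using \<beta>40 by (intro mult_left_mono) auto
        moreover have "4 * (2 * b) / \<beta> = 8 * \<beta>\<^sup>2" using \<beta> by (simp add: b_def eval_nat_numeral)
        ultimately show ?thesis unfolding b_def by linarith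
      qed
      have root: "3 * sqrt (2 * b) \<le> 7 / 10 * \<beta>"
      proof -
        have "2 * b \<le> (7 / 30 * \<beta>)\<^sup>2"
        proof -
          have "\<beta>\<^sup>2 * \<beta> \<le> \<beta>\<^sup>2 * (1 / 40)" using \<beta>40 by (intro mult_left_mono) auto
          moreover have "\<beta> ^ 3 = \<beta>\<^sup>2 * \<beta>" by (simp add: eval_nat_numeral)
          moreover have "(7 / 30 * \<beta>)\<^sup>2 = 49 / 900 * \<beta>\<^sup>2" by (simp add: power_mult_distrib power_divide)
          moreover have "\<beta>\<^sup>2 \<ge> 0" by simp
          ultimately show ?thesis unfolding b_def by linarith
        qed
        then have "sqrt (2 * b) \<le> 7 / 30 * \<beta>" using \<beta> by (intro real_le_lsqrt) auto
        then show ?thesis by simp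
      qed
      have cardB: "real (card B) \<le> 22 / 100 * \<beta> * N"
      proof -
        have "(16 * (2 * b) + 4 * (2 * b) / \<beta>) * real m \<le> (22 / 100 * \<beta>) * N"
          using small mle \<beta> by (intro mult_mono) auto
        with B(2) show ?thesis by linarith
      qed
      have "finite B" using B(1) finS finite_subset by blast
      then have "real (card (S - B)) = real m - real (card B)"
        using B(1) finS m(1) card_mono[OF finS B(1)] by (simp add: card_Diff_subset of_nat_diff)
      then have size: "(1 - 4 * \<beta>) * N \<le> real (card (S - B))"
        using cardB mN \<beta> N0 by (simp add: algebra_simps)
      have "0 < (1 - 4 * \<beta>) * N" using \<beta>40 N0 by (intro mult_pos_pos) auto
      then have "S - B \<noteq> {}" using size by (metis card.empty less_le_not_le of_nat_0)
      moreover have "proper_colouring r (S - B) f" using f by (auto simp: proper_colouring_def)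
      moreover have "(1 - 1 / real r - 7 * \<beta>) * N < real (card (nbrs (S - B) v))" if "v \<in> S - B" for v
      proof -
        have "(1 - 1 / real r - 7 * \<beta>) * N \<le> (a - 2 * \<beta>) * ((1 - 7 / 10 * \<beta>) * N)"
        proof -
          have "a * \<beta> \<le> 1 * \<beta>" using \<beta> u by (intro mult_right_mono) (auto simp: a_def)
          moreover have "\<beta> * \<beta> \<ge> 0" by simp
          moreover have eq: "(a - 2 * \<beta>) * (1 - 7 / 10 * \<beta>) = a - 2 * \<beta> - 7 / 10 * (a * \<beta>) + 14 / 10 * (\<beta> * \<beta>)"
            by (simp add: field_simps)
          ultimately have "1 - 1 / real r - 7 * \<beta> \<le> (a - 2 * \<beta>) * (1 - 7 / 10 * \<beta>)"
            using \<beta>(1) unfolding eq ru a_def by linarith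
          then have "(1 - 1 / real r - 7 * \<beta>) * N \<le> ((a - 2 * \<beta>) * (1 - 7 / 10 * \<beta>)) * N"
            using N0 by (intro mult_right_mono) auto
          then show ?thesis by (simp only: mult.assoc)
        qed
        also have "\<dots> \<le> (a - 2 * \<beta>) * real m" using mN \<beta>40 u by (intro mult_left_mono) (auto simp: a_def)
        also have "\<dots> \<le> (1 - 1 / real r - 3 * sqrt (2 * b) - \<beta> - (16 * (2 * b) + 4 * (2 * b) / \<beta>)) * real m"
          using small root \<beta> unfolding ru a_def by (intro mult_right_mono) linarith+
        also have "\<dots> < real (card (nbrs (S - B) v))" by (rule Bdeg[OF that])
        finally show ?thesis .
      qed
      ultimately show ?thesis using size S(1) unfolding N_def by (intro disjI2 exI[of _ "S - B"] exI[of _ f]) auto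
    qed
  qed
qed

end

section \<open>The theorem for digraphs\<close>

lemma adjacency_dominates:
  assumes "graph G"
  shows "adjacency (\<lambda>u v. u \<rightarrow>\<^bsub>G\<^esub> v)"
proof -
  interpret graph G by (rule assms)
  show ?thesis
  proof
    show "v \<rightarrow>\<^bsub>G\<^esub> u" if "u \<rightarrow>\<^bsub>G\<^esub> v" for u v
      using that sym_arcs by (rule arcs_ends_symmetric[rotated])
    show "\<not> u \<rightarrow>\<^bsub>G\<^esub> u" for u using adj_not_same by blast
  qed
qed

text \<open>Every eigenvalue is a value of the Rayleigh quotient, which \<mu> bounds. Since
  \<open>max_eigenvalue\<close> is a \<open>Max\<close>, the set of eigenvalues must also be finite,
  by the characteristic polynomial, and nonempty, by the Perron vector.\<close>

lemma max_eigenvalue_le_perron: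
  assumes G: "graph G" and P: "adjacency.perron (\<lambda>u v. u \<rightarrow>\<^bsub>G\<^esub> v) (verts G) \<mu> x"
  shows "max_eigenvalue G \<le> \<mu>"
proof -
  interpret graph G by (rule G)
  interpret adjacency "\<lambda>u v. u \<rightarrow>\<^bsub>G\<^esub> v" by (rule adjacency_dominates[OF G])
  obtain vs where vs: "set vs = verts G" "distinct vs"
    using finite_distinct_list[OF finite_verts] by blast
  let ?A = "adjacency_matrix G vs"
  let ?eig = "\<lambda>k. \<exists>z :: 'a \<Rightarrow> real. (\<exists>v\<in>verts G. z v \<noteq> 0) \<and>
       (\<forall>v\<in>verts G. (\<Sum>u\<in>{u\<in>verts G. v \<rightarrow>\<^bsub>G\<^esub> u}. z u) = k * z v)"
  have iff: "k \<in> graph_eigenvalues G \<longleftrightarrow> ?eig k" for k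
    unfolding graph_eigenvalues_def using eigenvalue_adjacency_matrix_iff vs by blast
  have "graph_eigenvalues G = {k. eigenvalue ?A k}"
    using iff eigenvalue_adjacency_matrix_iff[OF vs(2,1)] by blast
  moreover have A: "?A \<in> carrier_mat (length vs) (length vs)" by (simp add: adjacency_matrix_def)
  moreover have "{k. eigenvalue ?A k} = {k. poly (char_poly ?A) k = 0}"
    using eigenvalue_root_char_poly[OF A] by blast
  moreover have "char_poly ?A \<noteq> 0" using degree_monic_char_poly[OF A] by (metis coeff_0 zero_neq_one)
  ultimately have fin: "finite (graph_eigenvalues G)" using poly_roots_finite[of "char_poly ?A"] by simp
  have nb: "nbrs (verts G) v = {u\<in>verts G. v \<rightarrow>\<^bsub>G\<^esub> u}" for v by (simp add: nbrs_def)
  have "?eig \<mu>"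
  proof (intro exI[of _ x] conjI)
    show "\<exists>v\<in>verts G. x v \<noteq> 0"
    proof (rule ccontr)
      assume "\<not> ?thesis"
      then have "(\<Sum>v\<in>verts G. (x v)\<^sup>2) = 0" by (intro sum.neutral) auto
      with P show False by (simp add: perron_def)
    qed
    show "\<forall>v\<in>verts G. (\<Sum>u\<in>{u\<in>verts G. v \<rightarrow>\<^bsub>G\<^esub> u}. x u) = \<mu> * x v"
      using P unfolding perron_def nb by blast
  qed
  then have ne: "graph_eigenvalues G \<noteq> {}" using iff by blast
  have "k \<le> \<mu>" if "k \<in> graph_eigenvalues G" for k
  proof -
    have "?eig k" using that by (simp only: iff)
    then obtain z :: "'a \<Rightarrow> real" where ex: "\<exists>v\<in>verts G. z v \<noteq> 0"
      and z: "\<forall>v\<in>verts G. sum z (nbrs (verts G) v) = k * z v"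
      unfolding nb by (elim exE conjE)
    from ex obtain v where v: "v \<in> verts G" "z v \<noteq> 0" by blast
    have "quad_form (verts G) z = (\<Sum>u\<in>verts G. k * (z u)\<^sup>2)"
      unfolding quad_form_eq[OF finite_verts] using z
      by (intro sum.cong refl) (simp add: power2_eq_square)
    then have "quad_form (verts G) z = k * (\<Sum>u\<in>verts G. (z u)\<^sup>2)" by (simp only: sum_distrib_left)
    moreover have "quad_form (verts G) z \<le> \<mu> * (\<Sum>u\<in>verts G. (z u)\<^sup>2)"
      using P unfolding perron_def by blast
    ultimately have "k * (\<Sum>u\<in>verts G. (z u)\<^sup>2) \<le> \<mu> * (\<Sum>u\<in>verts G. (z u)\<^sup>2)" by simp
    moreover have "(\<Sum>u\<in>verts G. (z u)\<^sup>2) > 0"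
      using v by (intro sum_pos2[of _ v]) auto
    ultimately show ?thesis by simp
  qed
  then show ?thesis unfolding max_eigenvalue_def using fin ne by simp
qed

lemma out_degree_induce_subgraph:
  assumes G: "graph G" and v: "v \<in> S"
  shows "out_degree (G \<restriction> S) v = card {u\<in>S. v \<rightarrow>\<^bsub>G\<^esub> u}"
proof -
  interpret graph G by (rule G)
  have "bij_betw (head G) (out_arcs (G \<restriction> S) v) {u\<in>S. v \<rightarrow>\<^bsub>G\<^esub> u}"
  proof (rule bij_betw_imageI)
    show "inj_on (head G) (out_arcs (G \<restriction> S) v)"
      by (rule inj_onI) (auto simp: arc_to_ends_def intro: no_multi_arcs)
    show "head G ` out_arcs (G \<restriction> S) v = {u\<in>S. v \<rightarrow>\<^bsub>G\<^esub> u}"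
      using v by (auto simp: arcs_ends_def arc_to_ends_def image_iff)
  qed
  then show ?thesis by (simp add: out_degree_def bij_betw_same_card)
qed

theorem theorem5:
  fixes r n :: nat and b c :: real and G :: "('a, 'b) pre_digraph"
  assumes "r \<ge> 2"
    and "n > 0"
    and "2 / ln (real n) \<le> c"
    and "c \<le> real r powi (- int ((2 * r + 9) * (r + 1))) / 2"
    and "0 < b"
    and "b < 2 powi (-10) * real r powi (-6)"
    and "graph G"
    and "card (verts G) = n"
    and "max_eigenvalue G > (1 - 1 / real r - b) * real n"
  shows "contains_copy G
           (with_proj (K_plus (replicate (r - 1) (nat \<lfloor>c * ln (real n)\<rfloor>)
              @ [nat \<lceil>real n powr (1 - 2 * sqrt c)\<rceil>]))) \<or>
         (\<exists>G\<^sub>0. induced_subgraph G\<^sub>0 G \<and> r_partite r G\<^sub>0 \<and>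
            real (card (verts G\<^sub>0)) \<ge> (1 - 4 * b powr (1 / 3)) * real n \<and>
            real (min_degree G\<^sub>0) > (1 - 1 / real r - 7 * b powr (1 / 3)) * real n)"
proof -
  interpret graph G by (rule assms(7))
  interpret adjacency "\<lambda>u v. u \<rightarrow>\<^bsub>G\<^esub> v" by (rule adjacency_dominates[OF assms(7)])
  define \<beta> where "\<beta> = b powr (1 / 3)"
  have \<beta>: "\<beta> > 0" "\<beta> ^ 3 = b"
    using assms(5) by (simp_all add: \<beta>_def powr_realpow[symmetric] powr_powr)
  have b: "b < (1 / real r) ^ 6 / 1024"
    using assms(1,6) by (simp add: power_int_minus power_one_over field_simps)
  have c: "c \<le> 1 / (2 * real r ^ ((2 * r + 9) * (r + 1)))"
    using assms(4) by (simp only: power_int_minus power_int_of_nat) (simp add: field_simps)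
  have ne: "verts G \<noteq> {}" using assms(2,8) by auto
  obtain \<mu> x where P: "perron (verts G) \<mu> x" using ex_perron[OF finite_verts ne] by blast
  have \<mu>: "(1 - 1 / real r - b) * real n < \<mu>"
    using max_eigenvalue_le_perron[OF assms(7) P] assms(9) by linarith
  have b1: "1 - 1 / real r - b > 0"
  proof -
    have "1 / real r \<le> 1 / 2" using assms(1) by simp
    moreover have "(1 / real r) ^ 6 \<le> 1" by (rule power_le_one) (use assms(1) in auto)
    ultimately show ?thesis using b by linarith
  qed
  \<comment> \<open>For \<open>n = 1\<close> the quotient \<open>2 / ln n\<close> is
    \<open>0\<close> by convention, so the bounds on \<open>c\<close> do not exclude this case. A
    single vertex is properly coloured with one colour, which gives \<open>\<mu> \<le> 0\<close>,
    against the spectral hypothesis.\<close>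
  have n2: "n \<ge> 2"
  proof (rule ccontr)
    assume "\<not> n \<ge> 2"
    then have n1: "n = 1" using assms(2) by simp
    then obtain v where v: "verts G = {v}" using assms(8) card_1_singletonE by metis
    have "proper_colouring 1 (verts G) (\<lambda>_. 0)"
      unfolding proper_colouring_def v using E_irrefl by auto
    from perron_le_of_proper_colouring[OF finite_verts P this] have "\<mu> \<le> 0" by simp
    with \<mu> b1 n1 show False by simp
  qed
  from spectral_stability[OF assms(1) n2 assms(3) c \<beta>(1) _ finite_verts assms(8) P] b \<mu> \<beta>(2)
  consider "embeds_K_plus (verts G) (log_sizes r c n)"
    | S f where "S \<subseteq> verts G" "S \<noteq> {}" "proper_colouring r S f" "(1 - 4 * \<beta>) * real n \<le> real (card S)"
      "\<forall>v\<in>S. (1 - 1 / real r - 7 * \<beta>) * real n < real (card (nbrs S v))"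
    by auto
  then show ?thesis
  proof cases
    case 1
    then show ?thesis using contains_copy_K_plus[OF assms(7)] adjacency_axioms by blast
  next
    case (2 S f)
    have finS: "finite S" using 2(1) finite_verts finite_subset by blast
    have "induced_subgraph (G \<restriction> S) G" using 2(1) by (rule induced_induce)
    moreover have "r_partite r (G \<restriction> S)"
      unfolding r_partite_def
    proof (intro exI[of _ "\<lambda>i. {v\<in>S. f v = i}"] conjI)
      show "disjoint_family_on (\<lambda>i. {v \<in> S. f v = i}) {..<r}" by (auto simp: disjoint_family_on_def)
      show "(\<Union>i<r. {v \<in> S. f v = i}) = verts (G \<restriction> S)"
        using 2(3) by (auto simp: proper_colouring_def)
      have "\<not> u \<rightarrow>\<^bsub>G \<restriction> S\<^esub> v" if "u \<in> S" "v \<in> S" "f u = f v" for u v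
        using 2(3) that dominates_induce_subgraphD[of u v G S] unfolding proper_colouring_def by metis
      then show "\<forall>i<r. independent_set (G \<restriction> S) {v \<in> S. f v = i}"
        by (auto simp: independent_set_def)
    qed
    moreover have "(1 - 4 * b powr (1 / 3)) * real n \<le> real (card (verts (G \<restriction> S)))"
      using 2(4) by (simp add: \<beta>_def)
    moreover have "(1 - 1 / real r - 7 * b powr (1 / 3)) * real n < real (min_degree (G \<restriction> S))"
    proof -
      have "min_degree (G \<restriction> S) \<in> out_degree (G \<restriction> S) ` S"
        unfolding min_degree_def induce_subgraph_verts using finS 2(2) by (intro Min_in) auto
      then obtain v where "v \<in> S" "min_degree (G \<restriction> S) = card (nbrs S v)"
        using out_degree_induce_subgraph[OF assms(7)] by (auto simp: nbrs_def)
      then show ?thesis using 2(5) by (simp add: \<beta>_def)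
    qed
    ultimately show ?thesis by blast
  qed
qed

end
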